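(* Let $\mathcal F_{\mathfrak h}$ be the free superfermion PVA over a field $\mathbb F$ of characteristic $0$ associated to a finite-dimensional superspace $\mathfrak h$ with a super-skewsymmetric nondegenerate bilinear form. Then $$H^0_{\mathrm{PV}}(\mathcal F_{\mathfrak h},\mathcal F_{\mathfrak h})\simeq\mathbb F\,{\textstyle\int}1,\qquad H^n_{\mathrm{PV}}(\mathcal F_{\mathfrak h},\mathcal F_{\mathfrak h})=0\quad\text{for all } n\ge1.$$
   Context: $\mathbb F$ is a field of characteristic $0$. All superspaces are over $\mathbb F$, with parity $p$; $\bar p=1-p$ is the opposite parity. Formulas with signs are for parity-homogeneous elements. For an $\mathbb F[\partial]$-module $R$, $\int:R\to R/\partial R$ is the quotient map. PVA: a Poisson vertex superalgebra is a commutative (in the super sense) associative unital superalgebra $\mathcal V$ with an even derivation $\partial$ and a parity-preserving bilinear map $\mathcal V\otimes\mathcal V\to\mathcal V[\lambda]$, $a\otimes b\mapsto[a_\lambda b]$ ($\lambda$ even), with $[\partial a_\lambda b]=-\lambda[a_\lambda b]$, $[a_\lambda\partial b]=(\lambda+\partial)[a_\lambda b]$, $[a_\lambda b]=-(-1)^{p(a)p(b)}[b_{-\lambda-\partial}a]$ ($\partial$ acting from the left on coefficients), $[a_\lambda[b_\mu c]]-(-1)^{p(a)p(b)}[b_\mu[a_\lambda c]]=[[a_\lambda b]_{\lambda+\mu}c]$, and $[a_\lambda bc]=[a_\lambda b]c+(-1)^{p(b)p(c)}[a_\lambda c]b$. Variational PVA cohomology of $\mathcal V$ with coefficients in the adjoint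 module $M=\mathcal V$ (with $a_\lambda m=[a_\lambda m]$): $C^n_{\mathrm{PV}}(\mathcal V,M)$, $n\ge0$, is the superspace of linear maps $Y:\mathcal V^{\otimes n}\to M[\lambda_1,\dots,\lambda_n]/\langle\partial+\lambda_1+\cdots+\lambda_n\rangle$ ($\langle\Phi\rangle$ = image of $\Phi$), with parity $\bar p(Y)$ given by $\bar p(Y(a_1\otimes\cdots\otimes a_n))=\bar p(Y)+\sum\bar p(a_i)$, satisfying: sesquilinearity $Y_{\lambda_1,\dots,\lambda_n}(\cdots\otimes\partial a_i\otimes\cdots)=-\lambda_iY_{\lambda_1,\dots,\lambda_n}(\cdots\otimes a_i\otimes\cdots)$; symmetry: $Y$ is multiplied by $(-1)^{\bar p(a_i)\bar p(a_{i+1})}$ when $a_i,a_{i+1}$ and $\lambda_i,\lambda_{i+1}$ are simultaneously interchanged; Leibniz rules $Y(\cdots\otimes b_ic_i\otimes\cdots)=(-1)^{p(b_i)s_i}(e^{\partial\partial_{\lambda_i}}b_i)Y(\cdots\otimes c_i\otimes\cdots)+(-1)^{p(c_i)(p(b_i)+s_i)}(e^{\partial\partial_{\lambda_i}}c_i)Y(\cdots\otimes b_i\otimes\cdots)$, where $s_i=\bar p(Y)+\bar p(a_1)+\dots+\bar p(a_{i-1})$ and $(e^{\partial\partial_\lambda}a)P(\lambda)=\sum_{k\ge0}\frac1{k!}(\partial^ka)\frac{d^kP}{d\lambda^k}$. In particular $C^0_{\mathrm{PV}}=M/\partial M$. The differential $d:C^n_{\mathrm{PV}}\to C^{n+1}_{\mathrm{PV}}$,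 $d^2=0$, is $$(dY)_{\lambda_0,\dots,\lambda_n}(a_0\otimes\cdots\otimes a_n)=\sum_{i=0}^n(-1)^{\gamma_i}{a_i}_{\lambda_i}Y_{\lambda_0,\overset{i}{\check\dots},\lambda_n}(a_0\otimes\overset{i}{\check\cdots}\otimes a_n)+\sum_{i<j}(-1)^{\gamma_{ij}}Y_{\lambda_i+\lambda_j,\lambda_0,\overset{i}{\check\dots}\overset{j}{\check\dots},\lambda_n}([{a_i}_{\lambda_i}a_j]\otimes a_0\otimes\overset{i}{\check\cdots}\overset{j}{\check\cdots}\otimes a_n),$$ with $\check{}$ meaning omission, $\gamma_i=\bar p(a_i)(\bar p(Y)+\bar p(a_0)+\dots+\bar p(a_{i-1})+1)+1$, $\gamma_{ij}=\bar p(Y)+\bar p(a_i)(\bar p(a_0)+\dots+\bar p(a_{i-1})+1)+\bar p(a_j)(\bar p(a_0)+\overset{i}{\check\dots}+\bar p(a_{j-1}))$. $H^n_{\mathrm{PV}}(\mathcal V,M)=\ker(d|_{C^n_{\mathrm{PV}}})/d(C^{n-1}_{\mathrm{PV}})$. Free superfermion PVA: $\mathfrak h$ is a finite-dimensional superspace with a nondegenerate bilinear form $(\cdot|\cdot)$ such that $(a|b)=-(-1)^{p(a)p(b)}(b|a)$ and $(a|b)=0$ if $p(a)\ne p(b)$. $\mathcal F_{\mathfrak h}=S(\mathbb F[\partial]\otimes\mathfrak h)$ (symmetric superalgebra), with $\partial$ extended as an even derivation and with the unique PVA $\lambda$-bracket such that $[a_\lambda b]=(a|b)1$ for $a,b\in\mathfrak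 h$. *)

theory Defs
  imports
    "HOL-Library.Poly_Mapping"
    "HOL-Library.Set_Algebras"
    "HOL-Computational_Algebra.Polynomial"
begin

section \<open>Superspaces, superalgebras\<close>

text \<open>Parities are the natural numbers 0 and 1; gr p is the homogeneous part of parity p.\<close>

locale superspace = vector_space scale
  for scale :: "'f::field_char_0 \<Rightarrow> 'v::ab_group_add \<Rightarrow> 'v" +
  fixes gr :: "nat \<Rightarrow> 'v set"
  assumes subspace_gr: "p \<le> 1 \<Longrightarrow> subspace (gr p)"
    and gr_disjoint: "gr 0 \<inter> gr 1 = {0}"
    and gr_sum: "\<exists>x\<in>gr 0. \<exists>y\<in>gr 1. v = x + y"
begin

definition hpart :: "nat \<Rightarrow> 'v \<Rightarrow> 'v" where
  "hpart p v = (THE x. x \<in> gr p \<and> v - x \<in> gr (1 - p))"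

end

abbreviation opp :: "nat \<Rightarrow> nat" where
  "opp p \<equiv> 1 - p"

locale superalgebra = superspace scale gr
  for scale :: "'f::field_char_0 \<Rightarrow> 'v::ring_1 \<Rightarrow> 'v" and gr :: "nat \<Rightarrow> 'v set" +
  assumes scale_mult_left: "scale c (a * b) = scale c a * b"
    and scale_mult_right: "scale c (a * b) = a * scale c b"
    and one_even: "1 \<in> gr 0"
    and gr_mult: "p \<le> 1 \<Longrightarrow> q \<le> 1 \<Longrightarrow> a \<in> gr p \<Longrightarrow> b \<in> gr q \<Longrightarrow> a * b \<in> gr ((p + q) mod 2)"

locale supercommutative_algebra = superalgebra scale gr
  for scale :: "'f::field_char_0 \<Rightarrow> 'v::ring_1 \<Rightarrow> 'v" and gr :: "nat \<Rightarrow> 'v set" +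
  assumes supercommute:
    "p \<le> 1 \<Longrightarrow> q \<le> 1 \<Longrightarrow> a \<in> gr p \<Longrightarrow> b \<in> gr q \<Longrightarrow> a * b = (-1) ^ (p * q) * (b * a)"

locale differential_superalgebra = supercommutative_algebra scale gr
  for scale :: "'f::field_char_0 \<Rightarrow> 'v::ring_1 \<Rightarrow> 'v" and gr :: "nat \<Rightarrow> 'v set" +
  fixes D :: "'v \<Rightarrow> 'v"
  assumes D_add: "D (a + b) = D a + D b"
    and D_scale: "D (scale c a) = scale c (D a)"
    and D_even: "p \<le> 1 \<Longrightarrow> a \<in> gr p \<Longrightarrow> D a \<in> gr p"
    and D_mult: "D (a * b) = D a * b + a * D b"


section \<open>Polynomials with coefficients in a not necessarily commutative ring\<close>

text \<open>
  \<open>'v lpoly\<close> is V[\<lambda>]; \<open>'v mpoly\<close> is V[\<lambda>_0, \<lambda>_1, ...], exponents being finitely supported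
  functions. The \<lambda>'s commute with everything. A linear map \<open>f\<close> on coefficients acts as
  \<open>Poly_Mapping.map f\<close>.
\<close>

type_synonym 'v lpoly = "nat \<Rightarrow>\<^sub>0 'v"
type_synonym 'v mpoly = "(nat \<Rightarrow>\<^sub>0 nat) \<Rightarrow>\<^sub>0 'v"

abbreviation lam :: "'v::ring_1 lpoly" where
  "lam \<equiv> Poly_Mapping.single 1 1"

abbreviation lconst :: "'v::zero \<Rightarrow> 'v lpoly" where
  "lconst v \<equiv> Poly_Mapping.single 0 v"

abbreviation mconst :: "'v::zero \<Rightarrow> 'v mpoly" where
  "mconst v \<equiv> Poly_Mapping.single 0 v"

definition mvar :: "nat \<Rightarrow> 'v::ring_1 mpoly" where
  "mvar i = Poly_Mapping.single (Poly_Mapping.single i 1) 1"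

definition mpolys :: "nat \<Rightarrow> 'v::zero mpoly set" where
  "mpolys n = {x. \<forall>m\<in>Poly_Mapping.keys x. Poly_Mapping.keys m \<subseteq> {..<n}}"

text \<open>The value of x in V[\<lambda>_0, ..., \<lambda>_{k-1}] when the \<lambda>'s are replaced by the entries of Ls.\<close>

definition msubst :: "'v::ring_1 mpoly list \<Rightarrow> 'v mpoly \<Rightarrow> 'v mpoly" where
  "msubst Ls x = (\<Sum>m\<in>Poly_Mapping.keys x. mconst (Poly_Mapping.lookup x m) *
     prod_list (map (\<lambda>i. (Ls ! i) ^ Poly_Mapping.lookup m i) [0..<length Ls]))"

definition mderiv :: "nat \<Rightarrow> 'v::ring_1 mpoly \<Rightarrow> 'v mpoly" where
  "mderiv i x = (\<Sum>m\<in>Poly_Mapping.keys x.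
     Poly_Mapping.single (m - Poly_Mapping.single i 1)
       (of_nat (Poly_Mapping.lookup m i) * Poly_Mapping.lookup x m))"

definition omit :: "nat \<Rightarrow> 'a list \<Rightarrow> 'a list" where
  "omit i xs = take i xs @ drop (Suc i) xs"

definition swap_adj :: "nat \<Rightarrow> 'a list \<Rightarrow> 'a list" where
  "swap_adj i xs = xs[i := xs ! Suc i, Suc i := xs ! i]"

definition rep :: "'a set \<Rightarrow> 'a" where
  "rep A = (SOME x. x \<in> A)"


section \<open>Lambda-brackets and Poisson vertex superalgebras\<close>

text \<open>[a_\<Lambda> b] for a polynomial \<Lambda>, and its extension to [a_\<Lambda> x] with x a polynomial.\<close>

definition bracket_at ::
  "('v::ring_1 \<Rightarrow> 'v \<Rightarrow> 'v lpoly) \<Rightarrow> 'v \<Rightarrow> 'v mpoly \<Rightarrow> 'v \<Rightarrow> 'v mpoly" where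
  "bracket_at br a L b =
     (\<Sum>k\<in>Poly_Mapping.keys (br a b). L ^ k * mconst (Poly_Mapping.lookup (br a b) k))"

definition bracket_poly ::
  "('v::ring_1 \<Rightarrow> 'v \<Rightarrow> 'v lpoly) \<Rightarrow> 'v \<Rightarrow> 'v mpoly \<Rightarrow> 'v mpoly \<Rightarrow> 'v mpoly" where
  "bracket_poly br a L x =
     (\<Sum>m\<in>Poly_Mapping.keys x.
        Poly_Mapping.single m 1 * bracket_at br a L (Poly_Mapping.lookup x m))"

text \<open>For q(\<lambda>) = \<Sum> \<lambda>^k c_k this is q(-\<lambda>-\<partial>) = \<Sum> (-\<lambda>-\<partial>)^k c_k.\<close>

definition flip :: "('v::ring_1 \<Rightarrow> 'v) \<Rightarrow> 'v lpoly \<Rightarrow> 'v lpoly" where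
  "flip D q = (\<Sum>k\<in>Poly_Mapping.keys q.
     ((\<lambda>r. - (lam * r) - Poly_Mapping.map D r) ^^ k) (lconst (Poly_Mapping.lookup q k)))"

locale poisson_vertex_superalgebra = differential_superalgebra scale gr D
  for scale :: "'f::field_char_0 \<Rightarrow> 'v::ring_1 \<Rightarrow> 'v"
    and gr :: "nat \<Rightarrow> 'v set" and D :: "'v \<Rightarrow> 'v" +
  fixes br :: "'v \<Rightarrow> 'v \<Rightarrow> 'v lpoly"
  assumes br_add_left: "br (a + a') b = br a b + br a' b"
    and br_add_right: "br a (b + b') = br a b + br a b'"
    and br_scale_left: "br (scale t a) b = Poly_Mapping.map (scale t) (br a b)"
    and br_scale_right: "br a (scale t b) = Poly_Mapping.map (scale t) (br a b)"
    and br_parity: "p \<le> 1 \<Longrightarrow> q \<le> 1 \<Longrightarrow> a \<in> gr p \<Longrightarrow> b \<in> gr q \<Longrightarrow>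
      Poly_Mapping.lookup (br a b) k \<in> gr ((p + q) mod 2)"
    and br_D_left: "br (D a) b = - (lam * br a b)"
    and br_D_right: "br a (D b) = lam * br a b + Poly_Mapping.map D (br a b)"
    and br_skew: "p \<le> 1 \<Longrightarrow> q \<le> 1 \<Longrightarrow> a \<in> gr p \<Longrightarrow> b \<in> gr q \<Longrightarrow>
      br a b = - ((-1) ^ (p * q) * flip D (br b a))"
    and br_jacobi: "p \<le> 1 \<Longrightarrow> q \<le> 1 \<Longrightarrow> a \<in> gr p \<Longrightarrow> b \<in> gr q \<Longrightarrow>
      bracket_poly br a (mvar 0) (bracket_at br b (mvar 1) c)
        - (-1) ^ (p * q) * bracket_poly br b (mvar 1) (bracket_at br a (mvar 0) c)
      = (\<Sum>k\<in>Poly_Mapping.keys (br a b). mvar 0 ^ k *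
           bracket_at br (Poly_Mapping.lookup (br a b) k) (mvar 0 + mvar 1) c)"
    and br_leibniz: "p \<le> 1 \<Longrightarrow> q \<le> 1 \<Longrightarrow> b \<in> gr p \<Longrightarrow> c \<in> gr q \<Longrightarrow>
      br a (b * c) = br a b * lconst c + (-1) ^ (p * q) * (br a c * lconst b)"


section \<open>Variational cohomology with coefficients in the adjoint module\<close>

text \<open>
  Linear maps on the n-th tensor power are encoded as multilinear functions of lists of length n,
  with the conventional value {} on all other lists. Elements of
  V[\<lambda>_0, ..., \<lambda>_{n-1}]/\<langle>\<partial> + \<lambda>_0 + ... + \<lambda>_{n-1}\<rangle> are cosets.
\<close>

type_synonym 'v cochain = "'v list \<Rightarrow> 'v mpoly set"

context poisson_vertex_superalgebra
begin

definition total_deriv :: "nat \<Rightarrow> 'v mpoly set" where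
  "total_deriv n = (\<lambda>x. Poly_Mapping.map D x + (\<Sum>i<n. mvar i) * x) ` mpolys n"

definition qclass :: "nat \<Rightarrow> 'v mpoly \<Rightarrow> 'v mpoly set" where
  "qclass n x = (\<lambda>y. x + y) ` total_deriv n"

text \<open>(e^{\<partial>\<partial>_{\<lambda>_i}} b) x\<close>

definition exp_act :: "nat \<Rightarrow> 'v \<Rightarrow> 'v mpoly \<Rightarrow> 'v mpoly" where
  "exp_act i b x = (\<Sum>k | (mderiv i ^^ k) x \<noteq> 0.
     Poly_Mapping.map (scale (inverse (fact k))) (mconst ((D ^^ k) b) * (mderiv i ^^ k) x))"

definition multilinear :: "nat \<Rightarrow> 'v cochain \<Rightarrow> bool" where
  "multilinear n Y \<longleftrightarrow>
     (\<forall>as. length as \<noteq> n \<longrightarrow> Y as = {}) \<and>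
     (\<forall>as. length as = n \<longrightarrow> Y as \<in> qclass n ` mpolys n) \<and>
     (\<forall>as i a b. length as = n \<and> i < n \<longrightarrow>
        Y (as[i := a + b]) = Y (as[i := a]) + Y (as[i := b])) \<and>
     (\<forall>as i a c. length as = n \<and> i < n \<longrightarrow>
        Y (as[i := scale c a]) = qclass n (Poly_Mapping.map (scale c) (rep (Y (as[i := a])))))"

definition hom_list :: "nat list \<Rightarrow> 'v list \<Rightarrow> bool" where
  "hom_list ps as \<longleftrightarrow>
     length ps = length as \<and> set ps \<subseteq> {0, 1} \<and> (\<forall>i<length as. as ! i \<in> gr (ps ! i))"

text \<open>Here and below, e is the parity of Y with respect to the opposite parity.\<close>

definition has_parity :: "nat \<Rightarrow> nat \<Rightarrow> 'v cochain \<Rightarrow> bool" where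
  "has_parity n e Y \<longleftrightarrow> (\<forall>as ps. length as = n \<and> hom_list ps as \<longrightarrow>
     (\<exists>x\<in>Y as. \<forall>m. Poly_Mapping.lookup x m \<in>
        gr (opp ((e + (\<Sum>i<n. opp (ps ! i))) mod 2))))"

definition sesquilinear :: "nat \<Rightarrow> 'v cochain \<Rightarrow> bool" where
  "sesquilinear n Y \<longleftrightarrow> (\<forall>as i. length as = n \<and> i < n \<longrightarrow>
     Y (as[i := D (as ! i)]) = qclass n (- (mvar i * rep (Y as))))"

definition supersymmetric :: "nat \<Rightarrow> 'v cochain \<Rightarrow> bool" where
  "supersymmetric n Y \<longleftrightarrow> (\<forall>as ps i. length as = n \<and> hom_list ps as \<and> Suc i < n \<longrightarrow>
     qclass n (msubst (swap_adj i (map mvar [0..<n])) (rep (Y (swap_adj i as))))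
       = qclass n ((-1) ^ (opp (ps ! i) * opp (ps ! Suc i)) * rep (Y as)))"

text \<open>In the Leibniz rule, the list \<open>as\<close> supplies the entries other than the i-th one.\<close>

definition leibniz :: "nat \<Rightarrow> nat \<Rightarrow> 'v cochain \<Rightarrow> bool" where
  "leibniz n e Y \<longleftrightarrow> (\<forall>as ps i b c p q. length as = n \<and> hom_list ps as \<and> i < n \<and>
     p \<le> 1 \<and> q \<le> 1 \<and> b \<in> gr p \<and> c \<in> gr q \<longrightarrow>
     (let s = e + (\<Sum>k<i. opp (ps ! k)) in
      Y (as[i := b * c]) = qclass n
        ((-1) ^ (p * s) * exp_act i b (rep (Y (as[i := c])))
         + (-1) ^ (q * (p + s)) * exp_act i c (rep (Y (as[i := b]))))))"

definition hom_cochains :: "nat \<Rightarrow> nat \<Rightarrow> 'v cochain set" where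
  "hom_cochains n e = {Y. multilinear n Y \<and> has_parity n e Y \<and> sesquilinear n Y \<and>
     supersymmetric n Y \<and> leibniz n e Y}"

definition cochain_add :: "'v cochain \<Rightarrow> 'v cochain \<Rightarrow> 'v cochain" where
  "cochain_add Y Y' = (\<lambda>as. Y as + Y' as)"

definition cochain_zero :: "nat \<Rightarrow> 'v cochain" where
  "cochain_zero n = (\<lambda>as. if length as = n then qclass n 0 else {})"

definition cochains :: "nat \<Rightarrow> 'v cochain set" where
  "cochains n = {cochain_add Y0 Y1 | Y0 Y1. Y0 \<in> hom_cochains n 0 \<and> Y1 \<in> hom_cochains n 1}"

text \<open>
  A polynomial representing the differential of Y at a list
  \<open>as\<close> whose entries are homogeneous of parities ps.
\<close>

definition d_formula :: "nat \<Rightarrow> 'v cochain \<Rightarrow> nat list \<Rightarrow> 'v list \<Rightarrow> 'v mpoly" where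
  "d_formula e Y ps as =
    (let N = length as; L = map mvar [0..<N]; q = (\<lambda>i. opp (ps ! i)) in
      (\<Sum>i<N. (-1) ^ (q i * (e + (\<Sum>k<i. q k) + 1) + 1) *
         bracket_poly br (as ! i) (mvar i) (msubst (omit i L) (rep (Y (omit i as)))))
    + (\<Sum>j<N. \<Sum>i<j.
         (-1) ^ (e + q i * ((\<Sum>k<i. q k) + 1) + q j * (\<Sum>k\<in>{..<j} - {i}. q k)) *
         (\<Sum>k\<in>Poly_Mapping.keys (br (as ! i) (as ! j)). mvar i ^ k *
            msubst ((mvar i + mvar j) # omit i (omit j L))
              (rep (Y (Poly_Mapping.lookup (br (as ! i) (as ! j)) k # omit i (omit j as)))))))"

text \<open>For inhomogeneous arguments the formula is extended by multilinearity.\<close>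

definition d_hom :: "nat \<Rightarrow> nat \<Rightarrow> 'v cochain \<Rightarrow> 'v cochain" where
  "d_hom n e Y = (\<lambda>as. if length as = Suc n
     then qclass (Suc n) (\<Sum>ps | length ps = Suc n \<and> set ps \<subseteq> {0, 1}.
            d_formula e Y ps (map2 hpart ps as))
     else {})"

definition d_PV :: "nat \<Rightarrow> 'v cochain \<Rightarrow> 'v cochain" where
  "d_PV n Y = (THE W. \<exists>Y0\<in>hom_cochains n 0. \<exists>Y1\<in>hom_cochains n 1.
     Y = cochain_add Y0 Y1 \<and> W = cochain_add (d_hom n 0 Y0) (d_hom n 1 Y1))"

definition cocycles :: "nat \<Rightarrow> 'v cochain set" where
  "cocycles n = {Y \<in> cochains n. d_PV n Y = cochain_zero (Suc n)}"

definition coboundaries :: "nat \<Rightarrow> 'v cochain set" where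
  "coboundaries n = (case n of 0 \<Rightarrow> {cochain_zero 0} | Suc m \<Rightarrow> d_PV m ` cochains m)"

definition cohom_class :: "nat \<Rightarrow> 'v cochain \<Rightarrow> 'v cochain set" where
  "cohom_class n Y = cochain_add Y ` coboundaries n"

definition H_PV :: "nat \<Rightarrow> 'v cochain set set" where
  "H_PV n = cohom_class n ` cocycles n"

text \<open>The element \<integral>m of V/\<partial>V, as a 0-cochain.\<close>

definition int_cochain :: "'v \<Rightarrow> 'v cochain" where
  "int_cochain m = (\<lambda>as. if as = [] then qclass 0 (mconst m) else {})"

end


section \<open>Symmetric superalgebras and the free superfermion Poisson vertex superalgebra\<close>

text \<open>
  The free associative algebra on the set underlying a superspace W has the words in W as a
  basis. The two-sided ideal below is the kernel of its projection to S(W): it is generated by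
  the linearity relations, which cut out the tensor algebra of W, and by the
  relations xy - (-1)^{p(x)p(y)} yx.
\<close>

definition word :: "'w list \<Rightarrow> 'w list \<Rightarrow>\<^sub>0 'f::field_char_0" where
  "word w = Poly_Mapping.single w 1"

definition sym_ideal ::
  "('f::field_char_0 \<Rightarrow> 'w::ab_group_add \<Rightarrow> 'w) \<Rightarrow> (nat \<Rightarrow> 'w set) \<Rightarrow> ('w list \<Rightarrow>\<^sub>0 'f) set" where
  "sym_ideal scale gr = module.span (\<lambda>c. Poly_Mapping.map ((*) c))
     ({word (u @ [x + y] @ v) - word (u @ [x] @ v) - word (u @ [y] @ v) | u v x y. True}
      \<union> {word (u @ [scale c x] @ v) - Poly_Mapping.map ((*) c) (word (u @ [x] @ v)) | u v c x. True}
      \<union> {word (u @ [x, y] @ v) - Poly_Mapping.map ((*) ((-1) ^ (p * q))) (word (u @ [y, x] @ v))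
          | u v x y p q. p \<le> 1 \<and> q \<le> 1 \<and> x \<in> gr p \<and> y \<in> gr q})"

definition word_eval ::
  "('f::field_char_0 \<Rightarrow> 'v::ring_1 \<Rightarrow> 'v) \<Rightarrow> ('w \<Rightarrow> 'v) \<Rightarrow> ('w list \<Rightarrow>\<^sub>0 'f) \<Rightarrow> 'v" where
  "word_eval scale j t = (\<Sum>w\<in>Poly_Mapping.keys t.
     scale (Poly_Mapping.lookup t w) (prod_list (map j w)))"

text \<open>
  The superalgebra V with the even linear map j from W is the symmetric superalgebra of W:
  the induced homomorphism from the free algebra is onto with kernel the above ideal.
\<close>

locale symmetric_superalgebra =
  W: superspace scaleW grW + supercommutative_algebra scale gr
  for scaleW :: "'f::field_char_0 \<Rightarrow> 'w::ab_group_add \<Rightarrow> 'w" and grW :: "nat \<Rightarrow> 'w set"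
    and scale :: "'f \<Rightarrow> 'v::ring_1 \<Rightarrow> 'v" and gr :: "nat \<Rightarrow> 'v set" +
  fixes j :: "'w \<Rightarrow> 'v"
  assumes j_add: "j (x + y) = j x + j y"
    and j_scale: "j (scaleW c x) = scale c (j x)"
    and j_even: "p \<le> 1 \<Longrightarrow> x \<in> grW p \<Longrightarrow> j x \<in> gr p"
    and word_eval_surj: "surj (word_eval scale j)"
    and word_eval_kernel: "{t. word_eval scale j t = 0} = sym_ideal scaleW grW"

locale fermion_space = superspace scale gr
  for scale :: "'f::field_char_0 \<Rightarrow> 'h::ab_group_add \<Rightarrow> 'h" and gr :: "nat \<Rightarrow> 'h set" +
  fixes form :: "'h \<Rightarrow> 'h \<Rightarrow> 'f"
  assumes finite_dim: "\<exists>B. finite B \<and> span B = UNIV"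
    and form_add_left: "form (a + a') b = form a b + form a' b"
    and form_add_right: "form a (b + b') = form a b + form a b'"
    and form_scale_left: "form (scale c a) b = c * form a b"
    and form_scale_right: "form a (scale c b) = c * form a b"
    and form_skew: "p \<le> 1 \<Longrightarrow> q \<le> 1 \<Longrightarrow> a \<in> gr p \<Longrightarrow> b \<in> gr q \<Longrightarrow>
      form a b = - ((-1) ^ (p * q) * form b a)"
    and form_even: "p \<le> 1 \<Longrightarrow> q \<le> 1 \<Longrightarrow> a \<in> gr p \<Longrightarrow> b \<in> gr q \<Longrightarrow> p \<noteq> q \<Longrightarrow> form a b = 0"
    and form_nondegenerate: "(\<And>b. form a b = 0) \<Longrightarrow> a = 0"

text \<open>
  \<open>'h poly\<close> is F[\<partial>] \<otimes> h: the polynomial with coefficients u_k stands for \<Sum> \<partial>^k \<otimes> u_k, and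
  \<open>pCons 0\<close> is multiplication by \<partial>.
\<close>

locale free_superfermion =
  h: fermion_space scaleh grh form +
  poisson_vertex_superalgebra scale gr D br +
  symmetric_superalgebra "\<lambda>c. map_poly (scaleh c)" "\<lambda>p. {x. \<forall>k. coeff x k \<in> grh p}" scale gr j
  for scaleh :: "'f::field_char_0 \<Rightarrow> 'h::ab_group_add \<Rightarrow> 'h" and grh :: "nat \<Rightarrow> 'h set"
    and form :: "'h \<Rightarrow> 'h \<Rightarrow> 'f"
    and scale :: "'f \<Rightarrow> 'v::ring_1 \<Rightarrow> 'v" and gr :: "nat \<Rightarrow> 'v set"
    and D :: "'v \<Rightarrow> 'v" and br :: "'v \<Rightarrow> 'v \<Rightarrow> 'v lpoly"
    and j :: "'h poly \<Rightarrow> 'v" +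
  assumes D_gen: "D (j x) = j (pCons 0 x)"
    and br_gen: "br (j [:a:]) (j [:b:]) = lconst (scale (form a b) 1)"

end

theory Submission
  imports Defs
begin

text \<open>
  In terms of the generators, a cochain of degree n is a variational n-vector field on the free
  algebra. The pairing with a dual basis identifies these with differential forms modulo total
  derivatives, and the differential becomes the variational de Rham differential, because the
  bracket of two generators is constant.

  As for the Poincare lemma, a homotopy is the contraction with the Euler vector field. For dual
  bases U i, W i of the generating space put
  (hY)(a, b, ...) = - \<Sum>i. \<plusminus> U i \<cdot> Y(W i, a, b, ...), where the variable attached to W i acts as
  the derivation on U i. Then dh + hd is the operator Y \<mapsto> L Y + 2n Y, where L is the action of the
  Euler derivation E on cochains. On generators it is E + n, so its eigenvalues
  are positive if n > 0, and a polynomial in it with nonzero constant term annihilates Y, as the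
  generating space is finite dimensional. Since this operator preserves cocycles and maps them to
  coboundaries, every cocycle of positive degree is a coboundary. In degree 0
  it shows that E m is a total derivative whenever the class of m is a cocycle, hence m is a constant
  up to a total derivative.
\<close>

text \<open>The constant 2n has two sources, one unit per argument from each: the action of an
  argument on the vectors U i reproduces Y, and bracketing it with W i gives Y(.., a, ..) - Y(.., E
  a, ..). It also fits the degree of the bracket: [a_\<lambda> b] lowers the Euler degree by 2, so
  d(L Y) = L(dY) + 2 dY, which is exactly the shift that makes the operators L + 2n commute with d.
  The obstacle is that E has, in general, infinitely many eigenvalues on the algebra. Only the
  values of Y on tuples of generators, finitely many in number, share an annihilating polynomial;
  the Leibniz rule then spreads vanishing from generators to all arguments. The factors of the
  polynomial are removed one at a time: if Y is a cocycle and L Y + (n - k) Y = dx, then d(hY - x) =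
  (n + k) Y. Thus only the integers n + k are inverted, and here characteristic 0 and n > 0 enter.
  All computations use arbitrary representatives of cosets, so each operation has to be shown to
  respect total derivatives.\<close>

abbreviation "lk \<equiv> Poly_Mapping.lookup"
abbreviation "ks \<equiv> Poly_Mapping.keys"
abbreviation "sgl \<equiv> Poly_Mapping.single"
abbreviation "pmap \<equiv> Poly_Mapping.map"

section \<open>Polynomials\<close>

text \<open>Most operators below are sums over the support of their argument. Supports do not add
  up, but the summands vanish on zero coefficients and are additive, which is enough.\<close>

lemma sum_keys_add:
  assumes "\<And>k. h k 0 = 0" "\<And>k a b. h k (a + b) = h k a + h k b"
  shows "(\<Sum>k\<in>ks (x + y). h k (lk (x + y) k)) = (\<Sum>k\<in>ks x. h k (lk x k)) + (\<Sum>k\<in>ks y. h k (lk y k))"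
  using assms by (intro setsum_keys_plus_distrib) auto

lemma sum_keys_single:
  assumes "h k 0 = 0"
  shows "(\<Sum>m\<in>ks (sgl k v). h m (lk (sgl k v) m)) = h k v"
  using assms by (cases "v = 0") auto

lemma lookup_pmap: "f 0 = 0 \<Longrightarrow> lk (pmap f p) k = f (lk p k)"
  by (simp add: map.rep_eq when_def)

lemma poly_sum_singles: fixes x :: "'a \<Rightarrow>\<^sub>0 'b::comm_monoid_add" shows "x = (\<Sum>m\<in>ks x. sgl m (lk x m))"
  by (rule poly_mapping_eqI) (auto simp: lookup_sum lookup_single when_def in_keys_iff)

lemma poly_induct_single:
  fixes x :: "'a \<Rightarrow>\<^sub>0 'b::comm_monoid_add"
  assumes "P 0" "\<And>m v. m \<in> ks x \<Longrightarrow> P (sgl m v)" "\<And>x y. P x \<Longrightarrow> P y \<Longrightarrow> P (x + y)"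
  shows "P x"
proof -
  have "P (\<Sum>m\<in>A. sgl m (lk x m))" if "finite A" "A \<subseteq> ks x" for A
    using that by (induction A rule: finite_induct) (auto intro: assms)
  from this[of "ks x"] show ?thesis using poly_sum_singles[of x] by simp
qed

lemma additive_eqI:
  assumes "additive f" "additive g" "\<And>m v. f (sgl m v) = g (sgl m v)"
  shows "f x = g x"
proof -
  have "f (\<Sum>m\<in>ks x. sgl m (lk x m)) = g (\<Sum>m\<in>ks x. sgl m (lk x m))"
    using assms by (simp add: additive.sum)
  then show ?thesis using poly_sum_singles[of x] by simp
qed

lemma exponent_induct [consumes 1, case_names zero var]:
  fixes m :: "nat \<Rightarrow>\<^sub>0 nat"
  assumes "ks m \<subseteq> S" "P 0" "\<And>i m. i \<in> S \<Longrightarrow> ks m \<subseteq> S \<Longrightarrow> P m \<Longrightarrow> P (sgl i 1 + m)"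
  shows "P m"
  using assms(1)
proof (induction "\<Sum>i\<in>ks m. lk m i" arbitrary: m rule: less_induct)
  case less
  show ?case
  proof (cases "m = 0")
    case True then show ?thesis using assms(2) by simp
  next
    case False
    then obtain i where i: "i \<in> ks m" by (metis all_not_in_conv keys_eq_empty)
    define m' where "m' = m - sgl i 1"
    have mm: "m = sgl i 1 + m'"
      using i by (intro poly_mapping_eqI)
        (auto simp: m'_def lookup_add lookup_minus lookup_single when_def in_keys_iff)
    have km: "ks m' \<subseteq> ks m" by (auto simp: m'_def in_keys_iff lookup_minus)
    have "(\<Sum>k\<in>ks m'. lk m' k) = (\<Sum>k\<in>ks m. lk m' k)"
      using km by (intro sum.mono_neutral_left) (auto simp: in_keys_iff)
    also have "\<dots> < (\<Sum>k\<in>ks m. lk m k)"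
      using i by (intro sum_strict_mono_ex1)
        (auto simp: m'_def lookup_minus lookup_single in_keys_iff intro!: bexI[of _ i])
    finally have "P m'" using less km by blast
    then show ?thesis using assms(3)[of i m'] i km less.prems mm by auto
  qed
qed

lemma mvar_single: "mvar i * sgl m v = sgl (sgl i 1 + m) v"
  by (simp add: mvar_def mult_single)

lemma mvar_commute: "mvar i * x = x * mvar i"
proof (rule additive_eqI[of "(*) (mvar i)" "\<lambda>x. x * mvar i"])
  show "mvar i * sgl m v = sgl m v * mvar i" for m v
    by (simp add: mvar_def mult_single add.commute)
qed (auto intro!: additive.intro simp: algebra_simps)

lemma mvar_left_commute: "y * (mvar i * x) = mvar i * (y * x)"
  by (metis mvar_commute mult.assoc)

lemma mpolys_0 [simp]: "0 \<in> mpolys n" by (simp add: mpolys_def)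
lemma mpolys_mconst [simp]: "mconst v \<in> mpolys n" by (auto simp: mpolys_def)
lemma mpolys_add [intro, simp]: "x \<in> mpolys n \<Longrightarrow> y \<in> mpolys n \<Longrightarrow> x + y \<in> mpolys n"
  using Poly_Mapping.keys_add[of x y] by (auto simp: mpolys_def)
lemma mpolys_uminus [intro, simp]: "x \<in> mpolys n \<Longrightarrow> - x \<in> mpolys n" for x :: "'a::ab_group_add mpoly"
  by (auto simp: mpolys_def in_keys_iff)
lemma mpolys_diff [intro, simp]: "x \<in> mpolys n \<Longrightarrow> y \<in> mpolys n \<Longrightarrow> x - y \<in> mpolys n"
  for x :: "'a::ab_group_add mpoly"
  using mpolys_add[of x n "- y"] by simp
lemma mpolys_sum [intro]: "(\<And>i. i \<in> A \<Longrightarrow> f i \<in> mpolys n) \<Longrightarrow> sum f A \<in> mpolys n"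
  by (induction A rule: infinite_finite_induct) auto
lemma mpolys_mult [intro, simp]: "x \<in> mpolys n \<Longrightarrow> y \<in> mpolys n \<Longrightarrow> x * y \<in> mpolys n"
  for x :: "'a::ring_1 mpoly"
proof -
  assume xy: "x \<in> mpolys n" "y \<in> mpolys n"
  show ?thesis unfolding mpolys_def
  proof (safe)
    fix m k assume "m \<in> ks (x * y)" "k \<in> ks m"
    then obtain a b where "m = a + b" "a \<in> ks x" "b \<in> ks y"
      using Poly_Mapping.keys_mult[of x y] by auto
    then show "k < n" using xy \<open>k \<in> ks m\<close> Poly_Mapping.keys_add[of a b]
      unfolding mpolys_def by blast
  qed
qed
lemma mpolys_mvar [intro, simp]: "i < n \<Longrightarrow> mvar i \<in> mpolys n"
  by (auto simp: mpolys_def mvar_def)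
lemma mpolys_one [intro, simp]: "1 \<in> mpolys n"
  by (auto simp: mpolys_def)
lemma mpolys_power [intro, simp]: "x \<in> mpolys n \<Longrightarrow> x ^ k \<in> mpolys n" for x :: "'a::ring_1 mpoly"
  by (induction k) auto
lemma mpolys_pmap [intro, simp]: "x \<in> mpolys n \<Longrightarrow> pmap f x \<in> mpolys n"
  by (auto simp: mpolys_def in_keys_iff map.rep_eq)
lemma mpolys_ex: "\<exists>n. x \<in> mpolys n"
proof -
  have "finite (\<Union>m\<in>ks x. ks m)" by auto
  then obtain n where "\<forall>k\<in>(\<Union>m\<in>ks x. ks m). k < n" using finite_nat_set_iff_bounded by blast
  then show ?thesis by (auto simp: mpolys_def)
qed

text \<open>Constants, multiplication by one variable and sums suffice to reach every polynomial.
  Identities between operators are checked in this way below, with the coefficient generalized when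
  a variable differentiates it.\<close>

lemma mpolys_induct [consumes 1, case_names const var add]:
  fixes x :: "'a::ring_1 mpoly"
  assumes "x \<in> mpolys n" "\<And>v. P (mconst v)"
    "\<And>i x. i < n \<Longrightarrow> x \<in> mpolys n \<Longrightarrow> P x \<Longrightarrow> P (mvar i * x)"
    "\<And>x y. x \<in> mpolys n \<Longrightarrow> y \<in> mpolys n \<Longrightarrow> P x \<Longrightarrow> P y \<Longrightarrow> P (x + y)"
  shows "P x"
proof -
  have "P x \<and> x \<in> mpolys n"
  proof (rule poly_induct_single)
    show "P 0 \<and> 0 \<in> mpolys n" using assms(2)[of 0] by simp
    fix m v assume "m \<in> ks x"
    then have "ks m \<subseteq> {..<n}" using assms(1) by (auto simp: mpolys_def)
    then show "P (sgl m v) \<and> sgl m v \<in> mpolys n"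
    proof (induction rule: exponent_induct)
      case zero then show ?case using assms(2) by simp
    next
      case (var i m) then show ?case using assms(3)[of i "sgl m v"]
        by (metis lessThan_iff mpolys_mult mpolys_mvar mvar_single)
    qed
  qed (auto intro: assms(4))
  then show ?thesis by simp
qed

lemma mpoly_induct [case_names const var add]:
  fixes x :: "'a::ring_1 mpoly"
  assumes "\<And>v. P (mconst v)" "\<And>i x. P x \<Longrightarrow> P (mvar i * x)" "\<And>x y. P x \<Longrightarrow> P y \<Longrightarrow> P (x + y)"
  shows "P x"
proof -
  obtain n where "x \<in> mpolys n" using mpolys_ex by blast
  then show ?thesis by (induction rule: mpolys_induct) (auto intro: assms)
qed

text \<open>The coefficients do not commute, so substitution is multiplicative only for central
  polynomials. Sums of variables are central and commute with coefficientwise maps, and the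
  differential substitutes nothing else.\<close>

inductive lin :: "nat \<Rightarrow> 'a::ring_1 mpoly \<Rightarrow> bool" for n where
  lin_0: "lin n 0"
| lin_var: "i < n \<Longrightarrow> lin n (mvar i)"
| lin_add: "lin n a \<Longrightarrow> lin n b \<Longrightarrow> lin n (a + b)"

lemma lin_mpolys: "lin n L \<Longrightarrow> L \<in> mpolys n"
  by (induction rule: lin.induct) auto

lemma lin_commute: "lin n L \<Longrightarrow> L * x = x * L"
  by (induction rule: lin.induct) (auto simp: algebra_simps mvar_commute)

lemma lin_mult_left:
  assumes "lin n L" "additive f" "\<And>i x. i < n \<Longrightarrow> f (mvar i * x) = mvar i * f x"
  shows "f (L * x) = L * f x"
  using assms(1)
  by (induction rule: lin.induct) (auto simp: assms(3) algebra_simps additive.add[OF assms(2)] additive.zero[OF assms(2)])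

lemma lin_power_left:
  assumes "lin n L" "additive f" "\<And>i x. i < n \<Longrightarrow> f (mvar i * x) = mvar i * f x"
  shows "f (L ^ k * x) = L ^ k * f x"
  by (induction k) (auto simp: mult.assoc lin_mult_left[OF assms])

lemma lin_sum: "(\<And>i. i \<in> A \<Longrightarrow> lin n (f i)) \<Longrightarrow> lin n (sum f A)"
  by (induction A rule: infinite_finite_induct) (auto intro: lin.intros)

lemma additive_pmap: "additive f \<Longrightarrow> additive (pmap f)"
  by (standard, rule poly_mapping_eqI) (simp add: lookup_pmap additive.zero lookup_add additive.add)

lemma pmap_mconst: "f 0 = 0 \<Longrightarrow> pmap f (mconst v) = mconst (f v)"
  by (rule poly_mapping_eqI) (auto simp: lookup_pmap lookup_single when_def)

lemma pmap_mvar: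
  assumes "additive f" shows "pmap f (mvar i * x) = mvar i * pmap f x"
proof (rule additive_eqI[of "\<lambda>x. pmap f (mvar i * x)" "\<lambda>x. mvar i * pmap f x"])
  interpret p: additive "pmap f" by (rule additive_pmap[OF assms])
  show "additive (\<lambda>x. pmap f (mvar i * x))" "additive (\<lambda>x. mvar i * pmap f x)"
    by (auto intro!: additive.intro simp: algebra_simps p.add)
  show "pmap f (mvar i * sgl m v) = mvar i * pmap f (sgl m v)" for m v
    using additive.zero[OF assms] by (simp add: mvar_single)
qed

lemma pmap_lin: "additive f \<Longrightarrow> lin n L \<Longrightarrow> pmap f (L * x) = L * pmap f x"
  by (rule lin_mult_left[OF _ additive_pmap]) (auto simp: pmap_mvar)

lemma pmap_comm_pmap:
  assumes "f 0 = 0" "g 0 = 0" "\<And>v. f (g v) = g (f v)"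
  shows "pmap f (pmap g x) = pmap g (pmap f x)"
  by (rule poly_mapping_eqI) (simp add: lookup_pmap assms)

subsection \<open>Substitution\<close>

lemma prod_list_insert_factor:
  fixes c :: "'a::monoid_mult"
  assumes "\<And>x. c * x = x * c" "distinct xs" "i \<in> set xs"
  shows "prod_list (map (\<lambda>k. (if k = i then c else 1) * f k) xs) = c * prod_list (map f xs)"
  using assms(2,3)
proof (induction xs)
  case (Cons a xs)
  show ?case
  proof (cases "a = i")
    case True
    then have "map (\<lambda>k. (if k = i then c else 1) * f k) xs = map f xs"
      using Cons.prems by (auto)
    then have "prod_list (map (\<lambda>k. (if k = i then c else 1) * f k) xs) = prod_list (map f xs)"
      by (simp only:)
    then show ?thesis using True by (simp add: mult.assoc)
  next
    case False
    then have "prod_list (map (\<lambda>k. (if k = i then c else 1) * f k) (a # xs)) = f a * (c * prod_list (map f xs))"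
      using Cons by simp
    also have "\<dots> = c * prod_list (map f (a # xs))"
      using assms(1)[of "f a"] by (simp add: mult.assoc[symmetric])
    finally show ?thesis .
  qed
qed simp

lemma msubst_add: "msubst Ls (x + y) = msubst Ls x + msubst Ls y"
  unfolding msubst_def by (rule sum_keys_add) (auto simp: single_add algebra_simps)

lemma additive_msubst: "additive (msubst Ls)" by standard (rule msubst_add)

lemma msubst_single: "msubst Ls (sgl m v) =
    mconst v * prod_list (map (\<lambda>i. (Ls ! i) ^ lk m i) [0..<length Ls])"
  unfolding msubst_def by (rule sum_keys_single) auto

lemma msubst_mconst [simp]: "msubst Ls (mconst v) = mconst v"
proof -
  have "map (\<lambda>i. (Ls ! i) ^ lk 0 i) [0..<length Ls] = map (\<lambda>i. 1) [0..<length Ls]" by simp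
  then have "prod_list (map (\<lambda>i. (Ls ! i) ^ lk 0 i) [0..<length Ls]) = 1"
    by (metis (no_types) map_replicate_const prod_list_replicate power_one)
  then show ?thesis by (simp only: msubst_single mult_1_right)
qed

lemma msubst_1 [simp]: "msubst Ls 1 = 1"
  using msubst_mconst[of Ls 1] by simp

lemma msubst_mvar:
  assumes i: "i < length Ls" and c: "\<And>x. Ls ! i * x = x * Ls ! i"
  shows "msubst Ls (mvar i * x) = Ls ! i * msubst Ls x"
proof (rule additive_eqI[of "\<lambda>x. msubst Ls (mvar i * x)" "\<lambda>x. Ls ! i * msubst Ls x"])
  show "additive (\<lambda>x. msubst Ls (mvar i * x))" "additive (\<lambda>x. Ls ! i * msubst Ls x)"
    by (auto intro!: additive.intro simp: algebra_simps msubst_add)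
  fix m v
  have "map (\<lambda>k. (Ls ! k) ^ lk (sgl i 1 + m) k) [0..<length Ls] =
        map (\<lambda>k. (if k = i then Ls ! i else 1) * (Ls ! k) ^ lk m k) [0..<length Ls]"
    by (auto simp: lookup_add lookup_single when_def)
  then have "prod_list (map (\<lambda>k. (Ls ! k) ^ lk (sgl i 1 + m) k) [0..<length Ls]) =
        Ls ! i * prod_list (map (\<lambda>k. (Ls ! k) ^ lk m k) [0..<length Ls])"
    using prod_list_insert_factor[of "Ls ! i" "[0..<length Ls]" i, OF c] i
    by (simp only: distinct_upt set_upt atLeastLessThan_iff le0 simp_thms)
  then show "msubst Ls (mvar i * sgl m v) = Ls ! i * msubst Ls (sgl m v)"
    unfolding mvar_single msubst_single using c[of "mconst v"] by (simp add: mult.assoc[symmetric])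
qed

lemma msubst_mvar_lin:
  assumes "i < length Ls" "lin n (Ls ! i)"
  shows "msubst Ls (mvar i * x) = Ls ! i * msubst Ls x"
  using assms by (intro msubst_mvar lin_commute)

lemma msubst_mpolys:
  assumes "x \<in> mpolys (length Ls)" "\<And>L. L \<in> set Ls \<Longrightarrow> lin n L"
  shows "msubst Ls x \<in> mpolys n"
  using assms(1)
proof (induction rule: mpolys_induct)
  case (var i x)
  then have l: "lin n (Ls ! i)" using assms(2) by auto
  then show ?case using var by (simp add: msubst_mvar lin_commute lin_mpolys)
qed (auto simp: msubst_add)

lemma msubst_lin_mult:
  assumes "lin (length Ls) K" "\<And>L. L \<in> set Ls \<Longrightarrow> lin n L"
  shows "msubst Ls (K * x) = msubst Ls K * msubst Ls x"
  using assms(1)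
proof (induction rule: lin.induct)
  case (lin_var i)
  then have l: "lin n (Ls ! i)" using assms(2) by auto
  have "msubst Ls (mvar i) = Ls ! i"
    using msubst_mvar[of i Ls "mconst 1"] l lin_var by (simp add: lin_commute)
  then show ?case using l lin_var by (simp add: msubst_mvar lin_commute)
qed (auto simp: msubst_add algebra_simps additive.zero[OF additive_msubst])

lemma msubst_var [simp]:
  assumes "i < length Ls" "\<And>x. Ls ! i * x = x * Ls ! i"
  shows "msubst Ls (mvar i) = Ls ! i"
  using msubst_mvar[of i Ls "mconst 1"] assms by simp

lemma msubst_msubst:
  assumes "x \<in> mpolys (length Ks)" "\<And>K. K \<in> set Ks \<Longrightarrow> lin (length Ls) K"
    "\<And>L. L \<in> set Ls \<Longrightarrow> lin n L"
  shows "msubst Ls (msubst Ks x) = msubst (map (msubst Ls) Ks) x"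
  using assms(1)
proof (induction rule: mpolys_induct)
  case (var i x)
  then have l: "lin (length Ls) (Ks ! i)" using assms(2) by auto
  have "lin n (msubst Ls K)" if "lin (length Ls) K" for K
    using that
  proof (induction rule: lin.induct)
    case (lin_var i)
    then have "lin n (Ls ! i)" using assms(3) by auto
    with lin_var show ?case by (simp add: lin_commute)
  qed (auto simp: msubst_add additive.zero[OF additive_msubst] intro: lin.intros)
  then have l': "lin n (msubst Ls (Ks ! i))" using l by simp
  have "msubst Ls (msubst Ks (mvar i * x)) = msubst Ls (Ks ! i * msubst Ks x)"
    using var l by (simp add: msubst_mvar lin_commute)
  also have "\<dots> = msubst Ls (Ks ! i) * msubst Ls (msubst Ks x)"
    using l assms(3) by (rule msubst_lin_mult)
  also have "\<dots> = msubst (map (msubst Ls) Ks) (mvar i * x)"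
    using var l' by (simp add: msubst_mvar lin_commute[OF l'])
  finally show ?case .
qed (auto simp: msubst_add)

lemma msubst_id:
  assumes "x \<in> mpolys n" shows "msubst (map mvar [0..<n]) x = x"
  using assms
proof (induction rule: mpolys_induct)
  case (var i x)
  then show ?case by (subst msubst_mvar_lin[of _ _ n]) (auto intro: lin_var)
qed (auto simp: msubst_add)

lemma pmap_msubst:
  assumes "additive f" "x \<in> mpolys (length Ls)" "\<And>L. L \<in> set Ls \<Longrightarrow> lin n L"
  shows "pmap f (msubst Ls x) = msubst Ls (pmap f x)"
  using assms(2)
proof (induction rule: mpolys_induct)
  case (const v)
  then show ?case using assms(1) by (simp add: pmap_mconst additive.zero)
next
  case (var i x)
  then have l: "lin n (Ls ! i)" using assms(3) by auto
  then show ?case using var by (simp add: msubst_mvar_lin[OF _ l] pmap_lin[OF assms(1)] pmap_mvar[OF assms(1)])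
qed (auto simp: msubst_add additive.add[OF additive_pmap[OF assms(1)]])

subsection \<open>Derivatives\<close>

lemma mderiv_add: "mderiv i (x + y) = mderiv i x + mderiv i y"
  unfolding mderiv_def by (rule sum_keys_add) (auto simp: single_add algebra_simps)

lemma additive_mderiv: "additive (mderiv i)" by standard (rule mderiv_add)

lemma mderiv_single: "mderiv i (sgl m v) = sgl (m - sgl i 1) (of_nat (lk m i) * v)"
  unfolding mderiv_def by (rule sum_keys_single) auto

lemma mderiv_mconst [simp]: "mderiv i (mconst v) = 0"
  by (simp add: mderiv_single)

lemma mderiv_mvar: "mderiv i (mvar k * x) = (if k = i then x else 0) + mvar k * mderiv i x"
proof (rule additive_eqI[of "\<lambda>x. mderiv i (mvar k * x)" "\<lambda>x. (if k = i then x else 0) + mvar k * mderiv i x"])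
  show "additive (\<lambda>x. mderiv i (mvar k * x))"
    "additive (\<lambda>x. (if k = i then x else 0) + mvar k * mderiv i x)"
    by (auto intro!: additive.intro simp: algebra_simps mderiv_add)
  fix m and v :: 'a
  show "mderiv i (mvar k * sgl m v) =
      (if k = i then sgl m v else 0) + mvar k * mderiv i (sgl m v)"
  proof (cases "k = i")
    case True
    \<comment> \<open>If the exponent of i is 0 the truncated subtraction loses nothing that
      matters, as the coefficient is then 0.\<close>
    have "sgl i 1 + (m - sgl i 1) = m" if "lk m i \<noteq> 0"
      using that by (intro poly_mapping_eqI) (auto simp: lookup_add lookup_minus lookup_single when_def)
    then show ?thesis using True
      by (cases "lk m i = 0") (auto simp: mvar_single mderiv_single lookup_add algebra_simps single_add)
  next
    case False
    have "sgl k 1 + m - sgl i 1 = sgl k 1 + (m - sgl i 1)"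
      using False by (intro poly_mapping_eqI) (auto simp: lookup_add lookup_minus lookup_single when_def)
    then show ?thesis using False
      by (simp add: mvar_single mderiv_single lookup_add lookup_single)
  qed
qed

text \<open>\<open>exp_act\<close> sums over the set of k with nonzero k-th derivative. A sum over
  an infinite set would be 0 by convention, so this set must be known to be bounded.\<close>

lemma mderiv_eventually_0: "\<exists>K. \<forall>k\<ge>K. (mderiv i ^^ k) x = 0"
proof (induction x rule: mpoly_induct)
  case (const v)
  have "(mderiv i ^^ k) (mconst v) = 0" if k: "k \<ge> 1" for k
  proof -
    obtain k' where "k = Suc k'" using k by (cases k) auto
    moreover have "(mderiv i ^^ k') 0 = (0::'a mpoly)" for k'
      by (induction k') (auto simp: additive.zero[OF additive_mderiv])
    ultimately show ?thesis by (simp add: funpow_swap1)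
  qed
  then show ?case by blast
next
  case (var j x)
  then obtain K where K: "\<forall>k\<ge>K. (mderiv i ^^ k) x = 0" by blast
  have "(mderiv i ^^ k) (mvar j * x) = (if j = i then of_nat k * (mderiv i ^^ (k - 1)) x else 0) + mvar j * (mderiv i ^^ k) x" for k
  proof (induction k)
    case (Suc k)
    have "mderiv i (of_nat k * y) = of_nat k * mderiv i y" for y :: "'a mpoly"
      by (induction k) (auto simp: algebra_simps mderiv_add additive.zero[OF additive_mderiv])
    then show ?case using Suc
      by (cases k) (auto simp: mderiv_add mderiv_mvar algebra_simps additive.zero[OF additive_mderiv])
  qed simp
  then have "\<forall>k\<ge>Suc K. (mderiv i ^^ k) (mvar j * x) = 0" using K by simp
  then show ?case by blast
next
  case (add x y)
  then obtain K L where "\<forall>k\<ge>K. (mderiv i ^^ k) x = 0" "\<forall>k\<ge>L. (mderiv i ^^ k) y = 0" by blast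
  moreover have "(mderiv i ^^ k) (x + y) = (mderiv i ^^ k) x + (mderiv i ^^ k) y" for k
    by (induction k) (auto simp: mderiv_add)
  ultimately have "\<forall>k\<ge>max K L. (mderiv i ^^ k) (x + y) = 0" by simp
  then show ?case by blast
qed

subsection \<open>Replacing a variable by an operator\<close>

text \<open>The i-th variable is replaced by the operator \<open>\<Phi>\<close> acting on z, placed on the left.\<close>

definition subop :: "nat \<Rightarrow> ('a::ring_1 mpoly \<Rightarrow> 'a mpoly) \<Rightarrow> 'a mpoly \<Rightarrow> 'a mpoly \<Rightarrow> 'a mpoly" where
  "subop i \<Phi> z x = (\<Sum>m\<in>ks x. (\<Phi> ^^ lk m i) z * sgl (Poly_Mapping.update i 0 m) (lk x m))"

lemma subop_add: "subop i \<Phi> z (x + y) = subop i \<Phi> z x + subop i \<Phi> z y"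
  unfolding subop_def by (rule sum_keys_add) (auto simp: single_add algebra_simps)

lemma additive_subop: "additive (subop i \<Phi> z)" by standard (rule subop_add)

lemma subop_single: "subop i \<Phi> z (sgl m v) = (\<Phi> ^^ lk m i) z * sgl (Poly_Mapping.update i 0 m) v"
  unfolding subop_def by (rule sum_keys_single) auto

lemma subop_mconst [simp]: "subop i \<Phi> z (mconst v) = z * mconst v"
proof -
  have "Poly_Mapping.update i 0 0 = (0 :: nat \<Rightarrow>\<^sub>0 nat)"
    by (rule poly_mapping_eqI) (simp add: lookup_update)
  then show ?thesis by (simp add: subop_single)
qed

lemma subop_mvar_same: "subop i \<Phi> z (mvar i * x) = subop i \<Phi> (\<Phi> z) x"
proof (rule additive_eqI[of "\<lambda>x. subop i \<Phi> z (mvar i * x)" "\<lambda>x. subop i \<Phi> (\<Phi> z) x"])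
  show "additive (\<lambda>x. subop i \<Phi> z (mvar i * x))" "additive (\<lambda>x. subop i \<Phi> (\<Phi> z) x)"
    by (auto intro!: additive.intro simp: algebra_simps subop_add)
  fix m :: "nat \<Rightarrow>\<^sub>0 nat" and v :: 'a
  have "Poly_Mapping.update i 0 (sgl i 1 + m) = Poly_Mapping.update i 0 m"
    by (rule poly_mapping_eqI) (simp add: lookup_update lookup_add lookup_single)
  then show "subop i \<Phi> z (mvar i * sgl m v) = subop i \<Phi> (\<Phi> z) (sgl m v)"
    by (simp add: mvar_single subop_single lookup_add funpow_swap1)
qed

lemma subop_mvar_other: assumes "k \<noteq> i" shows "subop i \<Phi> z (mvar k * x) = mvar k * subop i \<Phi> z x"
proof (rule additive_eqI[of "\<lambda>x. subop i \<Phi> z (mvar k * x)" "\<lambda>x. mvar k * subop i \<Phi> z x"])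
  show "additive (\<lambda>x. subop i \<Phi> z (mvar k * x))" "additive (\<lambda>x. mvar k * subop i \<Phi> z x)"
    by (auto intro!: additive.intro simp: algebra_simps subop_add)
  fix m :: "nat \<Rightarrow>\<^sub>0 nat" and v :: 'a
  have "Poly_Mapping.update i 0 (sgl k 1 + m) = sgl k 1 + Poly_Mapping.update i 0 m"
    using assms by (intro poly_mapping_eqI) (simp add: lookup_update lookup_add lookup_single)
  then show "subop i \<Phi> z (mvar k * sgl m v) = mvar k * subop i \<Phi> z (sgl m v)"
    using assms by (simp add: mvar_single subop_single lookup_add lookup_single)
      (simp add: mvar_left_commute[symmetric] mvar_single)
qed

lemma subop_add_op:
  assumes "additive \<Phi>" shows "subop i \<Phi> (z + z') x = subop i \<Phi> z x + subop i \<Phi> z' x"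
proof -
  have "(\<Phi> ^^ k) (z + z') = (\<Phi> ^^ k) z + (\<Phi> ^^ k) z'" for k
    by (induction k) (auto simp: additive.add[OF assms])
  then show ?thesis by (simp add: subop_def algebra_simps sum.distrib)
qed

lemma subop_mpolys:
  assumes "x \<in> mpolys n" "z \<in> mpolys n" "\<And>y. y \<in> mpolys n \<Longrightarrow> \<Phi> y \<in> mpolys n"
  shows "subop i \<Phi> z x \<in> mpolys n"
  using assms(1,2)
proof (induction arbitrary: z rule: mpolys_induct)
  case (var k x) then show ?case
    by (cases "k = i") (auto simp: subop_mvar_same subop_mvar_other assms(3))
qed (auto simp: subop_add)

subsection \<open>Evaluating a polynomial in one variable\<close>

definition lev :: "'a::ring_1 mpoly \<Rightarrow> 'a lpoly \<Rightarrow> 'a mpoly" where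
  "lev L f = (\<Sum>k\<in>ks f. L ^ k * mconst (lk f k))"

lemma lev_add: "lev L (f + g) = lev L f + lev L g"
  unfolding lev_def by (rule sum_keys_add) (auto simp: single_add algebra_simps)

lemma additive_lev: "additive (lev L)" by standard (rule lev_add)

lemma lev_single: "lev L (sgl k v) = L ^ k * mconst v"
  unfolding lev_def by (rule sum_keys_single) auto

lemma lev_lconst [simp]: "lev L (lconst v) = mconst v" by (simp add: lev_single)

lemma lev_lam: "lev L (lam * f) = L * lev L f"
proof (rule additive_eqI[of "\<lambda>f. lev L (lam * f)" "\<lambda>f. L * lev L f"])
  show "additive (\<lambda>f. lev L (lam * f))" "additive (\<lambda>f. L * lev L f)"
    by (auto intro!: additive.intro simp: algebra_simps lev_add)
qed (simp add: mult_single lev_single mult.assoc)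

lemma lev_mult_lconst: "lev L (f * lconst c) = lev L f * mconst c"
proof (rule additive_eqI[of "\<lambda>f. lev L (f * lconst c)" "\<lambda>f. lev L f * mconst c"])
  show "additive (\<lambda>f. lev L (f * lconst c))" "additive (\<lambda>f. lev L f * mconst c)"
    by (auto intro!: additive.intro simp: algebra_simps lev_add)
qed (simp add: mult_single lev_single mult.assoc)

lemma lev_pmap:
  assumes "additive f" "lin n L" shows "lev L (pmap f q) = pmap f (lev L q)"
proof (rule additive_eqI[of "\<lambda>q. lev L (pmap f q)" "\<lambda>q. pmap f (lev L q)"])
  show "additive (\<lambda>q. lev L (pmap f q))" "additive (\<lambda>q. pmap f (lev L q))"
    by (auto intro!: additive.intro simp: lev_add additive.add[OF additive_pmap[OF assms(1)]])
  show "lev L (pmap f (sgl k v)) = pmap f (lev L (sgl k v))" for k v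
    using lin_power_left[OF assms(2) additive_pmap[OF assms(1)] pmap_mvar[OF assms(1)]]
      additive.zero[OF assms(1)] by (simp add: lev_single)
qed

lemma lev_mpolys: "lin n L \<Longrightarrow> lev L f \<in> mpolys n"
  unfolding lev_def by (intro mpolys_sum mpolys_mult mpolys_power mpolys_mconst) (rule lin_mpolys)

lemma msubst_lev:
  assumes "lin (length Ls) K" "\<And>L. L \<in> set Ls \<Longrightarrow> lin n L"
  shows "msubst Ls (lev K f) = lev (msubst Ls K) f"
proof -
  have "msubst Ls (K ^ k * x) = msubst Ls K ^ k * msubst Ls x" for k x
    by (induction k) (auto simp: mult.assoc msubst_lin_mult[OF assms])
  then show ?thesis unfolding lev_def by (simp add: additive.sum[OF additive_msubst])
qed

lemma bracket_at_lev: "bracket_at br a L b = lev L (br a b)"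
  by (simp add: bracket_at_def lev_def)

section \<open>Signs and parities\<close>

text \<open>A sign that makes sense in every abelian group, so that the one rule
  \<open>sg_additive\<close> moves it through all additive operators.\<close>

definition sg :: "nat \<Rightarrow> 'a::ab_group_add \<Rightarrow> 'a" where
  "sg k x = (if even k then x else - x)"

lemma sg_eq: "(-1) ^ k * x = sg k x" for x :: "'a::ring_1"
  by (simp add: sg_def)

lemma sg_cong: "even k = even l \<Longrightarrow> sg k x = sg l x" by (simp add: sg_def)
lemma sg_sg: "sg k (sg l x) = sg (k + l) x" by (simp add: sg_def)
lemma sg_add: "sg k (x + y) = sg k x + sg k y" by (simp add: sg_def)
lemma sg_diff: "sg k (x - y) = sg k x - sg k y" by (simp add: sg_def)
lemma sg_uminus: "sg k (- x) = - sg k x" by (simp add: sg_def)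
lemma sg_0 [simp]: "sg k 0 = 0" by (simp add: sg_def)
lemma sg_zero [simp]: "sg 0 x = x" by (simp add: sg_def)
lemma sg_sum: "sg k (sum f A) = (\<Sum>a\<in>A. sg k (f a))" by (simp add: sg_def sum_negf)
lemma sg_additive: "additive f \<Longrightarrow> f (sg k x) = sg k (f x)"
  by (simp add: sg_def additive.minus)
lemma sg_mult_left: "sg k x * y = sg k (x * y)" for x :: "'a::ring" by (simp add: sg_def)
lemma sg_mult_right: "x * sg k y = sg k (x * y)" for x :: "'a::ring" by (simp add: sg_def)
lemma lookup_sg: "lk (sg k x) m = sg k (lk x m)" by (simp add: sg_def)

context superspace begin

lemma gr_0 [simp]: "p \<le> 1 \<Longrightarrow> 0 \<in> gr p" using subspace_gr subspace_0 by blast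
lemma gr_add: "p \<le> 1 \<Longrightarrow> x \<in> gr p \<Longrightarrow> y \<in> gr p \<Longrightarrow> x + y \<in> gr p" using subspace_gr subspace_add by blast
lemma gr_diff: "p \<le> 1 \<Longrightarrow> x \<in> gr p \<Longrightarrow> y \<in> gr p \<Longrightarrow> x - y \<in> gr p" using subspace_gr subspace_diff by blast
lemma gr_neg: "p \<le> 1 \<Longrightarrow> x \<in> gr p \<Longrightarrow> - x \<in> gr p" using subspace_gr subspace_neg by blast
lemma gr_scale: "p \<le> 1 \<Longrightarrow> x \<in> gr p \<Longrightarrow> scale c x \<in> gr p" using subspace_gr subspace_scale by blast
lemma gr_sg: "p \<le> 1 \<Longrightarrow> x \<in> gr p \<Longrightarrow> sg k x \<in> gr p" by (simp add: sg_def gr_neg)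
lemma gr_sumI: "p \<le> 1 \<Longrightarrow> (\<And>i. i \<in> A \<Longrightarrow> f i \<in> gr p) \<Longrightarrow> sum f A \<in> gr p"
  by (induction A rule: infinite_finite_induct) (auto simp: gr_add)

lemma gr_unique:
  assumes "p \<le> 1" "x \<in> gr p" "x' \<in> gr p" "y \<in> gr (1 - p)" "y' \<in> gr (1 - p)" "x + y = x' + y'"
  shows "x = x'"
proof -
  have "x - x' = y' - y" using assms(6) by (simp add: algebra_simps)
  moreover have "x - x' \<in> gr p" "y' - y \<in> gr (1 - p)" using assms by (auto intro: gr_diff)
  ultimately have "x - x' \<in> gr p \<inter> gr (1 - p)" by simp
  moreover have "gr p \<inter> gr (1 - p) = {0}" using gr_disjoint assms(1)
    by (cases "p = 0") (auto simp: le_Suc_eq)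
  ultimately have "x - x' = 0" by (metis singletonD)
  then show ?thesis by simp
qed

lemma hpart_ex: assumes "p \<le> 1" shows "\<exists>x. x \<in> gr p \<and> v - x \<in> gr (1 - p)"
proof -
  obtain x y where xy: "x \<in> gr 0" "y \<in> gr 1" "v = x + y" using gr_sum by blast
  show ?thesis using xy assms
    by (cases "p = 0") (auto simp: le_Suc_eq intro: exI[of _ x] exI[of _ y])
qed

lemma hpart_eq: assumes "p \<le> 1" "x \<in> gr p" "v - x \<in> gr (1 - p)" shows "hpart p v = x"
  unfolding hpart_def
proof (rule the_equality)
  fix x' assume "x' \<in> gr p \<and> v - x' \<in> gr (1 - p)"
  then show "x' = x" using gr_unique[of p x' x "v - x'" "v - x"] assms by simp
qed (use assms in simp)

lemma hpart_in: "p \<le> 1 \<Longrightarrow> hpart p v \<in> gr p"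
  and hpart_rest: "p \<le> 1 \<Longrightarrow> v - hpart p v \<in> gr (1 - p)"
  using hpart_ex[of p v] hpart_eq by blast+

lemma hpart_same [simp]: "p \<le> 1 \<Longrightarrow> v \<in> gr p \<Longrightarrow> hpart p v = v"
  by (rule hpart_eq) auto

lemma hpart_other: "p \<le> 1 \<Longrightarrow> q \<le> 1 \<Longrightarrow> p \<noteq> q \<Longrightarrow> v \<in> gr q \<Longrightarrow> hpart p v = 0"
proof (rule hpart_eq)
  assume "p \<le> 1" "q \<le> 1" "p \<noteq> q" "v \<in> gr q"
  then have "q = 1 - p" by auto
  then show "v - 0 \<in> gr (1 - p)" using \<open>v \<in> gr q\<close> by simp
qed auto

lemma hpart_sum: "v = hpart 0 v + hpart 1 v"
proof -
  have "hpart 1 v = v - hpart 0 v"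
    using hpart_in[of 0 v] hpart_rest[of 0 v] by (intro hpart_eq) auto
  then show ?thesis by simp
qed

end

section \<open>Operators on polynomials with coefficients in a Poisson vertex superalgebra\<close>

context poisson_vertex_superalgebra begin

lemma additive_D: "additive D" by standard (rule D_add)
lemma D_0 [simp]: "D 0 = 0" by (rule additive.zero[OF additive_D])
lemma D_sum: "D (sum f A) = (\<Sum>a\<in>A. D (f a))" by (rule additive.sum[OF additive_D])
lemma D_1 [simp]: "D 1 = 0" using D_mult[of 1 1] by simp
lemma additive_scale: "additive (scale c)" by standard (rule scale_right_distrib)

abbreviation "Dm \<equiv> pmap D"
abbreviation "sc c \<equiv> pmap (scale c)"

lemma Dm_add: "Dm (x + y) = Dm x + Dm y" by (rule additive.add[OF additive_pmap[OF additive_D]])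
lemma Dm_mconst: "Dm (mconst v) = mconst (D v)" by (simp add: pmap_mconst)
lemma Dm_mvar: "Dm (mvar i * x) = mvar i * Dm x" by (rule pmap_mvar[OF additive_D])
lemma Dm_lin: "lin n L \<Longrightarrow> Dm (L * x) = L * Dm x" by (rule pmap_lin[OF additive_D])

lemma sc_add: "sc c (x + y) = sc c x + sc c y" by (rule additive.add[OF additive_pmap[OF additive_scale]])
lemma additive_sc: "additive (sc c)" by standard (rule sc_add)
lemma sc_mconst: "sc c (mconst v) = mconst (scale c v)" by (simp add: pmap_mconst)
lemma sc_mvar: "sc c (mvar i * x) = mvar i * sc c x" by (rule pmap_mvar[OF additive_scale])
lemma sc_sc: "sc c (sc d x) = sc (c * d) x" for x :: "'k \<Rightarrow>\<^sub>0 'v"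
  by (rule poly_mapping_eqI) (simp add: lookup_pmap)
lemma sc_1 [simp]: "sc 1 x = x" for x :: "'k \<Rightarrow>\<^sub>0 'v"
  by (rule poly_mapping_eqI) (simp add: lookup_pmap)
lemma sc_of_nat: "sc (of_nat n) x = of_nat n * x" for x :: "'v mpoly"
proof (induction n)
  case (Suc n)
  have "sc (of_nat (Suc n)) x = x + sc (of_nat n) x"
    by (rule poly_mapping_eqI) (simp add: lookup_pmap lookup_add scale_left_distrib)
  also have "\<dots> = of_nat (Suc n) * x" using Suc by (simp add: algebra_simps)
  finally show ?case .
qed (auto intro!: poly_mapping_eqI simp: lookup_pmap)
lemma sc_mult_mconst: "mconst a * sc c x = sc c (mconst a * x)"
proof (induction x rule: mpoly_induct)
  case (const v) then show ?case by (simp add: sc_mconst mult_single scale_mult_right)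
next
  case (var i x) then show ?case by (simp add: sc_mvar mvar_left_commute)
qed (auto simp: sc_add algebra_simps)
subsection \<open>The action of the exponential\<close>

definition Phi :: "nat \<Rightarrow> 'v mpoly \<Rightarrow> 'v mpoly" where
  "Phi i y = mvar i * y + Dm y"

lemma additive_Phi: "additive (Phi i)"
  by standard (simp add: Phi_def Dm_add algebra_simps)

lemma Phi_mpolys: "i < n \<Longrightarrow> x \<in> mpolys n \<Longrightarrow> Phi i x \<in> mpolys n"
  by (auto simp: Phi_def)

lemma exp_act_bound:
  assumes "\<forall>k\<ge>K. (mderiv i ^^ k) x = 0"
  shows "exp_act i b x = (\<Sum>k<K. sc (inverse (fact k)) (mconst ((D ^^ k) b) * (mderiv i ^^ k) x))"
  unfolding exp_act_def
proof (rule sum.mono_neutral_left)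
  show "{k. (mderiv i ^^ k) x \<noteq> 0} \<subseteq> {..<K}"
    using assms by (auto simp: not_le[symmetric])
  show "\<forall>k\<in>{..<K} - {k. (mderiv i ^^ k) x \<noteq> 0}.
      sc (inverse (fact k)) (mconst ((D ^^ k) b) * (mderiv i ^^ k) x) = 0"
    by (auto simp: additive.zero[OF additive_sc])
qed auto

lemma mderiv_pow_add: "(mderiv i ^^ k) (x + y) = (mderiv i ^^ k) x + (mderiv i ^^ k) y"
  for x y :: "'v mpoly"
  by (induction k) (auto simp: mderiv_add)

lemma mderiv_pow_mvar: "(mderiv i ^^ k) (mvar j * x) =
    (if j = i then of_nat k * (mderiv i ^^ (k - 1)) x else 0) + mvar j * (mderiv i ^^ k) x"
  for x :: "'v mpoly"
proof (induction k)
  case (Suc k)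
  have "mderiv i (of_nat k * y) = of_nat k * mderiv i y" for y :: "'v mpoly"
    by (induction k) (auto simp: algebra_simps mderiv_add additive.zero[OF additive_mderiv])
  then show ?case using Suc
    by (cases k) (auto simp: mderiv_add mderiv_mvar algebra_simps additive.zero[OF additive_mderiv])
qed simp

lemma exp_act_add: "exp_act i b (x + y) = exp_act i b x + exp_act i b y"
proof -
  obtain K L where KL: "\<forall>k\<ge>K. (mderiv i ^^ k) x = 0" "\<forall>k\<ge>L. (mderiv i ^^ k) y = 0"
    using mderiv_eventually_0 by metis
  let ?M = "max K L"
  have *: "\<forall>k\<ge>?M. (mderiv i ^^ k) x = 0" "\<forall>k\<ge>?M. (mderiv i ^^ k) y = 0"
    "\<forall>k\<ge>?M. (mderiv i ^^ k) (x + y) = 0"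
    using KL by (auto simp: mderiv_pow_add)
  show ?thesis unfolding exp_act_bound[OF *(1)] exp_act_bound[OF *(2)] exp_act_bound[OF *(3)]
    by (simp add: mderiv_pow_add distrib_left sc_add sum.distrib)
qed

lemma exp_act_mconst: "exp_act i b (mconst v) = mconst (b * v)"
proof -
  have "(mderiv i ^^ k) (0 :: 'v mpoly) = 0" for k
    by (induction k) (auto simp: additive.zero[OF additive_mderiv])
  then have "\<forall>k\<ge>1. (mderiv i ^^ k) (mconst v) = 0"
    by (metis One_nat_def Suc_le_D funpow_swap1 funpow.simps(2) comp_apply mderiv_mconst)
  from exp_act_bound[OF this] show ?thesis by (simp add: mult_single)
qed

lemma exp_act_mvar_other:
  assumes "j \<noteq> i" shows "exp_act i b (mvar j * x) = mvar j * exp_act i b x"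
proof -
  obtain K where K: "\<forall>k\<ge>K. (mderiv i ^^ k) x = 0" using mderiv_eventually_0 by metis
  then have K': "\<forall>k\<ge>K. (mderiv i ^^ k) (mvar j * x) = 0" using assms by (simp add: mderiv_pow_mvar)
  show ?thesis unfolding exp_act_bound[OF K] exp_act_bound[OF K']
    using assms by (simp add: mderiv_pow_mvar sum_distrib_left mvar_left_commute sc_mvar)
qed

text \<open>The k-th derivative of \<lambda>Q is \<lambda> times that of Q plus k times the
  derivative of Q of order k - 1. Since k/k! = 1/(k-1)!, the second part is the series for Q shifted
  by one, that is, with D b in place of b.\<close>

lemma exp_act_mvar_same: "exp_act i b (mvar i * x) = mvar i * exp_act i b x + exp_act i (D b) x"
proof -
  obtain K where K: "\<forall>k\<ge>K. (mderiv i ^^ k) x = 0" using mderiv_eventually_0 by metis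
  then have K': "\<forall>k\<ge>Suc K. (mderiv i ^^ k) (mvar i * x) = 0" by (simp add: mderiv_pow_mvar)
  have KS: "\<forall>k\<ge>Suc K. (mderiv i ^^ k) x = 0" using K by simp
  have fac: "sc (inverse (fact (Suc k))) (mconst c * (of_nat (Suc k) * y)) =
      sc (inverse (fact k)) (mconst c * y)" for k c and y :: "'v mpoly"
  proof -
    have "of_nat (Suc k) * y = sc (of_nat (Suc k)) y" by (rule sc_of_nat[symmetric])
    moreover have "inverse (fact (Suc k)) * of_nat (Suc k) = (inverse (fact k) :: 'f)"
      by (simp add: field_simps del: of_nat_Suc)
    ultimately show ?thesis by (metis sc_mult_mconst sc_sc)
  qed
  have "exp_act i b (mvar i * x) =
      (\<Sum>k<Suc K. sc (inverse (fact k)) (mconst ((D ^^ k) b) * (of_nat k * (mderiv i ^^ (k - 1)) x)))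
    + (\<Sum>k<Suc K. mvar i * sc (inverse (fact k)) (mconst ((D ^^ k) b) * (mderiv i ^^ k) x))"
    unfolding exp_act_bound[OF K'] sum.distrib[symmetric]
    by (intro sum.cong) (auto simp: mderiv_pow_mvar ring_distribs sc_add mvar_left_commute sc_mvar)
  also have "(\<Sum>k<Suc K. mvar i * sc (inverse (fact k)) (mconst ((D ^^ k) b) * (mderiv i ^^ k) x)) =
      mvar i * exp_act i b x"
    unfolding exp_act_bound[OF KS] by (rule sum_distrib_left[symmetric])
  also have "(\<Sum>k<Suc K. sc (inverse (fact k)) (mconst ((D ^^ k) b) * (of_nat k * (mderiv i ^^ (k - 1)) x))) =
      exp_act i (D b) x"
    unfolding exp_act_bound[OF K] sum.lessThan_Suc_shift
    by (simp add: fac del: of_nat_Suc fact_Suc funpow.simps)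
      (simp add: additive.zero[OF additive_sc] funpow_swap1)
  finally show ?thesis by (simp add: add.commute)
qed

text \<open>Taylor's formula: the exponential shifts \<lambda> to \<lambda> + \<partial>, where
  \<partial> acts on b only. The same shift occurs in the skew-symmetry of the bracket and in
  contraction, so this is the link between these and the Leibniz rule of cochains.\<close>

lemma exp_act_subop: "exp_act i b x = subop i (Phi i) (mconst b) x"
proof (induction x arbitrary: b rule: mpoly_induct)
  case (const v) then show ?case by (simp add: exp_act_mconst mult_single)
next
  case (var j x)
  have "subop i (Phi i) (mvar i * z) x = mvar i * subop i (Phi i) z x" for z x
  proof (induction x arbitrary: z rule: mpoly_induct)
    case (var j x)
    have "Phi i (mvar i * z) = mvar i * Phi i z"
      by (simp add: Phi_def Dm_mvar distrib_left)
    then show ?case using var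
      by (cases "j = i") (simp_all add: subop_mvar_same subop_mvar_other, rule mvar_left_commute)
  qed (auto simp: mult.assoc subop_add algebra_simps)
  then show ?case using var
    by (cases "j = i") (auto simp: exp_act_mvar_same exp_act_mvar_other subop_mvar_same subop_mvar_other
        Phi_def[of i "mconst b"] Dm_mconst subop_add_op[OF additive_Phi])
qed (auto simp: exp_act_add subop_add)

lemma additive_exp_act: "additive (exp_act i b)" by standard (rule exp_act_add)

lemma exp_act_add_left: "exp_act i (b + c) x = exp_act i b x + exp_act i c x"
  by (simp add: exp_act_subop single_add subop_add_op[OF additive_Phi])
lemma additive_exp_act_left: "additive (\<lambda>b. exp_act i b x)" by standard (rule exp_act_add_left)

lemma exp_act_mpolys: "i < n \<Longrightarrow> x \<in> mpolys n \<Longrightarrow> exp_act i b x \<in> mpolys n"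
  unfolding exp_act_subop by (intro subop_mpolys) (auto simp: Phi_mpolys)

lemmas exp_rules = exp_act_add exp_act_mconst exp_act_mvar_other exp_act_mvar_same

text \<open>The exponential of a derivation is multiplicative.\<close>

lemma exp_act_mult: "exp_act i (b * c) x = exp_act i b (exp_act i c x)"
proof (induction x arbitrary: b c rule: mpoly_induct)
  case (var j x)
  then show ?case
    by (cases "j = i") (auto simp: exp_rules D_mult exp_act_add_left algebra_simps)
qed (auto simp: exp_rules mult.assoc)

lemma exp_act_1: "exp_act i 1 x = x"
proof (induction x rule: mpoly_induct)
  case (var j x)
  then show ?case
    by (cases "j = i") (auto simp: exp_rules additive.zero[OF additive_exp_act_left])
qed (auto simp: exp_rules)

lemma exp_act_Dm: "exp_act i b (Dm x) = Dm (exp_act i b x) - exp_act i (D b) x"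
proof (induction x arbitrary: b rule: mpoly_induct)
  case (const v) then show ?case by (simp add: Dm_mconst exp_rules D_mult single_add)
next
  case (var j x)
  then show ?case
    by (cases "j = i") (simp_all add: Dm_mvar exp_rules Dm_add right_diff_distrib)
qed (auto simp: exp_rules Dm_add)

lemma exp_act_sc: "exp_act i b (sc c x) = sc c (exp_act i b x)"
proof (induction x arbitrary: b rule: mpoly_induct)
  case (const v) then show ?case by (simp add: exp_rules sc_mconst scale_mult_right)
next
  case (var j x)
  then show ?case
    by (cases "j = i") (auto simp: sc_mvar exp_rules sc_add)
qed (auto simp: exp_rules sc_add)

lemma exp_act_scale: "exp_act i (scale c b) x = sc c (exp_act i b x)"
proof (induction x arbitrary: b rule: mpoly_induct)
  case (const v) then show ?case by (simp add: exp_rules sc_mconst scale_mult_left)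
next
  case (var j x)
  then show ?case
    by (cases "j = i") (auto simp: sc_mvar exp_rules sc_add D_scale)
qed (auto simp: exp_rules sc_add)

subsection \<open>Contraction\<close>

text \<open>The variable with index 0 is replaced by the derivation acting on w, and the other
  variables are renumbered.\<close>

definition contr :: "'v \<Rightarrow> 'v mpoly \<Rightarrow> 'v mpoly" where
  "contr w x = (\<Sum>m\<in>ks x. mconst ((D ^^ lk m 0) w) * sgl (Poly_Mapping.map_key Suc m) (lk x m))"

lemma contr_add: "contr w (x + y) = contr w x + contr w y"
  unfolding contr_def by (rule sum_keys_add) (auto simp: single_add algebra_simps)

lemma additive_contr: "additive (contr w)" by standard (rule contr_add)

lemma contr_single: "contr w (sgl m v) = mconst ((D ^^ lk m 0) w) * sgl (Poly_Mapping.map_key Suc m) v"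
  unfolding contr_def by (rule sum_keys_single) auto

lemma contr_mconst: "contr w (mconst v) = mconst (w * v)"
  by (simp add: contr_single mult_single)

lemma contr_mvar_0: "contr w (mvar 0 * x) = contr (D w) x"
proof (rule additive_eqI[of "\<lambda>x. contr w (mvar 0 * x)" "\<lambda>x. contr (D w) x"])
  show "additive (\<lambda>x. contr w (mvar 0 * x))" "additive (\<lambda>x. contr (D w) x)"
    by (auto intro!: additive.intro simp: algebra_simps contr_add)
  fix m :: "nat \<Rightarrow>\<^sub>0 nat" and v :: 'v
  have "Poly_Mapping.map_key Suc (sgl 0 1 + m) = Poly_Mapping.map_key Suc m"
    by (rule poly_mapping_eqI) (simp add: map_key.rep_eq lookup_add lookup_single)
  then show "contr w (mvar 0 * sgl m v) = contr (D w) (sgl m v)"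
    by (simp add: mvar_single contr_single lookup_add funpow_swap1)
qed

lemma contr_mvar_Suc: "contr w (mvar (Suc k) * x) = mvar k * contr w x"
proof (rule additive_eqI[of "\<lambda>x. contr w (mvar (Suc k) * x)" "\<lambda>x. mvar k * contr w x"])
  show "additive (\<lambda>x. contr w (mvar (Suc k) * x))" "additive (\<lambda>x. mvar k * contr w x)"
    by (auto intro!: additive.intro simp: algebra_simps contr_add)
  fix m :: "nat \<Rightarrow>\<^sub>0 nat" and v :: 'v
  have "Poly_Mapping.map_key Suc (sgl (Suc k) 1 + m) = sgl k 1 + Poly_Mapping.map_key Suc m"
    by (rule poly_mapping_eqI) (simp add: map_key.rep_eq lookup_add lookup_single)
  then show "contr w (mvar (Suc k) * sgl m v) = mvar k * contr w (sgl m v)"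
    by (simp add: mvar_single contr_single lookup_add lookup_single)
      (simp add: mvar_left_commute[symmetric] mvar_single)
qed

lemmas contr_rules = contr_add contr_mconst contr_mvar_0 contr_mvar_Suc

lemma contr_mpolys: "x \<in> mpolys (Suc n) \<Longrightarrow> contr w x \<in> mpolys n"
proof (induction arbitrary: w rule: mpolys_induct)
  case (var i x) then show ?case by (cases i) (auto simp: contr_rules)
qed (auto simp: contr_rules)

lemma contr_Dm: "contr w (Dm x) = Dm (contr w x) - contr (D w) x"
proof (induction x arbitrary: w rule: mpoly_induct)
  case (const v) then show ?case by (simp add: Dm_mconst contr_rules D_mult single_add)
next
  case (var j x)
  then show ?case by (cases j) (simp_all add: Dm_mvar contr_rules Dm_add right_diff_distrib)
qed (auto simp: contr_rules Dm_add)

lemma contr_sc: "contr b (sc c x) = sc c (contr b x)"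
proof (induction x arbitrary: b rule: mpoly_induct)
  case (const v) then show ?case by (simp add: contr_rules sc_mconst scale_mult_right)
next
  case (var j x) then show ?case by (cases j) (auto simp: sc_mvar contr_rules sc_add)
qed (auto simp: contr_rules sc_add)

subsection \<open>Brackets\<close>

abbreviation "bp \<equiv> bracket_poly br"

lemma br_0_left [simp]: "br 0 b = 0"
  using additive.zero[of "\<lambda>a. br a b"] br_add_left by (auto simp: additive_def)
lemma br_0_right [simp]: "br a 0 = 0"
  using additive.zero[of "\<lambda>b. br a b"] br_add_right by (auto simp: additive_def)

lemma bp_add: "bp a L (x + y) = bp a L x + bp a L y"
  unfolding bracket_poly_def
  by (rule sum_keys_add) (auto simp: bracket_at_lev br_add_right lev_add algebra_simps additive.zero[OF additive_lev])

lemma additive_bp: "additive (bp a L)" by standard (rule bp_add)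

lemma bp_single: "bp a L (sgl m v) = sgl m 1 * lev L (br a v)"
  unfolding bracket_poly_def bracket_at_lev
  by (rule sum_keys_single) (auto simp: additive.zero[OF additive_lev])

lemma bp_mconst: "bp a L (mconst v) = lev L (br a v)"
  by (simp add: bp_single)

lemma bp_mvar: "bp a L (mvar i * x) = mvar i * bp a L x"
proof (rule additive_eqI[of "\<lambda>x. bp a L (mvar i * x)" "\<lambda>x. mvar i * bp a L x"])
  show "additive (\<lambda>x. bp a L (mvar i * x))" "additive (\<lambda>x. mvar i * bp a L x)"
    by (auto intro!: additive.intro simp: algebra_simps bp_add)
qed (simp add: mvar_single bp_single mult.assoc[symmetric])

lemmas bp_rules = bp_add bp_mconst bp_mvar

lemma bp_lin: "lin n K \<Longrightarrow> bp a L (K * x) = K * bp a L x"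
  by (rule lin_mult_left[OF _ additive_bp]) (auto simp: bp_mvar)

lemma bp_Dm: "lin n L \<Longrightarrow> bp a L (Dm x) = L * bp a L x + Dm (bp a L x)"
proof (induction x rule: mpoly_induct)
  case (const v)
  then show ?case by (simp add: Dm_mconst bp_rules br_D_right lev_add lev_lam[unfolded One_nat_def] lev_pmap[OF additive_D])
next
  case (var i x) then show ?case by (simp add: Dm_mvar bp_rules algebra_simps mvar_left_commute)
qed (auto simp: Dm_add bp_rules algebra_simps)

lemma bp_add_left: "bp (a + b) L x = bp a L x + bp b L x"
  by (induction x rule: mpoly_induct) (auto simp: bp_rules br_add_left lev_add algebra_simps)

lemma bp_0_left [simp]: "bp 0 L x = 0"
  using bp_add_left[of 0 0] by simp

lemma bp_sc: "lin n L \<Longrightarrow> bp a L (sc c x) = sc c (bp a L x)"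
proof (induction x rule: mpoly_induct)
  case (const v)
  then show ?case by (simp add: sc_mconst bp_rules br_scale_right lev_pmap[OF additive_scale])
qed (auto simp: sc_mvar sc_add bp_rules algebra_simps)

lemma bp_mpolys: "x \<in> mpolys n \<Longrightarrow> lin n L \<Longrightarrow> bp a L x \<in> mpolys n"
  by (induction rule: mpolys_induct) (auto simp: bp_rules lev_mpolys)

subsection \<open>Congruence modulo total derivatives\<close>

definition del :: "nat \<Rightarrow> 'v mpoly \<Rightarrow> 'v mpoly" where
  "del n x = Dm x + (\<Sum>i<n. mvar i) * x"

lemma del_add: "del n (x + y) = del n x + del n y" by (simp add: del_def Dm_add algebra_simps)
lemma additive_del: "additive (del n)" by standard (rule del_add)
lemma total_deriv_del: "total_deriv n = del n ` mpolys n" by (simp add: total_deriv_def del_def)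

lemma lin_vars: "lin n (\<Sum>i<n. mvar i)" by (intro lin_sum lin_var) auto

lemma del_mpolys: "x \<in> mpolys n \<Longrightarrow> del n x \<in> mpolys n"
  unfolding del_def using lin_mpolys[OF lin_vars] by auto

definition eqv :: "nat \<Rightarrow> 'v mpoly \<Rightarrow> 'v mpoly \<Rightarrow> bool" where
  "eqv n x y \<longleftrightarrow> x - y \<in> total_deriv n"

lemma eqv_alt: "eqv n x y \<longleftrightarrow> (\<exists>z\<in>mpolys n. x = y + del n z)"
  by (auto simp: eqv_def total_deriv_del algebra_simps image_iff eq_diff_eq diff_eq_eq)

lemma eqv_refl [simp, intro]: "eqv n x x"
  unfolding eqv_alt by (rule bexI[of _ 0]) (auto simp: additive.zero[OF additive_del])
lemma eqv_eq: "x = y \<Longrightarrow> eqv n x y" by simp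
lemma eqv_sym: "eqv n x y \<Longrightarrow> eqv n y x"
proof -
  assume "eqv n x y"
  then obtain z where "z \<in> mpolys n" "x = y + del n z" by (auto simp: eqv_alt)
  then show ?thesis unfolding eqv_alt
    by (intro bexI[of _ "- z"]) (auto simp: additive.minus[OF additive_del])
qed
lemma eqv_add: "eqv n x y \<Longrightarrow> eqv n x' y' \<Longrightarrow> eqv n (x + x') (y + y')"
proof -
  assume "eqv n x y" "eqv n x' y'"
  then obtain z z' where "z \<in> mpolys n" "x = y + del n z" "z' \<in> mpolys n" "x' = y' + del n z'"
    by (auto simp: eqv_alt)
  then show ?thesis unfolding eqv_alt
    by (intro bexI[of _ "z + z'"]) (auto simp: del_add)
qed
lemma eqv_trans [trans]: "eqv n x y \<Longrightarrow> eqv n y z \<Longrightarrow> eqv n x z"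
  using eqv_add[of n x y y z] by (simp add: eqv_def)
lemma eqv_eq_trans [trans]: "eqv n x y \<Longrightarrow> y = z \<Longrightarrow> eqv n x z" by simp
lemma eq_eqv_trans [trans]: "x = y \<Longrightarrow> eqv n y z \<Longrightarrow> eqv n x z" by simp
lemma eqv_minus: "eqv n x y \<Longrightarrow> eqv n (- x) (- y)"
  using eqv_sym[of n x y] by (simp add: eqv_def)
lemma eqv_diff: "eqv n x y \<Longrightarrow> eqv n x' y' \<Longrightarrow> eqv n (x - x') (y - y')"
  using eqv_add[of n x y "- x'" "- y'"] eqv_minus by simp
lemma eqv_sg: "eqv n x y \<Longrightarrow> eqv n (sg k x) (sg k y)"
  by (simp add: sg_def eqv_minus)
lemma eqv_sum: "(\<And>i. i \<in> A \<Longrightarrow> eqv n (f i) (g i)) \<Longrightarrow> eqv n (sum f A) (sum g A)"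
  by (induction A rule: infinite_finite_induct) (auto intro: eqv_add)
lemma eqv_mpolys: "eqv n x y \<Longrightarrow> y \<in> mpolys n \<Longrightarrow> x \<in> mpolys n"
  by (auto simp: eqv_alt del_mpolys)

text \<open>The criterion by which the operators below are shown to descend to the quotients:
  intertwine the total derivatives \<open>del n\<close> and \<open>del m\<close>.\<close>

lemma eqv_op:
  assumes "eqv n x y" "additive f" "\<And>x. x \<in> mpolys n \<Longrightarrow> f x \<in> mpolys m"
    "\<And>x. x \<in> mpolys n \<Longrightarrow> f (del n x) = del m (f x)"
  shows "eqv m (f x) (f y)"
proof -
  obtain z where "z \<in> mpolys n" "x = y + del n z" using assms(1) by (auto simp: eqv_alt)
  then show ?thesis unfolding eqv_alt using assms
    by (intro bexI[of _ "f z"]) (auto simp: additive.add)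
qed

lemma eqv_lin:
  assumes "eqv n x y" "lin n L" shows "eqv n (L * x) (L * y)"
proof (rule eqv_op[OF assms(1)])
  show "additive ((*) L)" by (standard) (simp add: algebra_simps)
  show "L * del n x = del n (L * x)" for x
    unfolding del_def using lin_commute[OF assms(2), of "\<Sum>i<n. mvar i"]
    by (simp add: Dm_lin[OF assms(2)] ring_distribs mult.assoc[symmetric])
qed (use lin_mpolys[OF assms(2)] in auto)

lemma eqv_mvar: "eqv n x y \<Longrightarrow> i < n \<Longrightarrow> eqv n (mvar i * x) (mvar i * y)"
  by (rule eqv_lin[OF _ lin_var])

lemma eqv_pmap:
  assumes "eqv n x y" "additive f" "\<And>v. f (D v) = D (f v)" shows "eqv n (pmap f x) (pmap f y)"
proof (rule eqv_op[OF assms(1) additive_pmap[OF assms(2)]])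
  show "pmap f (del n x) = del n (pmap f x)" for x
    unfolding del_def using assms(2,3)
    by (simp add: additive.add[OF additive_pmap[OF assms(2)]] pmap_lin[OF assms(2) lin_vars]
        pmap_comm_pmap additive.zero)
qed auto

lemma eqv_sc: "eqv n x y \<Longrightarrow> eqv n (sc c x) (sc c y)"
  by (rule eqv_pmap) (auto simp: additive_scale D_scale)

text \<open>In the total derivative only the variable i fails to commute with the exponential, and
  its extra term in D b cancels the one produced by \<open>exp_act_Dm\<close>.\<close>

lemma eqv_exp:
  assumes "eqv n x y" "i < n" shows "eqv n (exp_act i b x) (exp_act i b y)"
proof (rule eqv_op[OF assms(1) additive_exp_act])
  fix x :: "'v mpoly"
  have "exp_act i b ((\<Sum>k<n. mvar k) * x) = (\<Sum>k<n. mvar k * exp_act i b x + (if k = i then exp_act i (D b) x else 0))"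
    unfolding sum_distrib_right additive.sum[OF additive_exp_act]
    by (intro sum.cong) (auto simp: exp_rules)
  also have "\<dots> = (\<Sum>k<n. mvar k) * exp_act i b x + exp_act i (D b) x"
    using assms(2) by (simp add: sum.distrib sum_distrib_right)
  finally show "exp_act i b (del n x) = del n (exp_act i b x)"
    by (simp add: del_def exp_act_add exp_act_Dm)
qed (use assms exp_act_mpolys in auto)

text \<open>The variable 0 turns into \<partial> acting on w. This supplies precisely the term
  \<open>contr (D w) x\<close> that is missing in \<open>contr_Dm\<close>, because \<partial> acts
  on the product of w with the coefficients.\<close>

lemma contr_del: "contr w (del (Suc n) x) = del n (contr w x)"
proof -
  have "contr w ((\<Sum>k<Suc n. mvar k) * x) = contr (D w) x + (\<Sum>k<n. mvar k) * contr w x"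
    unfolding sum.lessThan_Suc_shift sum_distrib_right ring_distribs
    by (simp add: contr_rules additive.sum[OF additive_contr])
  then show ?thesis by (simp add: del_def contr_add contr_Dm)
qed

lemma eqv_contr: "eqv (Suc n) x y \<Longrightarrow> eqv n (contr w x) (contr w y)"
  by (erule eqv_op) (auto simp: additive_contr contr_mpolys contr_del)

lemma msubst_vars:
  assumes "\<And>L. L \<in> set Ls \<Longrightarrow> lin n L"
  shows "msubst Ls ((\<Sum>i<length Ls. mvar i) * x) = sum_list Ls * msubst Ls x"
proof -
  have "msubst Ls ((\<Sum>i<length Ls. mvar i) * x) = (\<Sum>i<length Ls. Ls ! i * msubst Ls x)"
    unfolding sum_distrib_right additive.sum[OF additive_msubst]
    using assms by (intro sum.cong msubst_mvar_lin[where n=n]) auto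
  then show ?thesis by (simp add: sum_distrib_right sum_list_sum_nth atLeast0LessThan)
qed

lemma msubst_del:
  assumes "\<And>L. L \<in> set Ls \<Longrightarrow> lin m L" "length Ls = n" "x \<in> mpolys n"
  shows "msubst Ls (del n x) = Dm (msubst Ls x) + sum_list Ls * msubst Ls x"
  using assms unfolding del_def by (simp add: msubst_add msubst_vars[OF assms(1)] pmap_msubst[OF additive_D _ assms(1)] flip: assms(2))

text \<open>The condition on the sum of \<open>Ls\<close> says that \<partial> plus the sum of the
  variables is carried to the corresponding operator in m variables.\<close>

lemma eqv_msubst:
  assumes "eqv n x y" "length Ls = n" "\<And>L. L \<in> set Ls \<Longrightarrow> lin m L" "sum_list Ls = (\<Sum>i<m. mvar i)"
  shows "eqv m (msubst Ls x) (msubst Ls y)"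
proof (rule eqv_op[OF assms(1) additive_msubst])
  show "msubst Ls x \<in> mpolys m" if "x \<in> mpolys n" for x
    using that assms by (intro msubst_mpolys) auto
  show "msubst Ls (del n x) = del m (msubst Ls x)" if "x \<in> mpolys n" for x
    by (subst msubst_del[OF assms(3,2) that]) (auto simp: del_def assms(4))
qed

text \<open>Moving \<partial> out of the bracket produces the additional summand L
  (\<open>bp_Dm\<close>). Hence L and the entries of \<open>Ls\<close> together must add up to the
  sum of the variables.\<close>

lemma eqv_bp:
  assumes "eqv n x y" "length Ls = n" "\<And>L. L \<in> set Ls \<Longrightarrow> lin m L" "lin m L"
    "L + sum_list Ls = (\<Sum>i<m. mvar i)"
  shows "eqv m (bp a L (msubst Ls x)) (bp a L (msubst Ls y))"
proof (rule eqv_op[OF assms(1)])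
  show "additive (\<lambda>x. bp a L (msubst Ls x))"
    by standard (simp add: msubst_add bp_add)
  show "bp a L (msubst Ls x) \<in> mpolys m" if "x \<in> mpolys n" for x
    using that assms by (intro bp_mpolys msubst_mpolys) auto
  have l: "lin m (sum_list Ls)" using assms(3) by (induction Ls) (auto intro: lin.intros)
  show "bp a L (msubst Ls (del n x)) = del m (bp a L (msubst Ls x))" if "x \<in> mpolys n" for x
    by (subst msubst_del[OF assms(3,2) that])
      (auto simp: del_def bp_add bp_Dm[OF assms(4)] bp_lin[OF l] assms(5)[symmetric] algebra_simps)
qed

section \<open>Cosets modulo total derivatives\<close>

lemma qclass_eq: "qclass n x = qclass n y \<longleftrightarrow> eqv n x y"
proof
  assume "qclass n x = qclass n y"
  moreover have "0 \<in> total_deriv n" using eqv_refl[of n x] unfolding eqv_def by simp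
  then have "x \<in> qclass n x" unfolding qclass_def by (intro image_eqI[of _ _ 0]) auto
  ultimately show "eqv n x y" by (auto simp: qclass_def eqv_def)
next
  have *: "qclass n x \<subseteq> qclass n y" if "eqv n x y" for x y
  proof
    fix z assume "z \<in> qclass n x"
    then have "eqv n z x" by (auto simp: qclass_def eqv_def)
    then have "eqv n z y" using that by (rule eqv_trans)
    then show "z \<in> qclass n y" by (force simp: qclass_def eqv_def)
  qed
  assume "eqv n x y"
  then show "qclass n x = qclass n y" using * eqv_sym by blast
qed

lemma mem_qclass: "z \<in> qclass n x \<longleftrightarrow> eqv n z x"
  by (force simp: qclass_def eqv_def)

lemma rep_qclass: "eqv n (rep (qclass n x)) x"
  unfolding rep_def mem_qclass[symmetric] by (rule someI[of _ x]) (simp add: mem_qclass)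

lemma qclass_add: "qclass n x + qclass n y = qclass n (x + y)"
proof
  show "qclass n x + qclass n y \<subseteq> qclass n (x + y)"
    by (auto simp: set_plus_def mem_qclass intro: eqv_add)
  show "qclass n (x + y) \<subseteq> qclass n x + qclass n y"
  proof
    fix z assume "z \<in> qclass n (x + y)"
    then have "eqv n (z - y) (x + y - y)" by (intro eqv_diff) (auto simp: mem_qclass)
    then have "(z - y) + y \<in> qclass n x + qclass n y" by (intro set_plus_intro) (auto simp: mem_qclass)
    then show "z \<in> qclass n x + qclass n y" by simp
  qed
qed

end

section \<open>Lists\<close>

definition skip :: "nat \<Rightarrow> nat \<Rightarrow> nat" where "skip k i = (if i < k then i else Suc i)"

abbreviation vars :: "nat \<Rightarrow> 'a::ring_1 mpoly list" where "vars n \<equiv> map mvar [0..<n]"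

lemma length_omit: "k < length xs \<Longrightarrow> length (omit k xs) = length xs - 1"
  by (auto simp: omit_def)

lemma nth_omit: "k < length xs \<Longrightarrow> i < length xs - 1 \<Longrightarrow> omit k xs ! i = xs ! skip k i"
  by (auto simp: omit_def skip_def nth_append)

lemma omit_Cons_0 [simp]: "omit 0 (x # xs) = xs" by (simp add: omit_def)
lemma omit_Cons_Suc [simp]: "omit (Suc k) (x # xs) = x # omit k xs" by (simp add: omit_def)

lemma nth_in_set_omit: "k < length xs \<Longrightarrow> i < length xs \<Longrightarrow> k \<noteq> i \<Longrightarrow> xs ! k \<in> set (omit i xs)"
proof -
  assume a: "k < length xs" "i < length xs" "k \<noteq> i"
  let ?j = "if k < i then k else k - 1"
  have "?j < length (omit i xs)" "omit i xs ! ?j = xs ! k"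
    using a by (auto simp: length_omit nth_omit skip_def)
  then show ?thesis by (metis nth_mem)
qed

lemma sum_list_omit: "k < length xs \<Longrightarrow> xs ! k + sum_list (omit k xs) = sum_list (xs :: 'a::comm_monoid_add list)"
proof (induction xs arbitrary: k)
  case (Cons x xs) then show ?case by (cases k) (auto simp: add.left_commute)
qed simp

lemma sum_list_vars: "sum_list (vars n) = (\<Sum>i<n. mvar i)"
  by (simp add: interv_sum_list_conv_sum_set_nat atLeast0LessThan)

lemma sum_list_omit_vars: "k < n \<Longrightarrow> mvar k + sum_list (omit k (vars n)) = (\<Sum>i<n. mvar i)"
  using sum_list_omit[of k "vars n"] by (simp add: sum_list_vars)

lemma omit_update_same: "omit i (xs[i := a]) = omit i xs"
  by (simp add: omit_def)

lemma omit_map: "omit i (map f xs) = map f (omit i xs)"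
  by (simp add: omit_def take_map drop_map)

lemma set_omit: "set (omit i xs) \<subseteq> set xs"
  by (auto simp: omit_def dest: in_set_takeD in_set_dropD)

lemma lin_omit_vars: "L \<in> set (omit k (vars n)) \<Longrightarrow> lin n L"
  using set_omit[of k "vars n"] by (force intro: lin_var)

lemma length_swap_adj [simp]: "length (swap_adj i xs) = length xs" by (simp add: swap_adj_def)

lemma swap_adj_Cons [simp]: "swap_adj (Suc i) (x # xs) = x # swap_adj i xs"
  by (simp add: swap_adj_def)

lemma swap_adj_0 [simp]: "swap_adj 0 (x # y # xs) = y # x # xs"
  by (simp add: swap_adj_def)

lemma set_swap_adj: "Suc i < length xs \<Longrightarrow> set (swap_adj i xs) = set xs"
  by (simp add: swap_adj_def set_swap)

lemma mset_swap_adj: "Suc i < length xs \<Longrightarrow> sum_list (swap_adj i xs) = sum_list (xs :: 'a::comm_monoid_add list)"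
proof (induction xs arbitrary: i)
  case (Cons x xs)
  then show ?case by (cases i; cases xs) (auto simp: add.left_commute)
qed simp

section \<open>Homogeneous polynomials and the Leibniz rule for the bracket\<close>

lemma lookup_mconst_mult: "lk (sgl 0 a * x) m = a * lk x m"
  for x :: "'k::comm_monoid_add \<Rightarrow>\<^sub>0 'v::ring_1"
  by (simp add: mult_map_scale_conv_mult[symmetric] lookup_pmap)

lemma lookup_mult_mconst: "lk (x * sgl 0 a) m = lk x m * a"
  for x :: "'k::comm_monoid_add \<Rightarrow>\<^sub>0 'v::ring_1"
proof -
  have "x * sgl 0 a = pmap (\<lambda>v. v * a) x"
  proof (rule additive_eqI[of "\<lambda>x. x * sgl 0 a" "pmap (\<lambda>v. v * a)"])
    show "additive (\<lambda>x. x * sgl 0 a)" by standard (simp add: algebra_simps)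
    show "additive (pmap (\<lambda>v. v * a) :: ('k \<Rightarrow>\<^sub>0 'v) \<Rightarrow> _)"
      by (intro additive_pmap) (standard, simp add: algebra_simps)
  qed (simp add: mult_single)
  then show ?thesis by (simp add: lookup_pmap)
qed

context poisson_vertex_superalgebra begin

definition homp :: "nat \<Rightarrow> ('k \<Rightarrow>\<^sub>0 'v) \<Rightarrow> bool" where
  "homp p x \<longleftrightarrow> (\<forall>m. lk x m \<in> gr p)"

lemma homp_add: "p \<le> 1 \<Longrightarrow> homp p x \<Longrightarrow> homp p y \<Longrightarrow> homp p (x + y)"
  by (simp add: homp_def lookup_add gr_add)
lemma homp_sg: "p \<le> 1 \<Longrightarrow> homp p x \<Longrightarrow> homp p (sg k x)"
  by (simp add: homp_def lookup_sg gr_sg)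
lemma homp_sum: "p \<le> 1 \<Longrightarrow> (\<And>i. i \<in> A \<Longrightarrow> homp p (f i)) \<Longrightarrow> homp p (sum f A)"
  by (simp add: homp_def lookup_sum gr_sumI)

lemma mconst_supercommute:
  fixes x :: "'k::comm_monoid_add \<Rightarrow>\<^sub>0 'v"
  assumes "p \<le> 1" "q \<le> 1" "a \<in> gr p" "homp q x" shows "sgl 0 a * x = sg (p * q) (x * sgl 0 a)"
proof (rule poly_mapping_eqI)
  fix m
  have "a * lk x m = sg (p * q) (lk x m * a)"
    using supercommute[of p q a "lk x m"] assms unfolding sg_eq by (simp add: homp_def)
  then show "lk (sgl 0 a * x) m = lk (sg (p * q) (x * sgl 0 a)) m"
    by (simp add: lookup_mconst_mult lookup_mult_mconst lookup_sg)
qed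

lemma gr_induct:
  assumes "\<And>x. x \<in> gr 0 \<Longrightarrow> P x" "\<And>x. x \<in> gr 1 \<Longrightarrow> P x" "\<And>x y. P x \<Longrightarrow> P y \<Longrightarrow> P (x + y)"
  shows "P v"
  by (subst hpart_sum[of v]) (intro assms(3) assms(1)[OF hpart_in] assms(2)[OF hpart_in]; simp)

lemma br_homp: "p \<le> 1 \<Longrightarrow> q \<le> 1 \<Longrightarrow> a \<in> gr p \<Longrightarrow> b \<in> gr q \<Longrightarrow> homp ((p + q) mod 2) (br a b)"
  using br_parity by (simp add: homp_def)

text \<open>The Leibniz rule with u kept on the left: moving it there across a bracket of parity p +
  r changes the sign from q r to p q. The result no longer refers to the parity of v, so v may be
  inhomogeneous.\<close>

lemma br_mult:
  assumes "p \<le> 1" "q \<le> 1" "a \<in> gr p" "u \<in> gr q"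
  shows "br a (u * v) = br a u * lconst v + sg (p * q) (lconst u * br a v)"
proof -
  have h: "br a (u * v) = br a u * lconst v + sg (p * q) (lconst u * br a v)"
    if v: "r \<le> 1" "v \<in> gr r" for r v
  proof -
    have "br a (u * v) = br a u * lconst v + sg (q * r) (br a v * lconst u)"
      using br_leibniz[of q r u v a] assms v by (simp add: sg_eq)
    moreover have "lconst u * br a v = sg (q * ((p + r) mod 2)) (br a v * lconst u)"
      using assms v by (intro mconst_supercommute br_homp) auto
    moreover have "even (q * r) = even (p * q + q * ((p + r) mod 2))"
      by (auto simp: even_mult_iff)
    ultimately show ?thesis by (simp only: sg_sg) (simp only: sg_def)
  qed
  show ?thesis
    by (induction v rule: gr_induct) (use h[of 0] h[of 1] in \<open>auto simp: algebra_simps br_add_right sg_add single_add\<close>)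
qed

lemma lev_lconst_mult:
  assumes "lin n L" shows "lev L (lconst u * f) = mconst u * lev L f"
proof (rule additive_eqI[of "\<lambda>f. lev L (lconst u * f)" "\<lambda>f. mconst u * lev L f"])
  show "additive (\<lambda>f. lev L (lconst u * f))" "additive (\<lambda>f. mconst u * lev L f)"
    by (auto intro!: additive.intro simp: algebra_simps lev_add)
  fix k v
  have "L ^ k * mconst u = mconst u * L ^ k"
  proof (induction k)
    case (Suc k)
    have "L * (L ^ k * mconst u) = (L * mconst u) * L ^ k" using Suc by (simp add: mult.assoc)
    then show ?case by (simp add: mult.assoc lin_commute[OF assms, of "mconst u"])
  qed simp
  then show "lev L (lconst u * sgl k v) = mconst u * lev L (sgl k v)"
    by (simp add: mult_single lev_single)
      (metis (no_types, lifting) add_0 mult.assoc mult_single)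
qed

lemma lev_br_mult:
  assumes "p \<le> 1" "q \<le> 1" "a \<in> gr p" "u \<in> gr q" "lin n L"
  shows "lev L (br a (u * v)) = lev L (br a u) * mconst v + sg (p * q) (mconst u * lev L (br a v))"
  using assms by (simp add: br_mult lev_add lev_mult_lconst sg_additive[OF additive_lev] lev_lconst_mult[OF assms(5)])

lemma msubst_mult_mconst:
  assumes "x \<in> mpolys (length Ls)" "\<And>L. L \<in> set Ls \<Longrightarrow> lin n L"
  shows "msubst Ls (x * mconst v) = msubst Ls x * mconst v"
  using assms(1)
proof (induction rule: mpolys_induct)
  case (const w) then show ?case by (simp add: mult_single)
next
  case (var i x)
  then have "lin n (Ls ! i)" using assms(2) by auto
  then show ?case using var by (simp add: msubst_mvar_lin mult.assoc)
qed (auto simp: msubst_add algebra_simps)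

section \<open>Representatives of cochains\<close>

text \<open>
  The conditions defining cochains, for representatives in the polynomial ring instead of
  cosets. Parities enter only through signs and modulo 2, so e may be any natural number.
\<close>

definition rc :: "nat \<Rightarrow> nat \<Rightarrow> ('v list \<Rightarrow> 'v mpoly) \<Rightarrow> bool" where
  "rc n e y \<longleftrightarrow>
    (\<forall>as. length as = n \<longrightarrow> y as \<in> mpolys n) \<and>
    (\<forall>as i a b. length as = n \<and> i < n \<longrightarrow> eqv n (y (as[i := a + b])) (y (as[i := a]) + y (as[i := b]))) \<and>
    (\<forall>as i a c. length as = n \<and> i < n \<longrightarrow> eqv n (y (as[i := scale c a])) (sc c (y (as[i := a])))) \<and>
    (\<forall>as ps. length as = n \<and> hom_list ps as \<longrightarrow>
       (\<exists>x. eqv n x (y as) \<and> homp (opp ((e + (\<Sum>i<n. opp (ps ! i))) mod 2)) x)) \<and>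
    (\<forall>as i. length as = n \<and> i < n \<longrightarrow> eqv n (y (as[i := D (as ! i)])) (- (mvar i * y as))) \<and>
    (\<forall>as ps i. length as = n \<and> hom_list ps as \<and> Suc i < n \<longrightarrow>
       eqv n (msubst (swap_adj i (vars n)) (y (swap_adj i as))) (sg (opp (ps ! i) * opp (ps ! Suc i)) (y as))) \<and>
    (\<forall>as ps i b c p q. length as = n \<and> hom_list ps as \<and> i < n \<and> p \<le> 1 \<and> q \<le> 1 \<and> b \<in> gr p \<and> c \<in> gr q \<longrightarrow>
       eqv n (y (as[i := b * c]))
        (sg (p * (e + (\<Sum>k<i. opp (ps ! k)))) (exp_act i b (y (as[i := c])))
         + sg (q * (p + (e + (\<Sum>k<i. opp (ps ! k))))) (exp_act i c (y (as[i := b])))))"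

lemma rcI:
  assumes "\<And>as. length as = n \<Longrightarrow> y as \<in> mpolys n"
    and "\<And>as i a b. length as = n \<Longrightarrow> i < n \<Longrightarrow> eqv n (y (as[i := a + b])) (y (as[i := a]) + y (as[i := b]))"
    and "\<And>as i a c. length as = n \<Longrightarrow> i < n \<Longrightarrow> eqv n (y (as[i := scale c a])) (sc c (y (as[i := a])))"
    and "\<And>as ps. length as = n \<Longrightarrow> hom_list ps as \<Longrightarrow>
       \<exists>x. eqv n x (y as) \<and> homp (opp ((e + (\<Sum>i<n. opp (ps ! i))) mod 2)) x"
    and "\<And>as i. length as = n \<Longrightarrow> i < n \<Longrightarrow> eqv n (y (as[i := D (as ! i)])) (- (mvar i * y as))"
    and "\<And>as ps i. length as = n \<Longrightarrow> hom_list ps as \<Longrightarrow> Suc i < n \<Longrightarrow>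
       eqv n (msubst (swap_adj i (vars n)) (y (swap_adj i as))) (sg (opp (ps ! i) * opp (ps ! Suc i)) (y as))"
    and "\<And>as ps i b c p q. length as = n \<Longrightarrow> hom_list ps as \<Longrightarrow> i < n \<Longrightarrow> p \<le> 1 \<Longrightarrow> q \<le> 1 \<Longrightarrow> b \<in> gr p \<Longrightarrow> c \<in> gr q \<Longrightarrow>
       eqv n (y (as[i := b * c]))
        (sg (p * (e + (\<Sum>k<i. opp (ps ! k)))) (exp_act i b (y (as[i := c])))
         + sg (q * (p + (e + (\<Sum>k<i. opp (ps ! k))))) (exp_act i c (y (as[i := b]))))"
  shows "rc n e y"
  unfolding rc_def by (intro conjI allI impI; (elim conjE)?; rule assms; assumption)

lemmas rc_mpolys = rc_def[THEN iffD1, THEN conjunct1, rule_format]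
lemmas rc_add = rc_def[THEN iffD1, THEN conjunct2, THEN conjunct1, rule_format, OF _ conjI]
lemmas rc_scale = rc_def[THEN iffD1, THEN conjunct2, THEN conjunct2, THEN conjunct1, rule_format, OF _ conjI]
lemmas rc_parity = rc_def[THEN iffD1, THEN conjunct2, THEN conjunct2, THEN conjunct2, THEN conjunct1,
    rule_format, OF _ conjI]
lemmas rc_sesq = rc_def[THEN iffD1, THEN conjunct2, THEN conjunct2, THEN conjunct2, THEN conjunct2,
    THEN conjunct1, rule_format, OF _ conjI]
lemmas rc_sym = rc_def[THEN iffD1, THEN conjunct2, THEN conjunct2, THEN conjunct2, THEN conjunct2,
    THEN conjunct2, THEN conjunct1, rule_format, OF _ conjI[OF _ conjI]]
lemmas rc_leibniz = rc_def[THEN iffD1, THEN conjunct2, THEN conjunct2, THEN conjunct2, THEN conjunct2,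
    THEN conjunct2, THEN conjunct2, rule_format,
    OF _ conjI[OF _ conjI[OF _ conjI[OF _ conjI[OF _ conjI[OF _ conjI]]]]]]

definition toY :: "nat \<Rightarrow> ('v list \<Rightarrow> 'v mpoly) \<Rightarrow> 'v cochain" where
  "toY n y = (\<lambda>as. if length as = n then qclass n (y as) else {})"

lemma toY_eq: "toY n y = toY n z \<longleftrightarrow> (\<forall>as. length as = n \<longrightarrow> eqv n (y as) (z as))"
  by (auto simp: toY_def fun_eq_iff qclass_eq)

lemma eqv_right: "eqv n b b' \<Longrightarrow> eqv n a b \<longleftrightarrow> eqv n a b'"
  using eqv_trans eqv_sym by blast

lemma swap_vars:
  assumes "Suc i < n"
  shows "length (swap_adj i (vars n)) = n" "\<And>L. L \<in> set (swap_adj i (vars n)) \<Longrightarrow> lin n L"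
    "sum_list (swap_adj i (vars n)) = (\<Sum>i<n. mvar i)"
  using assms by (auto simp: set_swap_adj mset_swap_adj sum_list_vars intro: lin_var)

text \<open>All operations in the defining conditions descend to cosets, so the representative
  chosen by \<open>rep\<close> can be replaced by the given one, condition by condition.\<close>

lemma toY_hom_cochains: "toY n y \<in> hom_cochains n e \<longleftrightarrow> rc n e y"
proof -
  have r: "eqv n (rep (toY n y as)) (y as)" if "length as = n" for as
    using that rep_qclass by (simp add: toY_def)
  have "multilinear n (toY n y) \<longleftrightarrow>
    (\<forall>as. length as = n \<longrightarrow> y as \<in> mpolys n) \<and>
    (\<forall>as i a b. length as = n \<and> i < n \<longrightarrow> eqv n (y (as[i := a + b])) (y (as[i := a]) + y (as[i := b]))) \<and>
    (\<forall>as i a c. length as = n \<and> i < n \<longrightarrow> eqv n (y (as[i := scale c a])) (sc c (y (as[i := a]))))"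
  proof -
    have "qclass n x \<in> qclass n ` mpolys n \<longleftrightarrow> x \<in> mpolys n" for x
      by (auto simp: image_iff qclass_eq intro: eqv_mpolys)
    moreover have "qclass n (y (as[i := scale c a])) = qclass n (sc c (rep (toY n y (as[i := a]))))
       \<longleftrightarrow> eqv n (y (as[i := scale c a])) (sc c (y (as[i := a])))"
      if "length as = n" for as i a c
      unfolding qclass_eq using that by (intro eqv_right eqv_sc r) simp
    ultimately show ?thesis unfolding multilinear_def by (auto simp: toY_def qclass_add qclass_eq)
  qed
  moreover have "has_parity n e (toY n y) \<longleftrightarrow> (\<forall>as ps. length as = n \<and> hom_list ps as \<longrightarrow>
       (\<exists>x. eqv n x (y as) \<and> homp (opp ((e + (\<Sum>i<n. opp (ps ! i))) mod 2)) x))"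
    unfolding has_parity_def homp_def by (auto simp: toY_def mem_qclass Bex_def)
  moreover have "sesquilinear n (toY n y) \<longleftrightarrow>
    (\<forall>as i. length as = n \<and> i < n \<longrightarrow> eqv n (y (as[i := D (as ! i)])) (- (mvar i * y as)))"
  proof -
    have "eqv n (y (as[i := D (as ! i)])) (- (mvar i * rep (toY n y as)))
       \<longleftrightarrow> eqv n (y (as[i := D (as ! i)])) (- (mvar i * y as))"
      if "length as = n" "i < n" for as i
      using that by (intro eqv_right eqv_minus eqv_mvar r) auto
    then show ?thesis unfolding sesquilinear_def by (simp add: toY_def qclass_eq)
  qed
  moreover have "supersymmetric n (toY n y) \<longleftrightarrow> (\<forall>as ps i. length as = n \<and> hom_list ps as \<and> Suc i < n \<longrightarrow>
       eqv n (msubst (swap_adj i (vars n)) (y (swap_adj i as))) (sg (opp (ps ! i) * opp (ps ! Suc i)) (y as)))"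
  proof -
    have "eqv n (msubst (swap_adj i (vars n)) (rep (toY n y (swap_adj i as)))) ((-1) ^ k * rep (toY n y as))
      \<longleftrightarrow> eqv n (msubst (swap_adj i (vars n)) (y (swap_adj i as))) (sg k (y as))"
      if "length as = n" "Suc i < n" for as i k
    proof -
      have "eqv n (msubst (swap_adj i (vars n)) (rep (toY n y (swap_adj i as))))
         (msubst (swap_adj i (vars n)) (y (swap_adj i as)))"
        using that by (intro eqv_msubst swap_vars r) (simp_all add: r)
      moreover have "eqv n ((-1) ^ k * rep (toY n y as)) (sg k (y as))"
        unfolding sg_eq using that by (intro eqv_sg r)
      ultimately show ?thesis by (meson eqv_trans eqv_sym)
    qed
    then show ?thesis unfolding supersymmetric_def qclass_eq by metis
  qed
  moreover have "leibniz n e (toY n y) \<longleftrightarrow>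
    (\<forall>as ps i b c p q. length as = n \<and> hom_list ps as \<and> i < n \<and> p \<le> 1 \<and> q \<le> 1 \<and> b \<in> gr p \<and> c \<in> gr q \<longrightarrow>
       eqv n (y (as[i := b * c]))
        (sg (p * (e + (\<Sum>k<i. opp (ps ! k)))) (exp_act i b (y (as[i := c])))
         + sg (q * (p + (e + (\<Sum>k<i. opp (ps ! k))))) (exp_act i c (y (as[i := b])))))"
  proof -
    have "toY n y (as[i := b * c]) = qclass n
        ((-1) ^ k * exp_act i b (rep (toY n y (as[i := c]))) + (-1) ^ l * exp_act i c (rep (toY n y (as[i := b]))))
      \<longleftrightarrow> eqv n (y (as[i := b * c]))
        (sg k (exp_act i b (y (as[i := c]))) + sg l (exp_act i c (y (as[i := b]))))"
      if "length as = n" "i < n" for as i k l b c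
      using that unfolding sg_eq
      by (simp add: toY_def qclass_eq) (intro eqv_right eqv_add eqv_sg eqv_exp rep_qclass, auto)
    then show ?thesis unfolding leibniz_def Let_def
      by (intro iff_allI imp_cong refl) (elim conjE, assumption | simp only:)+
  qed
  ultimately show ?thesis unfolding hom_cochains_def mem_Collect_eq rc_def
    by (simp only: conj_assoc)
qed

lemma hom_cochains_obtain:
  assumes "Y \<in> hom_cochains n e"
  obtains y where "rc n e y" "Y = toY n y"
proof -
  have m: "multilinear n Y" using assms by (simp add: hom_cochains_def)
  have "Y as = qclass n (rep (Y as))" if l: "length as = n" for as
  proof -
    obtain x where "Y as = qclass n x" using m l by (auto simp: multilinear_def)
    then show ?thesis using rep_qclass[of n x] by (simp add: qclass_eq eqv_sym)
  qed
  then have "Y = toY n (\<lambda>as. rep (Y as))" using m unfolding toY_def multilinear_def fun_eq_iff by metis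
  then show ?thesis using that assms toY_hom_cochains by metis
qed

lemma rc_zero:
  assumes "rc n e y" "length as = n" "0 \<in> set as" shows "eqv n (y as) 0"
proof -
  obtain i where i: "i < n" "as ! i = 0" using assms(2,3) by (auto simp: in_set_conv_nth)
  have "eqv n (y (as[i := 0 + 0])) (y (as[i := 0]) + y (as[i := 0]))"
    by (rule rc_add[OF assms(1,2) i(1)])
  moreover have "as[i := 0] = as" using i by (metis list_update_id)
  ultimately have "eqv n (y as) (y as + y as)" by simp
  then have "eqv n (y as - y as) (y as + y as - y as)" by (intro eqv_diff) auto
  then show ?thesis by (simp add: eqv_sym)
qed

end

lemma sum_opp_sum_list: "(\<Sum>i<length ps. opp (ps ! i)) = sum_list (map opp ps)"
  by (simp add: sum_list_sum_nth atLeast0LessThan)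

lemma opp_mod2: "p \<le> 1 \<Longrightarrow> even (opp p) = odd p" for p :: nat
  by (cases "p = 0") (auto simp: le_Suc_eq)

lemma finite_parity_lists: "finite {ps. length ps = n \<and> set ps \<subseteq> {0, 1 :: nat}}"
  using finite_lists_length_eq[of "{0, 1 :: nat}" n] by (simp add: conj_commute)

context poisson_vertex_superalgebra begin

section \<open>Parity lists\<close>

lemma hom_list_all2: "hom_list ps as \<longleftrightarrow> list_all2 (\<lambda>p a. p \<le> 1 \<and> a \<in> gr p) ps as"
  unfolding hom_list_def list_all2_conv_all_nth set_conv_nth by (auto simp: le_Suc_eq)

lemma hom_list_length: "hom_list ps as \<Longrightarrow> length ps = length as" by (simp add: hom_list_def)
lemma hom_list_nth: "hom_list ps as \<Longrightarrow> i < length as \<Longrightarrow> ps ! i \<le> 1 \<and> as ! i \<in> gr (ps ! i)"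
  by (auto simp: hom_list_all2 list_all2_conv_all_nth)
lemma hom_list_Cons [simp]: "hom_list (p # ps) (a # as) \<longleftrightarrow> p \<le> 1 \<and> a \<in> gr p \<and> hom_list ps as"
  by (auto simp: hom_list_all2)
lemma hom_list_omit: "hom_list ps as \<Longrightarrow> hom_list (omit i ps) (omit i as)"
  unfolding hom_list_all2 omit_def
  by (intro list_all2_appendI) (auto intro: list_all2_takeI list_all2_dropI)
lemma hom_list_update: "hom_list ps as \<Longrightarrow> p \<le> 1 \<Longrightarrow> a \<in> gr p \<Longrightarrow> hom_list (ps[i := p]) (as[i := a])"
  unfolding hom_list_all2 by (intro list_all2_update_cong) auto
lemma hom_list_swap: "hom_list ps as \<Longrightarrow> Suc i < length as \<Longrightarrow> hom_list (swap_adj i ps) (swap_adj i as)"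
  unfolding swap_adj_def by (intro hom_list_update) (use hom_list_nth[of ps as i] hom_list_nth[of ps as "Suc i"] in auto)
lemma hom_list_update_same:
  "hom_list ps as \<Longrightarrow> i < length as \<Longrightarrow> a \<in> gr (ps ! i) \<Longrightarrow> hom_list ps (as[i := a])"
  using hom_list_update[of ps as "ps ! i" a i] hom_list_nth[of ps as i] by simp
lemma hom_list_hpart:
  "length ps = length as \<Longrightarrow> set ps \<subseteq> {0, 1} \<Longrightarrow> hom_list ps (map2 hpart ps as)"
  unfolding hom_list_def by (auto simp: in_set_conv_nth intro!: hpart_in)
    (metis One_nat_def empty_iff insert_iff le_zero_eq less_or_eq_imp_le nth_mem subsetD zero_le_one)

section \<open>The differential on representatives\<close>

text \<open>
  \<open>t1\<close> and \<open>t2\<close> are the terms of the differential with one argument acting and with two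
  arguments bracketed; \<open>s1\<close> and \<open>s2\<close> are the exponents of their signs.
\<close>

definition t1 :: "nat \<Rightarrow> nat \<Rightarrow> 'v \<Rightarrow> 'v mpoly \<Rightarrow> 'v mpoly" where
  "t1 N i a x = bp a (mvar i) (msubst (omit i (vars N)) x)"

definition subs2 :: "nat \<Rightarrow> nat \<Rightarrow> nat \<Rightarrow> 'v mpoly list" where
  "subs2 N i j = (mvar i + mvar j) # omit i (omit j (vars N))"

text \<open>The extension of g from elements to polynomials in one variable, evaluated at L. In use,
  g is additive only modulo total derivatives, so additivity in f is also only a congruence
  (\<open>pl_add_arg\<close>).\<close>

definition pl :: "'v mpoly \<Rightarrow> 'v lpoly \<Rightarrow> ('v \<Rightarrow> 'v mpoly) \<Rightarrow> 'v mpoly" where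
  "pl L f g = (\<Sum>k\<in>ks f. L ^ k * g (lk f k))"

definition s1 :: "nat \<Rightarrow> nat list \<Rightarrow> nat \<Rightarrow> nat" where
  "s1 e ps i = opp (ps ! i) * (e + (\<Sum>k<i. opp (ps ! k)) + 1) + 1"

definition s2 :: "nat \<Rightarrow> nat list \<Rightarrow> nat \<Rightarrow> nat \<Rightarrow> nat" where
  "s2 e ps i j = e + opp (ps ! i) * ((\<Sum>k<i. opp (ps ! k)) + 1) + opp (ps ! j) * (\<Sum>k\<in>{..<j} - {i}. opp (ps ! k))"

definition t2 :: "('v list \<Rightarrow> 'v mpoly) \<Rightarrow> 'v list \<Rightarrow> nat \<Rightarrow> nat \<Rightarrow> 'v mpoly" where
  "t2 y as i j = pl (mvar i) (br (as ! i) (as ! j))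
     (\<lambda>c. msubst (subs2 (length as) i j) (y (c # omit i (omit j as))))"

definition dF :: "nat \<Rightarrow> ('v list \<Rightarrow> 'v mpoly) \<Rightarrow> nat list \<Rightarrow> 'v list \<Rightarrow> 'v mpoly" where
  "dF e y ps as =
     (\<Sum>i<length as. sg (s1 e ps i) (t1 (length as) i (as ! i) (y (omit i as))))
   + (\<Sum>j<length as. \<Sum>i<j. sg (s2 e ps i j) (t2 y as i j))"

lemma d_formula_dF: "d_formula e Y ps as = dF e (\<lambda>as. rep (Y as)) ps as"
  unfolding d_formula_def dF_def Let_def sg_eq s1_def s2_def t1_def t2_def pl_def subs2_def ..

lemma subs2_props:
  assumes "i < j" "j < Suc n"
  shows "length (subs2 (Suc n) i j) = n" "\<And>L. L \<in> set (subs2 (Suc n) i j) \<Longrightarrow> lin (Suc n) L"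
    "sum_list (subs2 (Suc n) i j) = (\<Sum>i<Suc n. mvar i)"
proof -
  let ?v = "vars (Suc n) :: 'v mpoly list"
  have l: "length (omit j ?v) = n" using assms by (subst length_omit) auto
  then show "length (subs2 (Suc n) i j) = n" using assms by (simp add: subs2_def length_omit)
  fix L assume "L \<in> set (subs2 (Suc n) i j)"
  then have "L = mvar i + mvar j \<or> L \<in> set (omit j ?v)"
    using set_omit[of i "omit j ?v"] by (auto simp: subs2_def simp del: upt_Suc)
  then show "lin (Suc n) L" using assms lin_omit_vars by (auto intro!: lin.intros simp del: upt_Suc)
next
  let ?v = "vars (Suc n) :: 'v mpoly list"
  have l: "length (omit j ?v) = n" using assms by (subst length_omit) auto
  have "omit j ?v ! i = mvar i" using assms by (subst nth_omit) (auto simp: skip_def simp del: upt_Suc)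
  then have "mvar i + sum_list (omit i (omit j ?v)) = sum_list (omit j ?v)"
    using sum_list_omit[of i "omit j ?v"] assms l by simp
  moreover have "mvar j + sum_list (omit j ?v) = (\<Sum>i<Suc n. mvar i)"
    using assms by (intro sum_list_omit_vars) auto
  ultimately show "sum_list (subs2 (Suc n) i j) = (\<Sum>i<Suc n. mvar i)"
    unfolding subs2_def by (simp only: sum_list.Cons) (metis add.assoc add.commute)
qed

lemma omit_vars_props:
  assumes "k < Suc n"
  shows "length (omit k (vars (Suc n) :: 'v mpoly list)) = n" "\<And>L :: 'v mpoly. L \<in> set (omit k (vars (Suc n))) \<Longrightarrow> lin (Suc n) L"
    "mvar k + sum_list (omit k (vars (Suc n) :: 'v mpoly list)) = (\<Sum>i<Suc n. mvar i)"
  using assms lin_omit_vars sum_list_omit_vars by (auto simp: length_omit simp del: upt_Suc sum.lessThan_Suc)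

lemma eqv_t1: "eqv n x x' \<Longrightarrow> i < Suc n \<Longrightarrow> eqv (Suc n) (t1 (Suc n) i a x) (t1 (Suc n) i a x')"
  unfolding t1_def by (erule eqv_bp) (auto simp: omit_vars_props intro: lin_var simp del: upt_Suc sum.lessThan_Suc)

lemma lin_power: "lin n L \<Longrightarrow> eqv n x y \<Longrightarrow> eqv n (L ^ k * x) (L ^ k * y)"
  by (induction k) (auto simp: mult.assoc intro: eqv_lin)

lemma eqv_pl: "(\<And>c. eqv m (g c) (g' c)) \<Longrightarrow> lin m L \<Longrightarrow> eqv m (pl L f g) (pl L f g')"
  unfolding pl_def by (intro eqv_sum lin_power)

lemma eqv_t2:
  assumes "\<And>bs. length bs = n \<Longrightarrow> eqv n (y bs) (y' bs)" "length as = Suc n" "i < j" "j < Suc n"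
  shows "eqv (Suc n) (t2 y as i j) (t2 y' as i j)"
  unfolding t2_def assms(2)
  using assms by (intro eqv_pl lin_var eqv_msubst[OF _ subs2_props[OF assms(3,4)]] assms(1)) (auto simp: length_omit)

lemma dF_cong:
  assumes "\<And>bs. length bs = n \<Longrightarrow> eqv n (y bs) (y' bs)" "length as = Suc n"
  shows "eqv (Suc n) (dF e y ps as) (dF e y' ps as)"
  unfolding dF_def assms(2)
  by (intro eqv_add eqv_sum eqv_sg eqv_t1 eqv_t2 assms) (auto simp: length_omit assms)

lemma dF_zero:
  assumes y: "rc n e' y" and l: "length as = Suc n" and k: "k < Suc n" "as ! k = 0"
  shows "eqv (Suc n) (dF e y ps as) 0"
proof -
  have a: "eqv (Suc n) (t1 (Suc n) i (as ! i) (y (omit i as))) 0" if i: "i < Suc n" for i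
  proof (cases "i = k")
    case True then show ?thesis by (simp add: k t1_def)
  next
    case False
    then have "0 \<in> set (omit i as)" using nth_in_set_omit[of k as i] k l i by simp
    then have "eqv n (y (omit i as)) 0" using l i by (intro rc_zero[OF y]) (auto simp: length_omit)
    from eqv_t1[OF this i] show ?thesis
      by (simp add: t1_def additive.zero[OF additive_msubst] additive.zero[OF additive_bp])
  qed
  have b: "eqv (Suc n) (t2 y as i j) 0" if i: "i < j" "j < Suc n" for i j
  proof (cases "i = k \<or> j = k")
    case True then show ?thesis by (auto simp: k t2_def pl_def)
  next
    case False
    have lo: "length (omit j as) = n" using l i by (simp add: length_omit)
    have "(omit j as) ! (if k < j then k else k - 1) = 0"
      using False l i k by (subst nth_omit) (auto simp: skip_def)
    then have "0 \<in> set (omit i (omit j as))"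
      using nth_in_set_omit[of "if k < j then k else k - 1" "omit j as" i] False i k lo by (cases "k < j") auto
    then have "eqv n (y (c # omit i (omit j as))) 0" for c
      using lo i by (intro rc_zero[OF y]) (auto simp: length_omit)
    then have "eqv (Suc n) (msubst (subs2 (Suc n) i j) (y (c # omit i (omit j as)))) (msubst (subs2 (Suc n) i j) 0)" for c
      using i by (intro eqv_msubst[OF _ subs2_props[OF i]])
    then have "eqv (Suc n) (t2 y as i j) (pl (mvar i) (br (as ! i) (as ! j)) (\<lambda>c. 0))"
      unfolding t2_def l using i by (intro eqv_pl lin_var) (auto simp: additive.zero[OF additive_msubst])
    then show ?thesis by (simp add: pl_def)
  qed
  have "eqv (Suc n) (dF e y ps as) ((\<Sum>i<Suc n. sg (s1 e ps i) 0) + (\<Sum>j<Suc n. \<Sum>i<j. sg (s2 e ps i j) 0))"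
    unfolding dF_def l by (intro eqv_add eqv_sum eqv_sg a b) auto
  then show ?thesis by simp
qed

text \<open>The differential sums over all parity lists. A list other than the actual one projects
  some argument to 0, and then \<open>dF_zero\<close> applies.\<close>

lemma d_hom_hom:
  assumes y: "rc n e' y" and l: "length as = Suc n" and h: "hom_list ps as"
  shows "d_hom n e (toY n y) as = qclass (Suc n) (dF e y ps as)"
proof -
  let ?P = "{ps :: nat list. length ps = Suc n \<and> set ps \<subseteq> {0, 1}}"
  have ps: "ps \<in> ?P" using h l by (auto simp: hom_list_def)
  have "eqv (Suc n) (\<Sum>qs\<in>?P. d_formula e (toY n y) qs (map2 hpart qs as))
      (\<Sum>qs\<in>?P. if qs = ps then dF e y ps as else 0)"
  proof (rule eqv_sum)
    fix qs assume qs: "qs \<in> ?P"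
    have l': "length (map2 hpart qs as) = Suc n" using qs l by simp
    have "eqv (Suc n) (d_formula e (toY n y) qs (map2 hpart qs as)) (dF e y qs (map2 hpart qs as))"
      unfolding d_formula_dF by (rule dF_cong[OF _ l']) (simp add: toY_def rep_qclass)
    also have "eqv (Suc n) \<dots> (if qs = ps then dF e y ps as else 0)"
    proof (cases "qs = ps")
      case True
      have "map2 hpart ps as = as"
        using h l by (intro nth_equalityI) (auto simp: hom_list_length dest: hom_list_nth)
      then show ?thesis using True by simp
    next
      case False
      then obtain k where k: "k < Suc n" "qs ! k \<noteq> ps ! k"
        using qs ps nth_equalityI[of qs ps] by auto
      have "qs ! k \<in> set qs" using qs k by simp
      then have "qs ! k \<in> {0, 1}" using qs by blast
      then have "qs ! k \<le> 1" by auto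
      then have "map2 hpart qs as ! k = 0"
        using hom_list_nth[OF h, of k] k qs l by (auto intro: hpart_other)
      then show ?thesis using False dF_zero[OF y l' k(1)] by simp
    qed
    finally show "eqv (Suc n) (d_formula e (toY n y) qs (map2 hpart qs as)) (if qs = ps then dF e y ps as else 0)" .
  qed
  moreover have "(\<Sum>qs\<in>?P. if qs = ps then dF e y ps as else 0) = dF e y ps as"
    using ps by (subst sum.delta[OF finite_parity_lists]) simp
  ultimately show ?thesis using l by (simp add: d_hom_def qclass_eq)
qed

text \<open>Multilinear expansion of every argument into its even and odd part, peeling off the
  first argument. It reduces statements about cochains to homogeneous arguments.\<close>

lemma slot_expand:
  fixes z :: "'v list \<Rightarrow> 'v mpoly"
  assumes "\<And>as i a b. length as = N \<Longrightarrow> i < N \<Longrightarrow> eqv m (z (as[i := a + b])) (z (as[i := a]) + z (as[i := b]))"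
    "length as = N"
  shows "eqv m (z as) (\<Sum>ps | length ps = N \<and> set ps \<subseteq> {0, 1}. z (map2 hpart ps as))"
  using assms
proof (induction N arbitrary: z as)
  case 0
  have "{ps :: nat list. length ps = 0 \<and> set ps \<subseteq> {0, 1}} = {[]}" by auto
  then show ?case using 0 by simp
next
  case (Suc N)
  obtain x xs where as: "as = x # xs" "length xs = N" using Suc.prems(2) by (auto simp: length_Suc_conv)
  let ?P = "\<lambda>N. {ps :: nat list. length ps = N \<and> set ps \<subseteq> {0, 1}}"
  have e: "eqv m (z (c # xs)) (\<Sum>ps\<in>?P N. z (c # map2 hpart ps xs))" for c
  proof (rule Suc.IH[of "\<lambda>xs. z (c # xs)"])
    fix bs :: "'v list" and i a b assume "length bs = N" "i < N"
    then show "eqv m (z (c # bs[i := a + b])) (z (c # bs[i := a]) + z (c # bs[i := b]))"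
      using Suc.prems(1)[of "c # bs" "Suc i"] by simp
  qed (use as in simp)
  have "eqv m (z ((x # xs)[0 := hpart 0 x + hpart 1 x])) (z ((x # xs)[0 := hpart 0 x]) + z ((x # xs)[0 := hpart 1 x]))"
    using as by (intro Suc.prems(1)) auto
  then have "eqv m (z as) (z (hpart 0 x # xs) + z (hpart 1 x # xs))"
    using as hpart_sum[of x] by simp
  also have "eqv m \<dots> ((\<Sum>ps\<in>?P N. z (hpart 0 x # map2 hpart ps xs)) + (\<Sum>ps\<in>?P N. z (hpart 1 x # map2 hpart ps xs)))"
    by (intro eqv_add e)
  also have "\<dots> = (\<Sum>p\<in>{0,1}. \<Sum>ps\<in>?P N. z (hpart p x # map2 hpart ps xs))" by simp
  also have "\<dots> = (\<Sum>(p, ps)\<in>{0,1} \<times> ?P N. z (map2 hpart (p # ps) as))"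
    by (simp add: sum.cartesian_product as)
  also have "\<dots> = (\<Sum>ps\<in>?P (Suc N). z (map2 hpart ps as))"
  proof (rule sum.reindex_bij_witness[of _ "\<lambda>ps. (hd ps, tl ps)" "\<lambda>(p, ps). p # ps"])
    fix a assume "a \<in> {ps :: nat list. length ps = Suc N \<and> set ps \<subseteq> {0, 1}}"
    then show "(case (hd a, tl a) of (p, ps) \<Rightarrow> p # ps) = a" "(hd a, tl a) \<in> {0, 1} \<times> ?P N"
      by (cases a; auto)+
  qed auto
  finally show ?case .
qed

lemma rc_expand:
  assumes "rc n e y" "length as = n"
  shows "eqv n (y as) (\<Sum>ps | length ps = n \<and> set ps \<subseteq> {0, 1}. y (map2 hpart ps as))"
  using rc_add[OF assms(1)] assms(2) by (intro slot_expand)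

lemma rc_eqI:
  assumes "rc n e y" "rc n e' z" "length as = n"
    "\<And>ps as. length as = n \<Longrightarrow> hom_list ps as \<Longrightarrow> eqv n (y as) (z as)"
  shows "eqv n (y as) (z as)"
proof -
  have "eqv n (y as) (\<Sum>ps | length ps = n \<and> set ps \<subseteq> {0, 1}. y (map2 hpart ps as))"
    using assms by (intro rc_expand)
  also have "eqv n \<dots> (\<Sum>ps | length ps = n \<and> set ps \<subseteq> {0, 1}. z (map2 hpart ps as))"
  proof (rule eqv_sum)
    fix ps :: "nat list" assume "ps \<in> {ps. length ps = n \<and> set ps \<subseteq> {0, 1}}"
    then show "eqv n (y (map2 hpart ps as)) (z (map2 hpart ps as))"
      using assms(3) by (intro assms(4)[of _ ps] hom_list_hpart) auto
  qed
  also have "eqv n \<dots> (z as)" using assms by (intro eqv_sym[OF rc_expand])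
  finally show ?thesis .
qed

lemma d_hom_eqI:
  assumes y: "rc n e' y" and z: "rc (Suc n) e'' z"
    and eq: "\<And>ps as. length as = Suc n \<Longrightarrow> hom_list ps as \<Longrightarrow> eqv (Suc n) (dF e y ps as) (z as)"
  shows "d_hom n e (toY n y) = toY (Suc n) z"
proof
  fix as
  show "d_hom n e (toY n y) as = toY (Suc n) z as"
  proof (cases "length as = Suc n")
    case l: True
    let ?P = "{ps :: nat list. length ps = Suc n \<and> set ps \<subseteq> {0, 1}}"
    have "eqv (Suc n) (\<Sum>qs\<in>?P. d_formula e (toY n y) qs (map2 hpart qs as))
      (\<Sum>qs\<in>?P. z (map2 hpart qs as))"
    proof (rule eqv_sum)
      fix qs assume qs: "qs \<in> ?P"
      have l': "length (map2 hpart qs as) = Suc n" using qs l by simp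
      have "eqv (Suc n) (d_formula e (toY n y) qs (map2 hpart qs as)) (dF e y qs (map2 hpart qs as))"
        unfolding d_formula_dF by (rule dF_cong[OF _ l']) (simp add: toY_def rep_qclass)
      also have "eqv (Suc n) \<dots> (z (map2 hpart qs as))"
        using qs l by (intro eq l' hom_list_hpart) auto
      finally show "eqv (Suc n) (d_formula e (toY n y) qs (map2 hpart qs as)) (z (map2 hpart qs as))" .
    qed
    also have "eqv (Suc n) \<dots> (z as)" using l by (intro eqv_sym[OF rc_expand[OF z]])
    finally show ?thesis using l by (simp add: d_hom_def toY_def qclass_eq)
  qed (simp add: d_hom_def toY_def)
qed

section \<open>Linear structure\<close>

lemma sc_0 [simp]: "sc c 0 = 0" by (rule additive.zero[OF additive_sc])
lemma exp_act_0 [simp]: "exp_act i b 0 = 0" by (rule additive.zero[OF additive_exp_act])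
lemma msubst_0 [simp]: "msubst Ls 0 = 0" by (rule additive.zero[OF additive_msubst])
lemma homp_0: "p \<le> 1 \<Longrightarrow> homp p 0" by (simp add: homp_def)

lemma rc_0: "rc n e (\<lambda>_. 0)"
  by (rule rcI) (auto intro!: exI[of _ 0] homp_0)

lemma rc_plus:
  assumes "rc n e y" "rc n e z" shows "rc n e (\<lambda>as. y as + z as)"
proof (rule rcI)
  fix as :: "'v list" and i :: nat and a b :: 'v and c :: 'f and ps assume l: "length as = n"
  show "y as + z as \<in> mpolys n" using assms l by (auto intro: rc_mpolys)
  {
    assume i: "i < n"
    have "eqv n (y (as[i := a + b]) + z (as[i := a + b]))
        ((y (as[i := a]) + y (as[i := b])) + (z (as[i := a]) + z (as[i := b])))"
      using assms l i by (intro eqv_add rc_add)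
    then show "eqv n (y (as[i := a + b]) + z (as[i := a + b]))
        ((y (as[i := a]) + z (as[i := a])) + (y (as[i := b]) + z (as[i := b])))"
      by (simp add: algebra_simps)
    show "eqv n (y (as[i := scale c a]) + z (as[i := scale c a])) (sc c (y (as[i := a]) + z (as[i := a])))"
      unfolding sc_add using assms l i by (intro eqv_add rc_scale)
    have "eqv n (y (as[i := D (as ! i)]) + z (as[i := D (as ! i)])) (- (mvar i * y as) + - (mvar i * z as))"
      using assms l i by (intro eqv_add rc_sesq)
    then show "eqv n (y (as[i := D (as ! i)]) + z (as[i := D (as ! i)])) (- (mvar i * (y as + z as)))"
      by (simp add: algebra_simps)
  }
  assume h: "hom_list ps as"
  obtain u v where uv: "eqv n u (y as)" "homp (opp ((e + (\<Sum>i<n. opp (ps ! i))) mod 2)) u"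
    "eqv n v (z as)" "homp (opp ((e + (\<Sum>i<n. opp (ps ! i))) mod 2)) v"
    using rc_parity[OF assms(1) l h] rc_parity[OF assms(2) l h] by blast
  then show "\<exists>x. eqv n x (y as + z as) \<and> homp (opp ((e + (\<Sum>i<n. opp (ps ! i))) mod 2)) x"
    by (intro exI[of _ "u + v"] conjI eqv_add homp_add) auto
  {
    assume i: "Suc i < n"
    show "eqv n (msubst (swap_adj i (vars n)) (y (swap_adj i as) + z (swap_adj i as)))
        (sg (opp (ps ! i) * opp (ps ! Suc i)) (y as + z as))"
      unfolding msubst_add sg_add using assms l h i by (intro eqv_add rc_sym)
  }
  fix p q :: nat and b c :: 'v
  assume a: "i < n" "p \<le> 1" "q \<le> 1" "b \<in> gr p" "c \<in> gr q"
  let ?s = "p * (e + (\<Sum>k<i. opp (ps ! k)))" let ?t = "q * (p + (e + (\<Sum>k<i. opp (ps ! k))))"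
  have "eqv n (y (as[i := b * c]) + z (as[i := b * c]))
     ((sg ?s (exp_act i b (y (as[i := c]))) + sg ?t (exp_act i c (y (as[i := b])))) +
      (sg ?s (exp_act i b (z (as[i := c]))) + sg ?t (exp_act i c (z (as[i := b])))))"
    using assms l h a by (intro eqv_add rc_leibniz)
  then show "eqv n (y (as[i := b * c]) + z (as[i := b * c]))
     (sg ?s (exp_act i b (y (as[i := c]) + z (as[i := c]))) + sg ?t (exp_act i c (y (as[i := b]) + z (as[i := b]))))"
    by (simp add: exp_act_add sg_add algebra_simps)
qed

lemma homp_sc: "p \<le> 1 \<Longrightarrow> homp p x \<Longrightarrow> homp p (sc c x)"
  by (simp add: homp_def lookup_pmap gr_scale)

lemma msubst_sc: "x \<in> mpolys (length Ls) \<Longrightarrow> (\<And>L. L \<in> set Ls \<Longrightarrow> lin n L) \<Longrightarrow> msubst Ls (sc c x) = sc c (msubst Ls x)"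
  by (rule pmap_msubst[OF additive_scale, symmetric])

lemma sc_commute: "sc c (sc d x) = sc d (sc c x)" for x :: "'k \<Rightarrow>\<^sub>0 'v"
  by (simp add: sc_sc mult.commute)

lemma rc_smult:
  assumes "rc n e y" shows "rc n e (\<lambda>as. sc t (y as))"
proof (rule rcI)
  fix as :: "'v list" and i :: nat and a b :: 'v and c :: 'f and ps assume l: "length as = n"
  show "sc t (y as) \<in> mpolys n" using assms l by (auto intro: rc_mpolys)
  {
    assume i: "i < n"
    show "eqv n (sc t (y (as[i := a + b]))) (sc t (y (as[i := a])) + sc t (y (as[i := b])))"
      unfolding sc_add[symmetric] using assms l i by (intro eqv_sc rc_add)
    show "eqv n (sc t (y (as[i := scale c a]))) (sc c (sc t (y (as[i := a]))))"
      unfolding sc_commute[of c t] using assms l i by (intro eqv_sc rc_scale)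
    have "eqv n (sc t (y (as[i := D (as ! i)]))) (sc t (- (mvar i * y as)))"
      using assms l i by (intro eqv_sc rc_sesq)
    then show "eqv n (sc t (y (as[i := D (as ! i)]))) (- (mvar i * sc t (y as)))"
      by (simp add: additive.minus[OF additive_sc] sc_mvar)
  }
  assume h: "hom_list ps as"
  obtain u where u: "eqv n u (y as)" "homp (opp ((e + (\<Sum>i<n. opp (ps ! i))) mod 2)) u"
    using rc_parity[OF assms l h] by blast
  then show "\<exists>x. eqv n x (sc t (y as)) \<and> homp (opp ((e + (\<Sum>i<n. opp (ps ! i))) mod 2)) x"
    by (intro exI[of _ "sc t u"] conjI eqv_sc homp_sc) auto
  {
    assume i: "Suc i < n"
    have "y (swap_adj i as) \<in> mpolys n" using assms l by (intro rc_mpolys) auto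
    then have "msubst (swap_adj i (vars n)) (sc t (y (swap_adj i as))) = sc t (msubst (swap_adj i (vars n)) (y (swap_adj i as)))"
      using swap_vars[OF i] by (intro msubst_sc) auto
    then show "eqv n (msubst (swap_adj i (vars n)) (sc t (y (swap_adj i as))))
        (sg (opp (ps ! i) * opp (ps ! Suc i)) (sc t (y as)))"
      unfolding sg_additive[OF additive_sc, symmetric]
      using eqv_sc[OF rc_sym[OF assms l h i]] by simp
  }
  fix p q :: nat and b c :: 'v
  assume a: "i < n" "p \<le> 1" "q \<le> 1" "b \<in> gr p" "c \<in> gr q"
  let ?s = "p * (e + (\<Sum>k<i. opp (ps ! k)))" let ?t = "q * (p + (e + (\<Sum>k<i. opp (ps ! k))))"
  show "eqv n (sc t (y (as[i := b * c])))
     (sg ?s (exp_act i b (sc t (y (as[i := c])))) + sg ?t (exp_act i c (sc t (y (as[i := b])))))"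
    using eqv_sc[OF rc_leibniz[OF assms l h a], of t]
    by (simp add: sc_add sg_additive[OF additive_sc] exp_act_sc)
qed

lemma sc_minus1: "sc (- 1) x = - x" for x :: "'k \<Rightarrow>\<^sub>0 'v"
  by (rule poly_mapping_eqI) (simp add: lookup_pmap)

lemma rc_uminus: "rc n e y \<Longrightarrow> rc n e (\<lambda>as. - y as)"
  using rc_smult[of n e y "- 1"] by (simp add: sc_minus1)

lemma rc_diff: "rc n e y \<Longrightarrow> rc n e z \<Longrightarrow> rc n e (\<lambda>as. y as - z as)"
  using rc_plus[OF _ rc_uminus, of n e y z] by simp

lemma t1_add: "t1 N i a (x + y) = t1 N i a x + t1 N i a y" by (simp add: t1_def msubst_add bp_add)
lemma additive_t1: "additive (t1 N i a)" by standard (rule t1_add)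
lemma pl_plus: "pl L f (\<lambda>c. g c + h c) = pl L f g + pl L f h"
  by (simp add: pl_def distrib_left sum.distrib)
lemma t2_plus: "t2 (\<lambda>as. y as + z as) as i j = t2 y as i j + t2 z as i j"
  by (simp add: t2_def msubst_add pl_plus)

lemma dF_plus: "dF e (\<lambda>as. y as + z as) ps as = dF e y ps as + dF e z ps as"
  by (simp add: dF_def t1_add t2_plus sg_add sum.distrib algebra_simps)

lemma dF_smult:
  assumes "\<And>bs. length bs = n \<Longrightarrow> y bs \<in> mpolys n" "length as = Suc n"
  shows "dF e (\<lambda>as. sc t (y as)) ps as = sc t (dF e y ps as)"
proof -
  have "t1 (Suc n) i a (sc t (y (omit i as))) = sc t (t1 (Suc n) i a (y (omit i as)))" if i: "i < Suc n" for i a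
  proof -
    have "y (omit i as) \<in> mpolys n" using i assms by (auto simp: length_omit)
    then show ?thesis unfolding t1_def using omit_vars_props[OF i]
      by (subst msubst_sc[where n="Suc n"]) (auto simp: bp_sc[OF lin_var[OF i]] simp del: upt_Suc)
  qed
  moreover have "t2 (\<lambda>as. sc t (y as)) as i j = sc t (t2 y as i j)" if ij: "i < j" "j < Suc n" for i j
  proof -
    have "y (c # omit i (omit j as)) \<in> mpolys n" for c using ij assms by (auto simp: length_omit)
    then have "msubst (subs2 (Suc n) i j) (sc t (y (c # omit i (omit j as)))) =
        sc t (msubst (subs2 (Suc n) i j) (y (c # omit i (omit j as))))" for c
      using subs2_props[OF ij] by (intro msubst_sc) auto
    moreover have "mvar i ^ k * sc t x = sc t (mvar i ^ k * x)" for k x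
      by (induction k) (auto simp: mult.assoc sc_mvar)
    ultimately show ?thesis
      unfolding t2_def pl_def assms(2) by (simp add: additive.sum[OF additive_sc])
  qed
  ultimately show ?thesis unfolding dF_def assms(2)
    by (simp add: sc_add additive.sum[OF additive_sc] sg_additive[OF additive_sc, symmetric] del: sum.lessThan_Suc)
qed

end

lemma omit_swap_adj: "Suc k < length xs \<Longrightarrow> omit k (swap_adj k xs) = omit (Suc k) xs"
proof (induction k arbitrary: xs)
  case 0
  then obtain a b ys where "xs = a # b # ys" by (cases xs; cases "tl xs") auto
  then show ?case by simp
next
  case (Suc k) then show ?case by (cases xs) auto
qed

lemma nth_swap_adj:
  "Suc k < length xs \<Longrightarrow> i < length xs \<Longrightarrow>
   swap_adj k xs ! i = (if i = k then xs ! Suc k else if i = Suc k then xs ! k else xs ! i)"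
  by (auto simp: swap_adj_def nth_list_update)

text \<open>Parity count for a term of dY in which an argument of parity p acts; s is the sum of the
  opposite parities of the other arguments. The next lemma is the count for a term in which
  arguments of parities p and q are bracketed.\<close>

lemma parity_arith1:
  "p \<le> 1 \<Longrightarrow> (p + opp ((e + s) mod 2)) mod 2 = opp ((e + 1 + (opp p + s)) mod 2)" for p e s :: nat
  by (cases "p = 0") (auto simp: le_Suc_eq mod2_eq_if)

lemma parity_arith2:
  "p \<le> 1 \<Longrightarrow> q \<le> 1 \<Longrightarrow> opp ((e + (opp ((p + q) mod 2) + s)) mod 2) = opp ((e + 1 + (opp q + (opp p + s))) mod 2)"
  for p q e s :: nat
  by (cases "p = 0"; cases "q = 0") (auto simp: le_Suc_eq mod2_eq_if)

context poisson_vertex_superalgebra begin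

section \<open>Parity of the differential\<close>

lemma hpart_add: assumes "p \<le> 1" shows "hpart p (a + b) = hpart p a + hpart p b"
proof (rule hpart_eq[OF assms])
  show "hpart p a + hpart p b \<in> gr p" using assms by (intro gr_add hpart_in)
  have "(a - hpart p a) + (b - hpart p b) \<in> gr (1 - p)" using assms by (intro gr_add hpart_rest) auto
  then show "a + b - (hpart p a + hpart p b) \<in> gr (1 - p)" by (simp add: algebra_simps)
qed

lemma additive_hpart: "p \<le> 1 \<Longrightarrow> additive (hpart p)" by standard (rule hpart_add)

lemma hpart_D: assumes "p \<le> 1" shows "hpart p (D v) = D (hpart p v)"
proof (rule hpart_eq[OF assms])
  show "D (hpart p v) \<in> gr p" using assms by (intro D_even hpart_in)
  have "D (v - hpart p v) \<in> gr (1 - p)" using assms by (intro D_even hpart_rest) auto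
  then show "D v - D (hpart p v) \<in> gr (1 - p)" by (simp add: additive.diff[OF additive_D])
qed

text \<open>With homogeneity expressed as being fixed by a projection, that an operator is
  homogeneous becomes a commutation rule, which can be proved by induction on polynomials.\<close>

lemma homp_iff: assumes "p \<le> 1" shows "homp p x \<longleftrightarrow> pmap (hpart p) x = x"
proof -
  have z: "hpart p 0 = 0" by (rule additive.zero[OF additive_hpart[OF assms]])
  show ?thesis
  proof
    assume "homp p x" then show "pmap (hpart p) x = x"
      using assms by (intro poly_mapping_eqI) (simp add: lookup_pmap z homp_def)
  next
    assume "pmap (hpart p) x = x"
    then have "lk x m = hpart p (lk x m)" for m using lookup_pmap[of "hpart p" x m] z by simp
    then show "homp p x" unfolding homp_def using hpart_in[OF assms] by metis
  qed
qed

lemma homp_other: assumes "p \<le> 1" "q \<le> 1" "p \<noteq> q" "homp q x" shows "pmap (hpart p) x = 0"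
  using assms additive.zero[OF additive_hpart[OF assms(1)]]
  by (intro poly_mapping_eqI) (simp add: lookup_pmap homp_def hpart_other[of p q])

text \<open>The projection to a parity commutes with D, hence respects the congruence; it fixes x
  and kills x'.\<close>

lemma eqv_parity_zero:
  assumes "p \<le> 1" "q \<le> 1" "p \<noteq> q" "eqv n x x'" "homp p x" "homp q x'" shows "eqv n x 0"
proof -
  have "eqv n (pmap (hpart p) x) (pmap (hpart p) x')"
    using assms by (intro eqv_pmap additive_hpart) (auto simp: hpart_D)
  then show ?thesis using assms homp_other[of p q x'] homp_iff[of p x] by simp
qed

lemma br_hpart:
  assumes "p \<le> 1" "q \<le> 1" "a \<in> gr p"
  shows "pmap (hpart ((p + q) mod 2)) (br a v) = br a (hpart q v)"
proof -
  let ?r = "(p + q) mod 2"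
  have v: "v = hpart q v + hpart (1 - q) v"
    using hpart_sum[of v] assms(2) by (cases "q = 0") (auto simp: le_Suc_eq add.commute)
  have r: "?r \<le> 1" by simp
  have "homp ?r (br a (hpart q v))" using assms by (intro br_homp hpart_in) auto
  then have 1: "pmap (hpart ?r) (br a (hpart q v)) = br a (hpart q v)" using homp_iff[OF r] by blast
  have "homp ((p + (1 - q)) mod 2) (br a (hpart (1 - q) v))" using assms by (intro br_homp hpart_in) auto
  moreover have "?r \<noteq> (p + (1 - q)) mod 2" using assms(1,2)
    by (cases "p = 0"; cases "q = 0") (auto simp: le_Suc_eq)
  ultimately have 2: "pmap (hpart ?r) (br a (hpart (1 - q) v)) = 0"
    by (intro homp_other[of _ "(p + (1 - q)) mod 2"]) auto
  have "pmap (hpart ?r) (br a v) = pmap (hpart ?r) (br a (hpart q v)) + pmap (hpart ?r) (br a (hpart (1 - q) v))"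
    by (subst v) (simp only: br_add_right additive.add[OF additive_pmap[OF additive_hpart[OF r]]])
  then show ?thesis using 1 2 by simp
qed

lemma bp_homp:
  assumes "p \<le> 1" "q \<le> 1" "a \<in> gr p" "lin n L" "homp q x"
  shows "homp ((p + q) mod 2) (bp a L x)"
proof -
  let ?r = "(p + q) mod 2"
  have r: "?r \<le> 1" by simp
  have ad: "additive (hpart ?r)" "additive (hpart q)" using assms by (auto intro: additive_hpart)
  have "pmap (hpart ?r) (bp a L x) = bp a L (pmap (hpart q) x)"
  proof (induction x rule: mpoly_induct)
    case (const v)
    then show ?case using assms ad
      by (simp add: bp_mconst pmap_mconst additive.zero lev_pmap[OF ad(1) assms(4), symmetric] br_hpart)
  next
    case (var i x) then show ?case by (simp add: bp_mvar pmap_mvar[OF ad(1)] pmap_mvar[OF ad(2)])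
  next
    case (add x y) then show ?case by (simp add: bp_add additive.add[OF additive_pmap[OF ad(1)]] additive.add[OF additive_pmap[OF ad(2)]])
  qed
  then show ?thesis using homp_iff[of q x] homp_iff[OF r, of "bp a L x"] assms by simp
qed

lemma homp_msubst:
  assumes "p \<le> 1" "homp p x" "x \<in> mpolys (length Ls)" "\<And>L. L \<in> set Ls \<Longrightarrow> lin n L"
  shows "homp p (msubst Ls x)"
  using assms pmap_msubst[OF additive_hpart[OF assms(1)] assms(3,4)] homp_iff[OF assms(1)] by metis

lemma homp_lin_power: "p \<le> 1 \<Longrightarrow> lin n L \<Longrightarrow> homp p x \<Longrightarrow> homp p (L ^ k * x)"
  using lin_power_left[of n L "pmap (hpart p)" k x] additive_pmap[OF additive_hpart]
    pmap_mvar[OF additive_hpart] homp_iff by metis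

definition hasp :: "nat \<Rightarrow> nat \<Rightarrow> 'v mpoly \<Rightarrow> bool" where
  "hasp n p x \<longleftrightarrow> (\<exists>x'. eqv n x' x \<and> homp p x')"

lemma hasp_add: "p \<le> 1 \<Longrightarrow> hasp n p x \<Longrightarrow> hasp n p y \<Longrightarrow> hasp n p (x + y)"
  unfolding hasp_def by (meson eqv_add homp_add)
lemma hasp_0: "p \<le> 1 \<Longrightarrow> hasp n p 0" unfolding hasp_def using homp_0 by blast
lemma hasp_sum: "p \<le> 1 \<Longrightarrow> (\<And>i. i \<in> A \<Longrightarrow> hasp n p (f i)) \<Longrightarrow> hasp n p (sum f A)"
  by (induction A rule: infinite_finite_induct) (auto intro: hasp_0 hasp_add)
lemma hasp_sg: "p \<le> 1 \<Longrightarrow> hasp n p x \<Longrightarrow> hasp n p (sg k x)"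
  unfolding hasp_def by (meson eqv_sg homp_sg)

lemma hasp_zero: "p \<le> 1 \<Longrightarrow> q \<le> 1 \<Longrightarrow> p \<noteq> q \<Longrightarrow> hasp n p x \<Longrightarrow> hasp n q y \<Longrightarrow> eqv n x y \<Longrightarrow> eqv n x 0"
  unfolding hasp_def by (meson eqv_parity_zero eqv_trans eqv_sym)

lemma sum_opp_omit:
  assumes "i < length ps"
  shows "(\<Sum>k<length ps. opp (ps ! k)) = opp (ps ! i) + (\<Sum>k<length ps - 1. opp (omit i ps ! k))"
proof -
  have "sum_list (map opp ps) = opp (ps ! i) + sum_list (map opp (omit i ps))"
    using sum_list_omit[of i "map opp ps"] assms by (simp add: omit_map)
  then show ?thesis using sum_opp_sum_list[of ps] sum_opp_sum_list[of "omit i ps"] length_omit[OF assms] by simp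
qed

text \<open>The differential is odd. Both kinds of terms have the parity belonging to e + 1, which
  is checked term by term on homogeneous representatives.\<close>

lemma dF_hasp:
  assumes y: "rc n e y" and l: "length as = Suc n" and h: "hom_list ps as"
  shows "hasp (Suc n) (opp ((e + 1 + (\<Sum>k<Suc n. opp (ps ! k))) mod 2)) (dF e y ps as)"
  unfolding dF_def l
proof (intro hasp_add hasp_sum hasp_sg)
  let ?t = "opp ((e + 1 + (\<Sum>k<Suc n. opp (ps ! k))) mod 2)"
  have lp: "length ps = Suc n" using h l by (simp add: hom_list_length)
  fix i assume "i \<in> {..<Suc n}"
  then have i: "i < Suc n" by simp
  let ?S = "\<Sum>k<n. opp (omit i ps ! k)"
  have lo: "length (omit i as) = n" using l i by (simp add: length_omit)
  obtain x where x: "eqv n x (y (omit i as))" "homp (opp ((e + ?S) mod 2)) x"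
    using rc_parity[OF y lo hom_list_omit[OF h]] by blast
  have xm: "x \<in> mpolys n" using x(1) rc_mpolys[OF y lo] by (rule eqv_mpolys)
  have pi: "ps ! i \<le> 1" "as ! i \<in> gr (ps ! i)" using hom_list_nth[OF h] i l by auto
  have "homp ((ps ! i + opp ((e + ?S) mod 2)) mod 2) (t1 (Suc n) i (as ! i) x)"
    unfolding t1_def using pi xm x(2) i omit_vars_props[OF i]
    by (intro bp_homp[OF _ _ _ lin_var[of i "Suc n"]] homp_msubst[where n="Suc n"]) auto
  moreover have "(ps ! i + opp ((e + ?S) mod 2)) mod 2 = ?t"
    using parity_arith1[OF pi(1), of e ?S] sum_opp_omit[of i ps] lp i by (simp del: sum.lessThan_Suc)
  ultimately show "hasp (Suc n) ?t (t1 (Suc n) i (as ! i) (y (omit i as)))"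
    unfolding hasp_def using eqv_t1[OF x(1) i] by auto
next
  let ?t = "opp ((e + 1 + (\<Sum>k<Suc n. opp (ps ! k))) mod 2)"
  have lp: "length ps = Suc n" using h l by (simp add: hom_list_length)
  fix i j assume "j \<in> {..<Suc n}" "i \<in> {..<j}"
  then have ij: "i < j" "j < Suc n" by auto
  let ?r = "(ps ! i + ps ! j) mod 2"
  let ?qs = "?r # omit i (omit j ps)"
  have pi: "ps ! i \<le> 1" "as ! i \<in> gr (ps ! i)" "ps ! j \<le> 1" "as ! j \<in> gr (ps ! j)"
    using hom_list_nth[OF h] ij l by auto
  let ?S = "\<Sum>k<n. opp (?qs ! k)"
  have lq: "length (omit j ps) = n" using ij lp by (simp add: length_omit)
  obtain n' where n: "n = Suc n'" using ij by (cases n) auto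
  have "opp (omit j ps ! i) = opp (ps ! i)" using ij lp by (subst nth_omit) (auto simp: skip_def)
  then have s1: "(\<Sum>k<Suc n. opp (ps ! k)) = opp (ps ! j) + (opp (ps ! i) + (\<Sum>k<n'. opp (omit i (omit j ps) ! k)))"
    using sum_opp_omit[of j ps] sum_opp_omit[of i "omit j ps"] lp lq ij n by (simp del: sum.lessThan_Suc)
  have s2: "?S = opp ?r + (\<Sum>k<n'. opp (omit i (omit j ps) ! k))"
    unfolding n by (subst sum.lessThan_Suc_shift) simp
  have t: "opp ((e + ?S) mod 2) = ?t" unfolding s1 s2 by (rule parity_arith2[OF pi(1,3)])
  show "hasp (Suc n) ?t (t2 y as i j)"
    unfolding t2_def pl_def l
  proof (rule hasp_sum)
    fix k
    let ?bs = "lk (br (as ! i) (as ! j)) k # omit i (omit j as)"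
    have lb: "length ?bs = n" using ij l by (simp add: length_omit)
    have "hom_list ?qs ?bs" using pi by (auto intro!: hom_list_omit h br_parity)
    from rc_parity[OF y lb this] obtain x where x: "eqv n x (y ?bs)" "homp ?t x" using t by auto
    have xm: "x \<in> mpolys n" using x(1) rc_mpolys[OF y lb] by (rule eqv_mpolys)
    have "homp ?t (mvar i ^ k * msubst (subs2 (Suc n) i j) x)"
      using x(2) xm subs2_props[OF ij] ij
      by (intro homp_lin_power[OF _ lin_var[of i "Suc n"]] homp_msubst[where n="Suc n"]) auto
    moreover have "eqv (Suc n) (mvar i ^ k * msubst (subs2 (Suc n) i j) x) (mvar i ^ k * msubst (subs2 (Suc n) i j) (y ?bs))"
      using ij by (intro lin_power lin_var eqv_msubst[OF x(1) subs2_props[OF ij]]) auto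
    ultimately show "hasp (Suc n) ?t (mvar i ^ k * msubst (subs2 (Suc n) i j) (y ?bs))"
      unfolding hasp_def by blast
  qed simp
qed simp_all

lemma rc_hasp: "rc n e y \<Longrightarrow> length as = n \<Longrightarrow> hom_list ps as \<Longrightarrow>
    hasp n (opp ((e + (\<Sum>i<n. opp (ps ! i))) mod 2)) (y as)"
  unfolding hasp_def by (rule rc_parity)

lemma opp_mod_neq: "opp ((0 + s) mod 2) \<noteq> opp ((1 + s) mod 2)" for s :: nat by (auto simp: mod2_eq_if)

text \<open>Even and odd cochains meet only in 0, so a cochain splits uniquely. The definite
  description in \<open>d_PV\<close> is well defined because of this.\<close>

lemma rc_parity_zero:
  assumes "rc n 0 w" "rc n 1 w'" "\<And>as. length as = n \<Longrightarrow> eqv n (w as) (w' as)" "length as = n"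
  shows "eqv n (w as) 0"
proof (rule rc_eqI[OF assms(1) rc_0 assms(4)])
  fix ps as assume a: "length as = n" "hom_list ps as"
  show "eqv n (w as) 0"
    using rc_hasp[OF assms(1) a] rc_hasp[OF assms(2) a] assms(3)[OF a(1)] opp_mod_neq
    by (intro hasp_zero) auto
qed

text \<open>The two differentials have opposite parities, so their sum can vanish only if each does.
  Cocycles may therefore be treated one parity at a time.\<close>

lemma dF_parity_split:
  assumes "rc n 0 y0" "rc n 1 y1" and l: "length as = Suc n" and h: "hom_list ps as"
    and z: "eqv (Suc n) (dF 0 y0 ps as + dF 1 y1 ps as) 0"
  shows "eqv (Suc n) (dF 0 y0 ps as) 0" "eqv (Suc n) (dF 1 y1 ps as) 0"
proof -
  let ?S = "\<Sum>k<Suc n. opp (ps ! k)"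
  have a: "hasp (Suc n) (opp ((1 + ?S) mod 2)) (dF 0 y0 ps as)"
    using dF_hasp[OF assms(1) l h] by (simp del: sum.lessThan_Suc)
  have b: "hasp (Suc n) (opp ((0 + ?S) mod 2)) (- dF 1 y1 ps as)"
    using hasp_sg[OF _ dF_hasp[OF assms(2) l h], of 1] by (simp add: sg_def del: sum.lessThan_Suc)
  have "eqv (Suc n) (dF 0 y0 ps as + dF 1 y1 ps as - dF 1 y1 ps as) (0 - dF 1 y1 ps as)"
    by (intro eqv_diff z) auto
  then have "eqv (Suc n) (dF 0 y0 ps as) (- dF 1 y1 ps as)" by simp
  then show 0: "eqv (Suc n) (dF 0 y0 ps as) 0"
    by (rule hasp_zero[OF _ _ opp_mod_neq[THEN not_sym] a b, rotated 2]) simp_all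
  have "eqv (Suc n) (dF 0 y0 ps as + dF 1 y1 ps as - dF 0 y0 ps as) (0 - 0)"
    by (intro eqv_diff z 0)
  then show "eqv (Suc n) (dF 1 y1 ps as) 0" by simp
qed

section \<open>Cochains, cocycles and coboundaries\<close>

definition dd :: "nat \<Rightarrow> nat \<Rightarrow> ('v list \<Rightarrow> 'v mpoly) \<Rightarrow> 'v list \<Rightarrow> 'v mpoly" where
  "dd n e y as = (\<Sum>ps | length ps = Suc n \<and> set ps \<subseteq> {0, 1}. dF e y ps (map2 hpart ps as))"

lemma d_hom_toY: "d_hom n e (toY n y) = toY (Suc n) (dd n e y)"
proof
  fix as
  show "d_hom n e (toY n y) as = toY (Suc n) (dd n e y) as"
  proof (cases "length as = Suc n")
    case l: True
    have "eqv (Suc n) (\<Sum>ps | length ps = Suc n \<and> set ps \<subseteq> {0, 1}. d_formula e (toY n y) ps (map2 hpart ps as)) (dd n e y as)"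
      unfolding dd_def
    proof (rule eqv_sum)
      fix ps :: "nat list" assume "ps \<in> {ps. length ps = Suc n \<and> set ps \<subseteq> {0, 1}}"
      then have l': "length (map2 hpart ps as) = Suc n" using l by simp
      show "eqv (Suc n) (d_formula e (toY n y) ps (map2 hpart ps as)) (dF e y ps (map2 hpart ps as))"
        unfolding d_formula_dF by (rule dF_cong[OF _ l']) (simp add: toY_def rep_qclass)
    qed
    then show ?thesis using l by (simp add: d_hom_def toY_def qclass_eq)
  qed (simp add: d_hom_def toY_def)
qed

lemma dd_plus: "dd n e (\<lambda>as. y as + z as) as = dd n e y as + dd n e z as"
  by (simp add: dd_def dF_plus sum.distrib)

lemma toY_add: "cochain_add (toY n y) (toY n z) = toY n (\<lambda>as. y as + z as)"
  by (rule ext) (simp add: cochain_add_def toY_def qclass_add)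

lemma toY_zero: "cochain_zero n = toY n (\<lambda>_. 0)"
  by (simp add: cochain_zero_def toY_def)

lemma cochains_eq: "cochains n = {toY n (\<lambda>as. y0 as + y1 as) | y0 y1. rc n 0 y0 \<and> rc n 1 y1}"
proof
  show "cochains n \<subseteq> {toY n (\<lambda>as. y0 as + y1 as) | y0 y1. rc n 0 y0 \<and> rc n 1 y1}"
    unfolding cochains_def by (clarsimp elim!: hom_cochains_obtain simp: toY_add) blast
  show "{toY n (\<lambda>as. y0 as + y1 as) | y0 y1. rc n 0 y0 \<and> rc n 1 y1} \<subseteq> cochains n"
    unfolding cochains_def by (auto simp: toY_add[symmetric] toY_hom_cochains[symmetric])
qed

lemma d_PV_toY:
  assumes "rc n 0 y0" "rc n 1 y1"
  shows "d_PV n (toY n (\<lambda>as. y0 as + y1 as)) = toY (Suc n) (\<lambda>as. dd n 0 y0 as + dd n 1 y1 as)"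
  unfolding d_PV_def
proof (rule the_equality)
  show "\<exists>Y0\<in>hom_cochains n 0. \<exists>Y1\<in>hom_cochains n 1. toY n (\<lambda>as. y0 as + y1 as) = cochain_add Y0 Y1 \<and>
     toY (Suc n) (\<lambda>as. dd n 0 y0 as + dd n 1 y1 as) = cochain_add (d_hom n 0 Y0) (d_hom n 1 Y1)"
    using assms by (intro bexI[of _ "toY n y0"] bexI[of _ "toY n y1"])
      (auto simp: toY_add d_hom_toY toY_hom_cochains)
next
  fix W assume "\<exists>Y0\<in>hom_cochains n 0. \<exists>Y1\<in>hom_cochains n 1. toY n (\<lambda>as. y0 as + y1 as) = cochain_add Y0 Y1 \<and>
     W = cochain_add (d_hom n 0 Y0) (d_hom n 1 Y1)"
  then obtain z0 z1 where z: "rc n 0 z0" "rc n 1 z1"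
    "toY n (\<lambda>as. y0 as + y1 as) = toY n (\<lambda>as. z0 as + z1 as)"
    "W = cochain_add (d_hom n 0 (toY n z0)) (d_hom n 1 (toY n z1))"
    by (metis hom_cochains_obtain toY_add)
  have e: "eqv n (y0 as + y1 as) (z0 as + z1 as)" if "length as = n" for as :: "'v list"
    using z(3) that by (simp add: toY_eq)
  \<comment> \<open>The difference of the even parts is minus the difference of the odd parts, hence
    of both parities.\<close>
  have 0: "eqv n (y0 as - z0 as) 0" if "length as = n" for as :: "'v list"
  proof (rule rc_parity_zero[OF rc_diff[OF assms(1) z(1)] rc_diff[OF z(2) assms(2)] _ that])
    fix as :: "'v list" assume "length as = n"
    then have "eqv n (y0 as + y1 as - (z0 as + y1 as)) (z0 as + z1 as - (z0 as + y1 as))"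
      by (intro eqv_diff e) auto
    then show "eqv n (y0 as - z0 as) (z1 as - y1 as)" by simp
  qed
  have 1: "eqv n (y1 as - z1 as) 0" if "length as = n" for as
    using eqv_diff[OF eqv_diff[OF e[OF that] eqv_refl[of n "z0 as + z1 as"]] 0[OF that]]
    by (simp add: algebra_simps)
  have "toY n y0 = toY n z0" "toY n y1 = toY n z1"
    using 0 1 by (auto simp: toY_eq eqv_def)
  then show "W = toY (Suc n) (\<lambda>as. dd n 0 y0 as + dd n 1 y1 as)"
    using z(4) by (metis d_hom_toY toY_add)
qed

lemma coboundaries_Suc:
  "coboundaries (Suc m) = {toY (Suc m) (\<lambda>as. dd m 0 y0 as + dd m 1 y1 as) | y0 y1. rc m 0 y0 \<and> rc m 1 y1}"
proof -
  have "coboundaries (Suc m) = {d_PV m (toY m (\<lambda>as. y0 as + y1 as)) | y0 y1. rc m 0 y0 \<and> rc m 1 y1}"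
    unfolding coboundaries_def cochains_eq by auto
  also have "\<dots> = {toY (Suc m) (\<lambda>as. dd m 0 y0 as + dd m 1 y1 as) | y0 y1. rc m 0 y0 \<and> rc m 1 y1}"
    by (rule Collect_cong) (simp add: d_PV_toY cong: conj_cong rev_conj_cong)
  finally show ?thesis .
qed

lemma toY_cocycle:
  assumes "toY n (\<lambda>as. y0 as + y1 as) \<in> cocycles n" "rc n 0 y0" "rc n 1 y1"
    "length as = Suc n" "hom_list ps as"
  shows "eqv (Suc n) (dF 0 y0 ps as) 0" "eqv (Suc n) (dF 1 y1 ps as) 0"
proof -
  have "toY (Suc n) (\<lambda>as. dd n 0 y0 as + dd n 1 y1 as) = toY (Suc n) (\<lambda>_. 0)"
    using assms(1) d_PV_toY[OF assms(2,3)] by (simp add: cocycles_def toY_zero)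
  then have "eqv (Suc n) (dd n 0 y0 as + dd n 1 y1 as) 0" using assms(4) by (simp add: toY_eq)
  moreover have "eqv (Suc n) (dd n 0 y0 as) (dF 0 y0 ps as)" "eqv (Suc n) (dd n 1 y1 as) (dF 1 y1 ps as)"
    using d_hom_hom[OF assms(2,4,5), of 0] d_hom_hom[OF assms(3,4,5), of 1] assms(4)
    unfolding d_hom_toY by (auto simp: toY_def qclass_eq)
  ultimately have "eqv (Suc n) (dF 0 y0 ps as + dF 1 y1 ps as) 0"
    by (meson eqv_add eqv_sym eqv_trans)
  from dF_parity_split[OF assms(2-5) this]
  show "eqv (Suc n) (dF 0 y0 ps as) 0" "eqv (Suc n) (dF 1 y1 ps as) 0" .
qed

lemma zero_cocycle: "cochain_zero n \<in> cocycles n"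
proof -
  have "toY n (\<lambda>as. 0 + 0) \<in> cochains n" unfolding cochains_eq
    using rc_0[of n 0] rc_0[of n 1] by (intro CollectI exI[of _ "\<lambda>_. 0"] conjI) auto
  moreover have "d_PV n (toY n (\<lambda>as. 0 + 0)) = toY (Suc n) (\<lambda>as. dd n 0 (\<lambda>_. 0) as + dd n 1 (\<lambda>_. 0) as)"
    using d_PV_toY[OF rc_0 rc_0] .
  moreover have "dd n e (\<lambda>_. 0) as = 0" for e as using dd_plus[of n e "\<lambda>_. 0" "\<lambda>_. 0"] by simp
  ultimately show ?thesis unfolding cocycles_def by (simp add: toY_zero)
qed

section \<open>Cyclic permutations of the arguments\<close>

text \<open>Repeated adjacent exchanges bring the k-th argument to the front, past k others, which
  accounts for the sign. In this way lemmas about the first slot apply to every slot.\<close>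

lemma rc_cycle:
  assumes y: "rc n e y"
  shows "length as = n \<Longrightarrow> hom_list ps as \<Longrightarrow> k < n \<Longrightarrow>
    eqv n (msubst (mvar k # omit k (vars n)) (y (as ! k # omit k as)))
      (sg (opp (ps ! k) * (\<Sum>i<k. opp (ps ! i))) (y as))"
proof (induction k arbitrary: as ps)
  case 0
  then obtain a bs m where as: "as = a # bs" "n = Suc m" by (cases as) auto
  have "mvar 0 # omit 0 (vars n) = (vars n :: 'v mpoly list)"
    unfolding as(2) by (simp add: upt_rec[of 0 "Suc m"] del: upt_Suc)
  then show ?case using as 0 msubst_id[OF rc_mpolys[OF y], of as] by simp
next
  case (Suc k)
  let ?v = "vars n :: 'v mpoly list" let ?w = "swap_adj k ?v"
  let ?bs = "swap_adj k as" let ?qs = "swap_adj k ps"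
  have k: "Suc k < n" by fact
  have lps: "length ps = n" using Suc.prems hom_list_length by metis
  note w = swap_vars[OF k]
  have ml: "map (msubst ?w) ?v = ?w"
  proof (rule nth_equalityI)
    fix i assume "i < length (map (msubst ?w) ?v)"
    then have i: "i < n" by simp
    have "lin n (?w ! i)" using i by (intro w(2) nth_mem) simp
    then show "map (msubst ?w) ?v ! i = ?w ! i" using i by (simp add: lin_commute)
  qed simp
  have mk: "msubst ?w (mvar k) = mvar (Suc k)"
  proof -
    have "msubst ?w (mvar k) = ?w ! k" using k w(2)[of "?w ! k"] by (intro msubst_var) (auto simp: lin_commute)
    then show ?thesis using k by (simp add: nth_swap_adj)
  qed
  have lk: "length (mvar k # omit k ?v) = n" using k by (simp add: length_omit)
  have ll: "lin n L" if "L \<in> set (mvar k # omit k ?v)" for L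
    using that k lin_omit_vars by (auto intro: lin_var)
  have "y (as ! Suc k # omit (Suc k) as) \<in> mpolys n"
    using Suc.prems k by (intro rc_mpolys[OF y]) (auto simp: length_omit)
  then have "msubst ?w (msubst (mvar k # omit k ?v) (y (as ! Suc k # omit (Suc k) as))) =
      msubst (map (msubst ?w) (mvar k # omit k ?v)) (y (as ! Suc k # omit (Suc k) as))"
    using lk ll w by (intro msubst_msubst[where n=n]) auto
  also have "map (msubst ?w) (mvar k # omit k ?v) = mvar (Suc k) # omit (Suc k) ?v"
    using k by (simp add: mk omit_map[symmetric] ml[unfolded map_map comp_def] omit_swap_adj del: map_map)
      (metis (no_types) ml map_map omit_swap_adj length_map length_upt diff_zero)
  finally have c: "msubst ?w (msubst (mvar k # omit k ?v) (y (as ! Suc k # omit (Suc k) as))) =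
      msubst (mvar (Suc k) # omit (Suc k) ?v) (y (as ! Suc k # omit (Suc k) as))" .
  \<comment> \<open>The entry to be moved stands at position k after one exchange, so the induction
    hypothesis is applied to the exchanged list.\<close>
  have "eqv n (msubst (mvar k # omit k ?v) (y (?bs ! k # omit k ?bs)))
      (sg (opp (?qs ! k) * (\<Sum>i<k. opp (?qs ! i))) (y ?bs))"
    using Suc.prems k by (intro Suc.IH hom_list_swap) auto
  moreover have "(\<Sum>i<k. opp (?qs ! i)) = (\<Sum>i<k. opp (ps ! i))"
    using k lps by (intro sum.cong) (auto simp: nth_swap_adj)
  ultimately have "eqv n (msubst (mvar k # omit k ?v) (y (as ! Suc k # omit (Suc k) as)))
      (sg (opp (ps ! Suc k) * (\<Sum>i<k. opp (ps ! i))) (y ?bs))"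
    using k Suc.prems lps by (simp add: nth_swap_adj omit_swap_adj)
  then have "eqv n (msubst ?w (msubst (mvar k # omit k ?v) (y (as ! Suc k # omit (Suc k) as))))
      (msubst ?w (sg (opp (ps ! Suc k) * (\<Sum>i<k. opp (ps ! i))) (y ?bs)))"
    by (rule eqv_msubst[OF _ w])
  also have "eqv n \<dots> (sg (opp (ps ! Suc k) * (\<Sum>i<k. opp (ps ! i))) (sg (opp (ps ! k) * opp (ps ! Suc k)) (y as)))"
    unfolding sg_additive[OF additive_msubst] using Suc.prems k by (intro eqv_sg rc_sym[OF y])
  finally show ?case unfolding c sg_sg by (simp add: algebra_simps)
qed

end

lemma neg_eq_add_move: "- a = b + c \<Longrightarrow> a + c = - b" for a b c :: "'a::ab_group_add"
  by (metis add.commute add_minus_cancel minus_add_distrib minus_minus)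

section \<open>Differential monomials, one-variable contractions and the first slot of a
  cochain\<close>

context poisson_vertex_superalgebra begin

text \<open>Differential monomials together with their parity. Sums are left to spans, because signs
  need a definite parity.\<close>

inductive hgen :: "(nat \<Rightarrow> 'v set) \<Rightarrow> nat \<Rightarrow> 'v \<Rightarrow> bool" for G where
  hgen_one: "hgen G 0 1"
| hgen_gen: "a \<in> G p \<Longrightarrow> hgen G p a"
| hgen_D: "hgen G p a \<Longrightarrow> hgen G p (D a)"
| hgen_mult: "hgen G p a \<Longrightarrow> hgen G q b \<Longrightarrow> hgen G ((p + q) mod 2) (a * b)"

lemma D_pow_gr: "p \<le> 1 \<Longrightarrow> a \<in> gr p \<Longrightarrow> (D ^^ k) a \<in> gr p"
  by (induction k) (auto intro: D_even)

lemma br_1 [simp]: "br a 1 = 0"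
  using br_leibniz[of 0 0 1 1 a] one_even by simp

subsection \<open>Contraction of a polynomial in one variable\<close>

text \<open>Contraction for one variable: \<lambda> becomes \<partial> acting on w. Applied to a
  bracket [W i_\<lambda> v] with w = U i, it is the i-th summand of the Euler derivation.\<close>

definition cl :: "'v \<Rightarrow> 'v lpoly \<Rightarrow> 'v" where
  "cl w f = (\<Sum>k\<in>ks f. (D ^^ k) w * lk f k)"

lemma cl_add: "cl w (f + g) = cl w f + cl w g"
  unfolding cl_def by (rule sum_keys_add) (auto simp: algebra_simps)
lemma additive_cl: "additive (cl w)" by standard (rule cl_add)
lemma cl_single: "cl w (sgl k v) = (D ^^ k) w * v"
  unfolding cl_def by (rule sum_keys_single) auto
lemma cl_lconst: "cl w (lconst v) = w * v" by (simp add: cl_single)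
lemma cl_lam: "cl w (lam * f) = cl (D w) f"
proof (rule additive_eqI[of "\<lambda>f. cl w (lam * f)" "\<lambda>f. cl (D w) f"])
  show "additive (\<lambda>f. cl w (lam * f))" "additive (\<lambda>f. cl (D w) f)"
    by (auto intro!: additive.intro simp: algebra_simps cl_add)
qed (simp add: mult_single cl_single funpow_swap1)
lemma cl_D: "cl w (pmap D f) = D (cl w f) - cl (D w) f"
proof (rule additive_eqI[of "\<lambda>f. cl w (pmap D f)" "\<lambda>f. D (cl w f) - cl (D w) f"])
  show "additive (\<lambda>f. cl w (pmap D f))" "additive (\<lambda>f. D (cl w f) - cl (D w) f)"
    by (auto intro!: additive.intro simp: algebra_simps cl_add D_add additive.add[OF additive_pmap[OF additive_D]])
qed (simp add: cl_single D_mult funpow_swap1)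
lemma cl_mult_right: "cl w (f * lconst c) = cl w f * c"
proof (rule additive_eqI[of "\<lambda>f. cl w (f * lconst c)" "\<lambda>f. cl w f * c"])
  show "additive (\<lambda>f. cl w (f * lconst c))" "additive (\<lambda>f. cl w f * c)"
    by (auto intro!: additive.intro simp: algebra_simps cl_add)
qed (simp add: mult_single cl_single mult.assoc)
lemma cl_mult_left:
  assumes "p \<le> 1" "q \<le> 1" "w \<in> gr p" "c \<in> gr q"
  shows "cl w (lconst c * f) = sg (p * q) (c * cl w f)"
proof (rule additive_eqI[of "\<lambda>f. cl w (lconst c * f)" "\<lambda>f. sg (p * q) (c * cl w f)"])
  show "additive (\<lambda>f. cl w (lconst c * f))" "additive (\<lambda>f. sg (p * q) (c * cl w f))"
    by (auto intro!: additive.intro simp: algebra_simps cl_add sg_add)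
  fix k v
  have "(D ^^ k) w * c = sg (p * q) (c * (D ^^ k) w)"
    using supercommute[of p q "(D ^^ k) w" c] assms D_pow_gr unfolding sg_eq by blast
  then show "cl w (lconst c * sgl k v) = sg (p * q) (c * cl w (sgl k v))"
    by (simp add: mult_single cl_single mult.assoc[symmetric] sg_mult_left)
qed
lemma cl_sc: "cl w (sc c f) = scale c (cl w f)"
proof (rule additive_eqI[of "\<lambda>f. cl w (sc c f)" "\<lambda>f. scale c (cl w f)"])
  show "additive (\<lambda>f. cl w (sc c f))" "additive (\<lambda>f. scale c (cl w f))"
    by (auto intro!: additive.intro simp: algebra_simps cl_add additive.add[OF additive_pmap[OF additive_scale]])
qed (simp add: cl_single scale_mult_right)

lemma contr_lev: "contr w (lev (mvar 0) f) = mconst (cl w f)"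
proof (rule additive_eqI[of "\<lambda>f. contr w (lev (mvar 0) f)" "\<lambda>f. mconst (cl w f)"])
  show "additive (\<lambda>f. contr w (lev (mvar 0) f))" "additive (\<lambda>f. mconst (cl w f))"
    by (auto intro!: additive.intro simp: contr_add lev_add cl_add single_add)
  have "contr w (mvar 0 ^ k * x) = contr ((D ^^ k) w) x" for k x
    by (induction k arbitrary: w) (auto simp: mult.assoc contr_rules funpow_swap1)
  then show "contr w (lev (mvar 0) (sgl k v)) = mconst (cl w (sgl k v))" for k v
    by (simp add: lev_single cl_single contr_mconst)
qed

subsection \<open>The operator dual to contraction\<close>

text \<open>The part of \<open>y (cl w f # B)\<close> in which w remains the argument, as a function
  of x = \<open>y (w # B)\<close>: sesquilinearity turns D^k w into (-\<lambda>)^k, and the Leibniz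
  rule lets the k-th coefficient act by its exponential.\<close>

definition pe :: "'v lpoly \<Rightarrow> 'v mpoly \<Rightarrow> 'v mpoly" where
  "pe f x = (\<Sum>k\<in>ks f. exp_act 0 (lk f k) ((- mvar 0) ^ k * x))"

lemma exp_act_0_left [simp]: "exp_act i 0 x = 0" by (rule additive.zero[OF additive_exp_act_left])

lemma pe_add: "pe (f + g) x = pe f x + pe g x"
  unfolding pe_def by (rule sum_keys_add) (auto simp: exp_act_add_left)
lemma additive_pe: "additive (\<lambda>f. pe f x)" by standard (rule pe_add)
lemma pe_single: "pe (sgl k v) x = exp_act 0 v ((- mvar 0) ^ k * x)"
  unfolding pe_def by (rule sum_keys_single) auto
lemma pe_lconst: "pe (lconst v) x = exp_act 0 v x" by (simp add: pe_single)
text \<open>Replacing a by D a applies \<lambda> + \<partial> to the bracket of a fixed element with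
  a; here this becomes the factor that sesquilinearity prescribes for y.\<close>

lemma pe_der: "pe (lam * f + pmap D f) x = - (mvar 0 * pe f x)"
proof (rule additive_eqI[of "\<lambda>f. pe (lam * f + pmap D f) x" "\<lambda>f. - (mvar 0 * pe f x)"])
  show "additive (\<lambda>f. pe (lam * f + pmap D f) x)" "additive (\<lambda>f. - (mvar 0 * pe f x))"
    by (auto intro!: additive.intro simp: algebra_simps pe_add additive.add[OF additive_pmap[OF additive_D]])
  fix k v
  have c: "mvar 0 * ((- mvar 0) ^ k * x) = - ((- mvar 0) ^ Suc k * x)" by (simp add: mult.assoc)
  have "exp_act 0 v (mvar 0 * ((- mvar 0) ^ k * x)) = mvar 0 * exp_act 0 v ((- mvar 0) ^ k * x) + exp_act 0 (D v) ((- mvar 0) ^ k * x)"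
    by (rule exp_act_mvar_same)
  then show "pe (lam * sgl k v + pmap D (sgl k v)) x = - (mvar 0 * pe (sgl k v) x)"
    unfolding c additive.minus[OF additive_exp_act]
    by (simp only: mult_single pe_add pe_single map_single D_0 mult_1_left plus_1_eq_Suc)
      (rule neg_eq_add_move)
qed
lemma pe_mult_left: "pe (lconst a * f) x = exp_act 0 a (pe f x)"
proof (rule additive_eqI[of "\<lambda>f. pe (lconst a * f) x" "\<lambda>f. exp_act 0 a (pe f x)"])
  show "additive (\<lambda>f. pe (lconst a * f) x)" "additive (\<lambda>f. exp_act 0 a (pe f x))"
    by (auto intro!: additive.intro simp: algebra_simps pe_add exp_act_add)
qed (simp add: mult_single pe_single exp_act_mult)
lemma pe_sc: "pe (sc c f) x = sc c (pe f x)"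
proof (rule additive_eqI[of "\<lambda>f. pe (sc c f) x" "\<lambda>f. sc c (pe f x)"])
  show "additive (\<lambda>f. pe (sc c f) x)" "additive (\<lambda>f. sc c (pe f x))"
    by (auto intro!: additive.intro simp: sc_add pe_add additive.add[OF additive_pmap[OF additive_scale]])
qed (simp add: pe_single exp_act_scale)

lemma lin_neg_power: "i < n \<Longrightarrow> eqv n x y \<Longrightarrow> eqv n ((- mvar i) ^ k * x) ((- mvar i) ^ k * y)"
proof (induction k)
  case (Suc k) then show ?case by (simp add: mult.assoc eqv_minus eqv_mvar)
qed simp

lemma eqv_pe: "eqv n x y \<Longrightarrow> 0 < n \<Longrightarrow> eqv n (pe f x) (pe f y)"
  unfolding pe_def by (intro eqv_sum eqv_exp lin_neg_power)

lemma flip_add: "flip D (f + g) = flip D f + flip D g"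
proof -
  have a: "((\<lambda>r. - (lam * r) - pmap D r) ^^ k) (lconst (u + v)) =
     ((\<lambda>r. - (lam * r) - pmap D r) ^^ k) (lconst u) + ((\<lambda>r. - (lam * r) - pmap D r) ^^ k) (lconst v)" for k u v
    by (induction k) (auto simp: single_add algebra_simps additive.add[OF additive_pmap[OF additive_D]])
  have z: "((\<lambda>r. - (lam * r) - pmap D r) ^^ k) (lconst 0) = 0" for k
    using a[of k 0 0] by simp
  show ?thesis unfolding flip_def by (rule sum_keys_add[OF z a])
qed
lemma additive_flip: "additive (flip D)" by standard (rule flip_add)
lemma flip_single: "flip D (sgl k v) = ((\<lambda>r. - (lam * r) - pmap D r) ^^ k) (lconst v)"
proof -
  have "flip D 0 = 0" by (rule additive.zero[OF additive_flip])
  then show ?thesis unfolding flip_def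
  proof (intro sum_keys_single)
    have "additive (\<lambda>r. - (lam * r) - pmap D r)"
      by (auto intro!: additive.intro simp: algebra_simps additive.add[OF additive_pmap[OF additive_D]])
    then have "((\<lambda>r. - (lam * r) - pmap D r) ^^ k) 0 = 0"
      by (induction k) (auto dest: additive.zero)
    then show "((\<lambda>r. - (lam * r) - pmap D r) ^^ k) (lconst 0) = 0" by simp
  qed
qed

text \<open>By skew-symmetry of the bracket this replaces [a_(\<lambda> + \<partial>) u] by coefficients of [u_\<lambda> a].\<close>

lemma subop_flip: "subop 0 (Phi 0) (lev (mvar 0) (flip D f)) x = pe f x"
proof (rule additive_eqI[of "\<lambda>f. subop 0 (Phi 0) (lev (mvar 0) (flip D f)) x" "\<lambda>f. pe f x"])
  show "additive (\<lambda>f. subop 0 (Phi 0) (lev (mvar 0) (flip D f)) x)" "additive (\<lambda>f. pe f x)"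
    by (auto intro!: additive.intro simp: flip_add lev_add subop_add_op[OF additive_Phi] pe_add)
  fix k v
  have "lev (mvar 0) (((\<lambda>r. - (lam * r) - pmap D r) ^^ k) (lconst v)) = ((\<lambda>z. - Phi 0 z) ^^ k) (mconst v)"
  proof (induction k)
    case (Suc k)
    have "lev (mvar 0) (- (lam * r) - pmap D r) = - Phi 0 (lev (mvar 0) r)" for r
      using lev_pmap[OF additive_D lin_var[of 0 1], of r]
      by (simp add: additive.diff[OF additive_lev] additive.minus[OF additive_lev] lev_lam[unfolded One_nat_def] Phi_def)
    then show ?case using Suc by simp
  qed simp
  \<comment> \<open>One application of \<open>Phi\<close> to the operand is traded for one factor of
    the variable.\<close>
  moreover have "subop 0 (Phi 0) (((\<lambda>z. - Phi 0 z) ^^ k) z) x = subop 0 (Phi 0) z ((- mvar 0) ^ k * x)" for z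
  proof (induction k arbitrary: z)
    case (Suc k)
    have m: "subop 0 (Phi 0) (- w) x = - subop 0 (Phi 0) w x" for w x
      by (rule additive.minus, standard, rule subop_add_op[OF additive_Phi])
    have "subop 0 (Phi 0) (((\<lambda>z. - Phi 0 z) ^^ Suc k) z) x = subop 0 (Phi 0) (((\<lambda>z. - Phi 0 z) ^^ k) (- Phi 0 z)) x"
      by (simp only: funpow_Suc_right comp_apply)
    also have "\<dots> = - subop 0 (Phi 0) (Phi 0 z) ((- mvar 0) ^ k * x)" unfolding Suc m ..
    also have "\<dots> = subop 0 (Phi 0) z (- (mvar 0 * ((- mvar 0) ^ k * x)))"
      by (simp add: additive.minus[OF additive_subop] subop_mvar_same)
    finally show ?case by (simp add: mult.assoc)
  qed simp
  ultimately show "subop 0 (Phi 0) (lev (mvar 0) (flip D (sgl k v))) x = pe (sgl k v) x"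
    by (simp add: flip_single pe_single exp_act_subop)
qed

lemma rc_sum_front:
  assumes y: "rc (Suc n) e y" and l: "length B = n"
  shows "eqv (Suc n) (y ((\<Sum>x\<in>A. f x) # B)) (\<Sum>x\<in>A. y (f x # B))"
proof (induction A rule: infinite_finite_induct)
  case (insert a A)
  have "eqv (Suc n) (y ((f a + (\<Sum>x\<in>A. f x)) # B)) (y (f a # B) + y ((\<Sum>x\<in>A. f x) # B))"
    using rc_add[OF y, of "0 # B" 0] l by simp
  also have "eqv (Suc n) \<dots> (y (f a # B) + (\<Sum>x\<in>A. y (f x # B)))"
    by (intro eqv_add insert eqv_refl)
  finally show ?case using insert by simp
qed (auto intro!: rc_zero[OF y] simp: l)

lemma rc_D_pow_front:
  assumes y: "rc (Suc n) e y" and l: "length B = n"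
  shows "eqv (Suc n) (y ((D ^^ k) a # B)) ((- mvar 0) ^ k * y (a # B))"
proof (induction k)
  case (Suc k)
  have "eqv (Suc n) (y (D ((D ^^ k) a) # B)) (- (mvar 0 * y ((D ^^ k) a # B)))"
    using rc_sesq[OF y, of "(D ^^ k) a # B" 0] l by simp
  also have "eqv (Suc n) \<dots> (- (mvar 0 * ((- mvar 0) ^ k * y (a # B))))"
    by (intro eqv_minus eqv_mvar Suc) simp
  finally show ?case by (simp add: mult.assoc)
qed simp

lemma rc_mult_front:
  assumes y: "rc (Suc n) e y" and l: "length B = n" "hom_list qs B"
    and h: "p \<le> 1" "q \<le> 1" "b \<in> gr p" "c \<in> gr q"
  shows "eqv (Suc n) (y ((b * c) # B))
    (sg (p * e) (exp_act 0 b (y (c # B))) + sg (q * (p + e)) (exp_act 0 c (y (b # B))))"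
  using rc_leibniz[OF y _ _ _ h, of "0 # B" "0 # qs" 0] l by simp

end

text \<open>The half of the duality needed to recover a cochain from its values on the U i. It is
  separate so that it can be interpreted once more with the roles of U and W exchanged.\<close>

locale half_dual = poisson_vertex_superalgebra scale gr D br
  for scale :: "'f::field_char_0 \<Rightarrow> 'v::ring_1 \<Rightarrow> 'v"
    and gr :: "nat \<Rightarrow> 'v set" and D :: "'v \<Rightarrow> 'v" and br :: "'v \<Rightarrow> 'v \<Rightarrow> 'v lpoly" +
  fixes I :: "'i set" and U W :: "'i \<Rightarrow> 'v" and pr :: "'i \<Rightarrow> nat"
  assumes finite_I: "finite I" and pr_le: "i \<in> I \<Longrightarrow> pr i \<le> 1"
    and U_gr: "i \<in> I \<Longrightarrow> U i \<in> gr (pr i)" and W_gr: "i \<in> I \<Longrightarrow> W i \<in> gr (pr i)"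
    and br_WU: "i \<in> I \<Longrightarrow> k \<in> I \<Longrightarrow> br (W i) (U k) = lconst (if i = k then 1 else 0)"
    and gen_U: "v \<in> span {a. \<exists>p. hgen (\<lambda>p. {U i |i. i \<in> I \<and> pr i = p}) p a}"
begin

abbreviation "hg \<equiv> hgen (\<lambda>p. {U i |i. i \<in> I \<and> pr i = p})"

lemma hg_gr: "hg p a \<Longrightarrow> p \<le> 1 \<and> a \<in> gr p"
proof (induction rule: hgen.induct)
  case (hgen_gen a p) then show ?case using pr_le U_gr by auto
qed (auto simp: one_even D_even gr_mult)

text \<open>A combination of monomials that represents a homogeneous element may contain monomials
  of the wrong parity. The projection to parity p removes them.\<close>

lemma gr_hg_induct [consumes 2, case_names zero hg add scale]:
  assumes "p \<le> 1" "a \<in> gr p" "P 0" "\<And>a. hg p a \<Longrightarrow> P a"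
    "\<And>x y. x \<in> gr p \<Longrightarrow> y \<in> gr p \<Longrightarrow> P x \<Longrightarrow> P y \<Longrightarrow> P (x + y)" "\<And>c x. x \<in> gr p \<Longrightarrow> P x \<Longrightarrow> P (scale c x)"
  shows "P a"
proof -
  define Q where "Q x \<longleftrightarrow> x \<in> gr p \<and> P x" for x
  have hs: "hpart p (scale c x) = scale c (hpart p x)" for c x
  proof (rule hpart_eq[OF assms(1)])
    show "scale c (hpart p x) \<in> gr p" using assms(1) by (intro gr_scale hpart_in)
    have "scale c (x - hpart p x) \<in> gr (1 - p)" using assms(1) by (intro gr_scale hpart_rest) auto
    then show "scale c x - scale c (hpart p x) \<in> gr (1 - p)" by (simp add: algebra_simps)
  qed
  have "hpart p v = 0 \<or> Q (hpart p v)" for v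
    using gen_U[of v]
  proof (induction rule: span_induct_alt)
    case base then show ?case by (simp add: additive.zero[OF additive_hpart[OF assms(1)]])
  next
    case (step c x y)
    then obtain q where q: "hg q x" by blast
    have "hpart p (scale c x) = 0 \<or> Q (hpart p (scale c x))"
    proof (cases "p = q")
      case True
      then have "Q x" using q assms(4) hg_gr unfolding Q_def by blast
      then show ?thesis using hs True assms(1,6) hg_gr[OF q] by (auto simp: Q_def gr_scale)
    next
      case False
      then have "hpart p x = 0" using hg_gr[OF q] assms(1) by (auto intro: hpart_other)
      then show ?thesis by (simp add: hs)
    qed
    with step show ?case unfolding hpart_add[OF assms(1)]
      using assms(1,5) by (auto simp: Q_def gr_add)
  qed
  from this[of a] have "a = 0 \<or> Q a" using assms(1,2) by simp
  then show ?thesis using assms(3) by (auto simp: Q_def)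
qed


lemma hg_induct [case_names zero hg add scale]:
  assumes "P 0" "\<And>p a. hg p a \<Longrightarrow> P a" "\<And>x y. P x \<Longrightarrow> P y \<Longrightarrow> P (x + y)" "\<And>c x. P x \<Longrightarrow> P (scale c x)"
  shows "P v"
  using gen_U[of v] by (induction rule: span_induct_alt) (auto intro: assms)

section \<open>The Euler derivation\<close>

text \<open>Since [W i_\<lambda> U k] is 1 for i = k and 0 otherwise, [W i_\<lambda> v] is the
  generating series of the partial derivatives of v in the D^k (U i). So this multiplies each such
  derivative by D^k (U i) and adds up.\<close>

definition E :: "'v \<Rightarrow> 'v" where "E v = (\<Sum>i\<in>I. cl (U i) (br (W i) v))"

abbreviation "Em \<equiv> pmap E"

lemma E_add: "E (a + b) = E a + E b" by (simp add: E_def br_add_right cl_add sum.distrib)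
lemma additive_E: "additive E" by standard (rule E_add)
lemma E_0 [simp]: "E 0 = 0" by (rule additive.zero[OF additive_E])
lemma E_scale: "E (scale c a) = scale c (E a)"
  by (simp add: E_def br_scale_right cl_sc scale_sum_right)
lemma E_D: "E (D a) = D (E a)"
  by (simp add: E_def br_D_right cl_add cl_lam[unfolded One_nat_def] cl_D D_sum)
lemma E_mult: "E (b * c) = E b * c + b * E c"
proof -
  have "E (b * c) = E b * c + b * E c" if "q \<le> 1" "b \<in> gr q" for q b
    unfolding E_def sum_distrib_left sum_distrib_right sum.distrib[symmetric]
  proof (rule sum.cong[OF refl])
    fix i assume i: "i \<in> I"
    \<comment> \<open>The sign of passing W i across b is undone by passing U i across b, as they
      have equal parity.\<close>
    have "cl (U i) (sg (pr i * q) (lconst b * br (W i) c)) = b * cl (U i) (br (W i) c)"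
      using i that pr_le U_gr cl_mult_left[of "pr i" q "U i" b]
      by (simp add: sg_additive[OF additive_cl] sg_sg) (simp add: sg_def)
    then show "cl (U i) (br (W i) (b * c)) = cl (U i) (br (W i) b) * c + b * cl (U i) (br (W i) c)"
      using i that pr_le W_gr br_mult[of "pr i" q "W i" b c] by (simp add: cl_add cl_mult_right)
  qed
  from this[of 0] this[of 1] show ?thesis
    by (induction b rule: gr_induct) (auto simp: E_add algebra_simps)
qed
lemma E_1 [simp]: "E 1 = 0" using E_mult[of 1 1] by simp
lemma E_gr:
  assumes "q \<le> 1" "v \<in> gr q" shows "E v \<in> gr q"
  unfolding E_def cl_def
proof (intro gr_sumI assms)
  fix i k assume i: "i \<in> I"
  have "(D ^^ k) (U i) * lk (br (W i) v) k \<in> gr ((pr i + (pr i + q) mod 2) mod 2)"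
    using i pr_le U_gr W_gr assms by (intro gr_mult D_pow_gr br_parity) auto
  moreover have "(pr i + (pr i + q) mod 2) mod 2 = q" using assms(1) pr_le[OF i]
    by (cases "pr i = 0"; cases "q = 0") (auto simp: le_Suc_eq)
  ultimately show "(D ^^ k) (U i) * lk (br (W i) v) k \<in> gr q" by simp
qed
lemma E_U: "k \<in> I \<Longrightarrow> E (U k) = U k"
proof -
  assume k: "k \<in> I"
  have "E (U k) = (\<Sum>i\<in>I. if i = k then U i else 0)"
    unfolding E_def using k by (intro sum.cong) (auto simp: br_WU cl_lconst[unfolded One_nat_def] additive.zero[OF additive_cl] simp flip: single_one)
  then show ?thesis using k finite_I by simp
qed

text \<open>The eigenvalue d is the number of generators in the monomial. In degree 0 there may also
  be 0, for instance as D 1.\<close>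

lemma hg_degree: "hg p a \<Longrightarrow> \<exists>d::nat. E a = scale (of_nat d) a \<and> (d = 0 \<longrightarrow> a = 0 \<or> a = 1)"
proof (induction rule: hgen.induct)
  case hgen_one then show ?case by (intro exI[of _ 0]) auto
next
  case (hgen_gen a p) then show ?case by (intro exI[of _ 1]) (auto simp: E_U)
next
  case (hgen_D p a)
  then obtain d :: nat where "E a = scale (of_nat d) a" "d = 0 \<longrightarrow> a = 0 \<or> a = 1" by blast
  then show ?case by (intro exI[of _ d]) (auto simp: E_D D_scale)
next
  case (hgen_mult p a q b)
  then obtain d d' :: nat where "E a = scale (of_nat d) a" "d = 0 \<longrightarrow> a = 0 \<or> a = 1"
    "E b = scale (of_nat d') b" "d' = 0 \<longrightarrow> b = 0 \<or> b = 1" by blast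
  then show ?case by (intro exI[of _ "d + d'"])
    (auto simp: E_mult scale_left_distrib scale_mult_left[symmetric] scale_mult_right[symmetric])
qed

lemma contr_bp: "(\<Sum>i\<in>I. contr (U i) (bp (W i) (mvar 0) (msubst (map (\<lambda>k. mvar (Suc k)) [0..<n]) x))) = Em x"
  if "x \<in> mpolys n"
  using that
proof (induction rule: mpolys_induct)
  case (const v)
  have "mconst (\<Sum>i\<in>A. f i) = (\<Sum>i\<in>A. mconst (f i))" for A and f :: "'i \<Rightarrow> 'v"
    by (induction A rule: infinite_finite_induct) (auto simp: single_add)
  then show ?case by (simp add: bp_mconst contr_lev pmap_mconst[of E]) (simp add: E_def)
next
  case (var k x)
  have "msubst (map (\<lambda>k. mvar (Suc k)) [0..<n]) (mvar k * x) = mvar (Suc k) * msubst (map (\<lambda>k. mvar (Suc k)) [0..<n]) x"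
    using var(1) by (subst msubst_mvar_lin[of _ _ "Suc n"]) (auto intro: lin_var)
  then show ?case using var by (simp add: bp_mvar contr_rules pmap_mvar[OF additive_E] sum_distrib_left[symmetric])
next
  case (add x y)
  then show ?case by (simp add: msubst_add bp_add contr_add sum.distrib additive.add[OF additive_pmap[OF additive_E]])
qed

section \<open>Reconstruction of a cochain from its values on generators\<close>

text \<open>The chain rule: a cochain in its first slot behaves like a derivative, so its value at a
  is assembled from the partial derivatives of a, read off from [W i_\<lambda> a], and its values at
  the U i.\<close>

definition J :: "nat \<Rightarrow> ('v list \<Rightarrow> 'v mpoly) \<Rightarrow> 'v list \<Rightarrow> nat \<Rightarrow> 'v \<Rightarrow> 'v mpoly" where
  "J e y B p a = (\<Sum>i\<in>I. sg ((pr i + p) * (pr i + e)) (pe (br (W i) a) (y (U i # B))))"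

lemma J_add: "J e y B p (a + b) = J e y B p a + J e y B p b"
  by (simp add: J_def br_add_right pe_add sg_add sum.distrib)
lemma J_scale: "J e y B p (scale c a) = sc c (J e y B p a)"
  by (simp add: J_def br_scale_right pe_sc additive.sum[OF additive_sc] sg_additive[OF additive_sc])

lemma rc_one_front:
  assumes y: "rc (Suc n) e y" and l: "length B = n" "hom_list qs B"
  shows "eqv (Suc n) (y (1 # B)) 0"
proof -
  have "eqv (Suc n) (y ((1 * 1) # B)) (y (1 # B) + y (1 # B))"
    using rc_mult_front[OF y l, of 0 0 1 1] one_even by (simp add: exp_act_1)
  then have "eqv (Suc n) (y (1 # B) - y (1 # B)) (y (1 # B) + y (1 # B) - y (1 # B))"
    by (intro eqv_diff) auto
  then show ?thesis by (simp add: eqv_sym)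
qed

text \<open>Both sides obey the same rules for 1, D and products, and agree on the U i because of
  duality.\<close>

lemma J_hg:
  assumes y: "rc (Suc n) e y" and l: "length B = n" "hom_list qs B"
  shows "hg p a \<Longrightarrow> eqv (Suc n) (y (a # B)) (J e y B p a)"
proof (induction rule: hgen.induct)
  case hgen_one
  then show ?case using rc_one_front[OF y l] by (simp add: J_def additive.zero[OF additive_pe])
next
  case (hgen_gen a p)
  then obtain k where k: "k \<in> I" "a = U k" "p = pr k" by auto
  have "J e y B p a = (\<Sum>i\<in>I. if i = k then y (U i # B) else 0)"
    unfolding J_def using k
    by (intro sum.cong refl) (auto simp: br_WU additive.zero[OF additive_pe] pe_lconst exp_act_1 sg_def simp flip: single_one)
  then show ?case using k finite_I by simp
next
  case (hgen_D p a)
  have "eqv (Suc n) (y (D a # B)) (- (mvar 0 * y (a # B)))"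
    using rc_D_pow_front[OF y l(1), of 1 a] by simp
  also have "eqv (Suc n) \<dots> (- (mvar 0 * J e y B p a))"
    by (intro eqv_minus eqv_mvar hgen_D) simp
  also have "\<dots> = J e y B p (D a)"
    by (simp add: J_def br_D_right pe_der[unfolded One_nat_def] sum_distrib_left sum_negf sg_mult_right sg_uminus)
  finally show ?case .
next
  case (hgen_mult p a q b)
  have h: "p \<le> 1" "q \<le> 1" "a \<in> gr p" "b \<in> gr q" using hg_gr hgen_mult by auto
  have "eqv (Suc n) (y ((a * b) # B)) (sg (p * e) (exp_act 0 a (y (b # B))) + sg (q * (p + e)) (exp_act 0 b (y (a # B))))"
    by (rule rc_mult_front[OF y l h])
  also have "eqv (Suc n) \<dots> (sg (p * e) (exp_act 0 a (J e y B q b)) + sg (q * (p + e)) (exp_act 0 b (J e y B p a)))"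
    by (intro eqv_add eqv_sg eqv_exp hgen_mult) auto
  also have "\<dots> = J e y B ((p + q) mod 2) (a * b)"
    unfolding J_def additive.sum[OF additive_exp_act] sg_sum sum.distrib[symmetric]
  proof (rule sum.cong[OF refl])
    fix i assume i: "i \<in> I"
    have pi: "pr i \<le> 1" "W i \<in> gr (pr i)" using i pr_le W_gr by auto
    let ?Y = "y (U i # B)" let ?r = "(pr i + p) mod 2"
    \<comment> \<open>Both coefficients must stand in front for \<open>pe_mult_left\<close>, so b is
      carried across the bracket; the four parities then settle the signs.\<close>
    have "lconst b * br (W i) a = sg (q * ?r) (br (W i) a * lconst b)"
      using h pi by (intro mconst_supercommute br_homp) auto
    then have "br (W i) a * lconst b = sg (q * ?r) (lconst b * br (W i) a)" by (simp add: sg_sg) (simp add: sg_def)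
    then have "pe (br (W i) (a * b)) ?Y = sg (q * ?r) (exp_act 0 b (pe (br (W i) a) ?Y)) + sg (pr i * p) (exp_act 0 a (pe (br (W i) b) ?Y))"
      using br_mult[of "pr i" p "W i" a b] h pi
      by (simp add: pe_add sg_additive[OF additive_pe] pe_mult_left)
    then show "sg (p * e) (exp_act 0 a (sg ((pr i + q) * (pr i + e)) (pe (br (W i) b) ?Y)))
      + sg (q * (p + e)) (exp_act 0 b (sg ((pr i + p) * (pr i + e)) (pe (br (W i) a) ?Y)))
      = sg ((pr i + (p + q) mod 2) * (pr i + e)) (pe (br (W i) (a * b)) ?Y)"
      by (simp add: sg_add sg_sg sg_additive[OF additive_exp_act])
        (cases "even (pr i)"; cases "even p"; cases "even q"; cases "even e"; simp add: sg_def)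
  qed
  finally show ?case .
qed

lemma J_eq:
  assumes y: "rc (Suc n) e y" and l: "length B = n" "hom_list qs B" and a: "p \<le> 1" "a \<in> gr p"
  shows "eqv (Suc n) (y (a # B)) (J e y B p a)"
  using a
proof (induction rule: gr_hg_induct)
  case zero then show ?case using rc_zero[OF y, of "0 # B"] l by (simp add: J_def additive.zero[OF additive_pe])
next
  case (hg a) then show ?case by (rule J_hg[OF y l])
next
  case (add a b)
  have "eqv (Suc n) (y ((a + b) # B)) (y (a # B) + y (b # B))"
    using rc_add[OF y, of "0 # B" 0 a b] l by simp
  also have "eqv (Suc n) \<dots> (J e y B p (a + b))" unfolding J_add by (intro eqv_add add)
  finally show ?case .
next
  case (scale c a)
  have "eqv (Suc n) (y (scale c a # B)) (sc c (y (a # B)))"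
    using rc_scale[OF y, of "0 # B" 0 c a] l by simp
  also have "eqv (Suc n) \<dots> (J e y B p (scale c a))" unfolding J_scale by (intro eqv_sc scale)
  finally show ?case .
qed

text \<open>The contraction of the terms of dY that contain the bracket of W i and a.\<close>

definition Fe :: "nat \<Rightarrow> ('v list \<Rightarrow> 'v mpoly) \<Rightarrow> 'v list \<Rightarrow> 'v \<Rightarrow> 'v mpoly" where
  "Fe e y B a = (\<Sum>i\<in>I. sg (pr i * e)
     (\<Sum>k\<in>ks (br (W i) a). exp_act 0 ((D ^^ k) (U i)) (y (lk (br (W i) a) k # B))))"

text \<open>E a is a sum of products D^k (U i) c. By the Leibniz rule y of such a product has a part
  where D^k (U i) is the coefficient, which adds up to \<open>Fe\<close>, and a part where it is the
  argument, which adds up to \<open>J\<close> and hence to y at a.\<close>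

lemma Fe_eq:
  assumes y: "rc (Suc n) e y" and l: "length B = n" "hom_list qs B" and a: "p \<le> 1" "a \<in> gr p"
  shows "eqv (Suc n) (Fe e y B a) (y (E a # B) - y (a # B))"
proof -
  let ?c = "\<lambda>i k. lk (br (W i) a) k"
  have "eqv (Suc n) (y (E a # B)) (\<Sum>i\<in>I. y (cl (U i) (br (W i) a) # B))"
    unfolding E_def by (rule rc_sum_front[OF y l(1)])
  also have "eqv (Suc n) \<dots> (\<Sum>i\<in>I. \<Sum>k\<in>ks (br (W i) a). y (((D ^^ k) (U i) * ?c i k) # B))"
    unfolding cl_def by (intro eqv_sum rc_sum_front[OF y l(1)])
  also have "eqv (Suc n) \<dots> (\<Sum>i\<in>I. \<Sum>k\<in>ks (br (W i) a). sg (pr i * e) (exp_act 0 ((D ^^ k) (U i)) (y (?c i k # B)))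
      + sg ((pr i + p) * (pr i + e)) (exp_act 0 (?c i k) ((- mvar 0) ^ k * y (U i # B))))"
  proof (intro eqv_sum)
    fix i k assume i: "i \<in> I"
    have pi: "pr i \<le> 1" "W i \<in> gr (pr i)" "U i \<in> gr (pr i)" using i pr_le W_gr U_gr by auto
    let ?r = "(pr i + p) mod 2"
    have "eqv (Suc n) (y (((D ^^ k) (U i) * ?c i k) # B))
      (sg (pr i * e) (exp_act 0 ((D ^^ k) (U i)) (y (?c i k # B))) + sg (?r * (pr i + e)) (exp_act 0 (?c i k) (y ((D ^^ k) (U i) # B))))"
      using pi a by (intro rc_mult_front[OF y l] D_pow_gr br_parity) auto
    also have "eqv (Suc n) \<dots> (sg (pr i * e) (exp_act 0 ((D ^^ k) (U i)) (y (?c i k # B))) + sg (?r * (pr i + e)) (exp_act 0 (?c i k) ((- mvar 0) ^ k * y (U i # B))))"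
      by (intro eqv_add eqv_refl eqv_sg eqv_exp rc_D_pow_front[OF y l(1)]) simp
    also have "sg (?r * (pr i + e)) (exp_act 0 (?c i k) ((- mvar 0) ^ k * y (U i # B))) =
      sg ((pr i + p) * (pr i + e)) (exp_act 0 (?c i k) ((- mvar 0) ^ k * y (U i # B)))"
      by (rule sg_cong) simp
    finally show "eqv (Suc n) (y (((D ^^ k) (U i) * ?c i k) # B)) (sg (pr i * e) (exp_act 0 ((D ^^ k) (U i)) (y (?c i k # B)))
      + sg ((pr i + p) * (pr i + e)) (exp_act 0 (?c i k) ((- mvar 0) ^ k * y (U i # B))))" .
  qed
  also have "\<dots> = Fe e y B a + J e y B p a"
    by (simp add: Fe_def J_def pe_def sg_sum sum.distrib)
  also have "eqv (Suc n) \<dots> (Fe e y B a + y (a # B))"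
    by (intro eqv_add eqv_refl eqv_sym[OF J_eq[OF y l a]])
  finally have "eqv (Suc n) (y (E a # B) - y (a # B)) (Fe e y B a + y (a # B) - y (a # B))"
    by (intro eqv_diff) auto
  then show ?thesis by (simp add: eqv_sym)
qed

end

text \<open>That the W i also generate makes the exchange of U and W possible. That the U i have
  constant brackets among themselves determines the Euler degree of the bracket.\<close>

locale dual_system = half_dual scale gr D br I U W pr
  for scale :: "'f::field_char_0 \<Rightarrow> 'v::ring_1 \<Rightarrow> 'v"
    and gr :: "nat \<Rightarrow> 'v set" and D :: "'v \<Rightarrow> 'v" and br :: "'v \<Rightarrow> 'v \<Rightarrow> 'v lpoly"
    and I :: "'i set" and U W :: "'i \<Rightarrow> 'v" and pr :: "'i \<Rightarrow> nat" +
  assumes gen_W: "v \<in> span {a. \<exists>p. hgen (\<lambda>p. {W i |i. i \<in> I \<and> pr i = p}) p a}"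
    and br_UU: "i \<in> I \<Longrightarrow> k \<in> I \<Longrightarrow> \<exists>c. br (U i) (U k) = lconst (scale c 1)"
begin

lemma br_skew': "p \<le> 1 \<Longrightarrow> q \<le> 1 \<Longrightarrow> a \<in> gr p \<Longrightarrow> b \<in> gr q \<Longrightarrow> br a b = - sg (p * q) (flip D (br b a))"
  using br_skew[of p q a b] unfolding sg_eq .

lemma br_neg_left: "br (- a) b = - br a b"
  using additive.minus[of "\<lambda>a. br a b"] br_add_left by (auto simp: additive_def)

lemma br_sg_left: "br (sg k a) b = sg k (br a b)"
  by (simp add: sg_def br_neg_left)

text \<open>This is where super-skewsymmetry of the form enters.\<close>

lemma half_dual_swap: "half_dual scale gr D br I W (\<lambda>i. - sg (pr i) (U i)) pr"
proof unfold_locales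
  fix i k assume ik: "i \<in> I" "k \<in> I"
  have "flip D (lconst v) = lconst v" for v by (simp add: flip_single)
  then have "br (U i) (W k) = - sg (pr i * pr k) (lconst (if i = k then 1 else 0))"
    using br_skew'[of "pr i" "pr k" "U i" "W k"] ik pr_le U_gr W_gr br_WU[of k i] by simp
  then show "br (- sg (pr i) (U i)) (W k) = lconst (if i = k then 1 else 0)"
    by (cases "even (pr i)") (auto simp: br_neg_left br_sg_left sg_def)
qed (use finite_I pr_le W_gr U_gr gen_W in \<open>auto intro!: gr_neg gr_sg\<close>)

text \<open>The reconstruction formula for the exchanged system. It is the form in which the
  brackets of an argument with the U i occur in the homotopy formula.\<close>

lemma J_swap:
  assumes y: "rc (Suc n) e y" and l: "length B = n" "hom_list qs B" and a: "p \<le> 1" "a \<in> gr p"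
  shows "eqv (Suc n) (y (a # B))
    (- (\<Sum>i\<in>I. sg (pr i + (pr i + p) * (pr i + e)) (pe (br (U i) a) (y (W i # B)))))"
proof -
  interpret s: half_dual scale gr D br I W "\<lambda>i. - sg (pr i) (U i)" pr by (rule half_dual_swap)
  have "s.J e y B p a = - (\<Sum>i\<in>I. sg (pr i + (pr i + p) * (pr i + e)) (pe (br (U i) a) (y (W i # B))))"
    unfolding s.J_def sum_negf[symmetric]
    by (intro sum.cong refl)
      (simp add: br_neg_left br_sg_left additive.minus[OF additive_pe] sg_additive[OF additive_pe] sg_uminus sg_sg add.commute)
  then show ?thesis using s.J_eq[OF y l a] by simp
qed

lemma pmap_E_add: "pmap E (f + g) = pmap E f + pmap E g"
  by (rule additive.add[OF additive_pmap[OF additive_E]])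

lemma pmap_E_lam: "pmap E (lam * f) = lam * pmap E f"
proof (rule additive_eqI[of "\<lambda>f. pmap E (lam * f)" "\<lambda>f. lam * pmap E f"])
  show "additive (\<lambda>f. pmap E (lam * f))" "additive (\<lambda>f. lam * pmap E f)"
    by (auto intro!: additive.intro simp: algebra_simps pmap_E_add)
qed (simp add: mult_single)

lemma pmap_E_mult_lconst: "pmap E (f * lconst c) = pmap E f * lconst c + f * lconst (E c)"
proof (rule additive_eqI[of "\<lambda>f. pmap E (f * lconst c)" "\<lambda>f. pmap E f * lconst c + f * lconst (E c)"])
  show "additive (\<lambda>f. pmap E (f * lconst c))" "additive (\<lambda>f. pmap E f * lconst c + f * lconst (E c))"
    by (auto intro!: additive.intro simp: algebra_simps pmap_E_add)
qed (simp add: mult_single E_mult single_add)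

lemma pmap_E_lconst_mult: "pmap E (lconst c * f) = lconst (E c) * f + lconst c * pmap E f"
proof (rule additive_eqI[of "\<lambda>f. pmap E (lconst c * f)" "\<lambda>f. lconst (E c) * f + lconst c * pmap E f"])
  show "additive (\<lambda>f. pmap E (lconst c * f))" "additive (\<lambda>f. lconst (E c) * f + lconst c * pmap E f)"
    by (auto intro!: additive.intro simp: algebra_simps pmap_E_add)
qed (simp add: mult_single E_mult single_add)

text \<open>The bracket has Euler degree -2: it removes one generator from each entry.\<close>

definition elaw :: "'v \<Rightarrow> 'v \<Rightarrow> bool" where
  "elaw a b \<longleftrightarrow> pmap E (br a b) = br (E a) b + br a (E b) - br a b - br a b"

text \<open>For fixed a both sides satisfy the same rules in b for D, products and linear
  combinations, so generators decide.\<close>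

lemma elaw_right:
  assumes p: "p \<le> 1" "a \<in> gr p" and base: "\<And>k. k \<in> I \<Longrightarrow> elaw a (U k)"
  shows "elaw a b"
proof (induction b rule: hg_induct)
  case zero then show ?case by (simp add: elaw_def additive.zero[OF additive_pmap[OF additive_E]])
next
  case (hg q b)
  then show ?case
  proof (induction rule: hgen.induct)
    case hgen_one show ?case by (simp add: elaw_def additive.zero[OF additive_pmap[OF additive_E]])
  next
    case (hgen_gen a p) then show ?case using base by auto
  next
    case (hgen_D p b)
    have "pmap E (pmap D f) = pmap D (pmap E f)" for f :: "'v lpoly"
      by (rule pmap_comm_pmap) (auto simp: E_D)
    then show ?case using hgen_D.IH unfolding elaw_def
      by (simp add: E_D br_D_right pmap_E_add pmap_E_lam[unfolded One_nat_def] distrib_left right_diff_distrib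
         additive.add[OF additive_pmap[OF additive_D]] additive.diff[OF additive_pmap[OF additive_D]])
  next
    case (hgen_mult q b r c)
    have h: "q \<le> 1" "b \<in> gr q" using hg_gr[OF hgen_mult(1)] by auto
    have m: "br x (z * w) = br x z * lconst w + sg (p * q) (lconst z * br x w)"
      if "x \<in> gr p" "z \<in> gr q" for x z w
      using br_mult[of p q x z w] that h p by simp
    have Ea: "E a \<in> gr p" "E b \<in> gr q" using E_gr p h by auto
    have "pmap E (br a (b * c)) = pmap E (br a b) * lconst c + br a b * lconst (E c)
       + sg (p * q) (lconst (E b) * br a c + lconst b * pmap E (br a c))"
      using p h by (simp add: m pmap_E_add pmap_E_mult_lconst pmap_E_lconst_mult sg_additive[OF additive_pmap[OF additive_E]])
    also have "\<dots> = br (E a) (b * c) + br a (E (b * c)) - br a (b * c) - br a (b * c)"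
      using hgen_mult(3,4)[unfolded elaw_def] Ea p h
      by (simp add: m E_mult br_add_right sg_add sg_diff distrib_left distrib_right
          left_diff_distrib right_diff_distrib)
    finally show ?case by (simp add: elaw_def)
  qed
next
  case (add x y) then show ?case by (simp add: elaw_def E_add br_add_right pmap_E_add)
next
  case (scale c x)
  have "pmap E (sc c f) = sc c (pmap E f)" for f :: "'v lpoly"
    by (rule pmap_comm_pmap) (auto simp: E_scale)
  then show ?case using scale
    by (simp add: elaw_def E_scale br_scale_right sc_add additive.diff[OF additive_pmap[OF additive_scale]]
        additive.add[OF additive_pmap[OF additive_scale]])
qed

lemma flip_E: "flip D (pmap E f) = pmap E (flip D f)"
proof (rule additive_eqI[of "\<lambda>f. flip D (pmap E f)" "\<lambda>f. pmap E (flip D f)"])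
  show "additive (\<lambda>f. flip D (pmap E f))" "additive (\<lambda>f. pmap E (flip D f))"
    by (auto intro!: additive.intro simp: pmap_E_add flip_add)
  have ED: "pmap E (pmap D f) = pmap D (pmap E f)" for f :: "'v lpoly"
    by (rule pmap_comm_pmap) (auto simp: E_D)
  have "((\<lambda>r. - (lam * r) - pmap D r) ^^ k) (pmap E z) = pmap E (((\<lambda>r. - (lam * r) - pmap D r) ^^ k) z)" for k z
    by (induction k) (auto simp: ED additive.diff[OF additive_pmap[OF additive_E]] additive.minus[OF additive_pmap[OF additive_E]] pmap_E_lam[unfolded One_nat_def])
  from this[of _ "lconst _"] show "flip D (pmap E (sgl k v)) = pmap E (flip D (sgl k v))" for k v
    by (simp add: flip_single)
qed

text \<open>Generators are handled first in both entries, then \<open>elaw_right\<close> frees the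
  second entry, skew-symmetry exchanges the entries, and \<open>elaw_right\<close> frees the second
  one again.\<close>

lemma elaw: "elaw a b"
proof -
  have UU: "elaw (U i) b" if "i \<in> I" for i b
  proof (rule elaw_right)
    show "pr i \<le> 1" "U i \<in> gr (pr i)" using that pr_le U_gr by auto
    fix k assume k: "k \<in> I"
    then obtain c where c: "br (U i) (U k) = lconst (scale c 1)" using br_UU \<open>i \<in> I\<close> by blast
    \<comment> \<open>E kills the constant bracket on the left, and on the right the four terms
      cancel because both generators have degree 1.\<close>
    show "elaw (U i) (U k)" using k that unfolding elaw_def c E_U[OF k] E_U[OF that]
      by (simp add: E_scale)
  qed
  have aU: "elaw a (U k)" if k: "k \<in> I" and p: "p \<le> 1" "a \<in> gr p" for k a p
  proof -
    have pk: "pr k \<le> 1" "U k \<in> gr (pr k)" using k pr_le U_gr by auto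
    have s: "br x (U k) = - sg (p * pr k) (flip D (br (U k) x))" if "x \<in> gr p" for x
      using br_skew'[OF p(1) pk(1) that pk(2)] .
    have "pmap E (br (U k) a) = br (U k) (E a) - br (U k) a"
      using UU[OF k, of a] by (simp add: elaw_def E_U[OF k])
    then have "pmap E (br a (U k)) = - sg (p * pr k) (flip D (br (U k) (E a) - br (U k) a))"
      unfolding s[OF p(2)] by (simp add: additive.minus[OF additive_pmap[OF additive_E]]
         sg_additive[OF additive_pmap[OF additive_E]] flip_E[symmetric])
    also have "\<dots> = br (E a) (U k) - br a (U k)"
      using s[OF p(2)] s[OF E_gr[OF p]] by (simp add: additive.diff[OF additive_flip] sg_diff)
    finally show ?thesis by (simp add: elaw_def E_U[OF k])
  qed
  have h: "elaw a b" if "p \<le> 1" "a \<in> gr p" for p a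
    by (rule elaw_right[OF that aU[OF _ that]])
  show ?thesis
    by (induction a rule: gr_induct) (use h[of 0] h[of 1] in \<open>auto simp: elaw_def E_add br_add_left pmap_E_add algebra_simps\<close>)
qed

lemma br_E: "pmap E (br a b) = br (E a) b + br a (E b) - br a b - br a b"
  using elaw[of a b] by (simp add: elaw_def)

lemma bp_E: assumes "lin n L" shows "Em (bp a L x) = bp (E a) L x + bp a L (Em x) - bp a L x - bp a L x"
proof (induction x rule: mpoly_induct)
  case (const v)
  then show ?case
    by (simp add: bp_mconst pmap_mconst lev_pmap[OF additive_E assms, symmetric] br_E additive.diff[OF additive_lev] lev_add)
next
  case (var i x)
  then show ?case by (simp add: bp_mvar pmap_mvar[OF additive_E] distrib_left right_diff_distrib)
next
  case (add x y)
  then show ?case by (simp add: bp_add pmap_E_add)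
qed

section \<open>Annihilating polynomials of the Euler derivation\<close>

text \<open>A polynomial in E, encoded by the list of its roots; natural numbers suffice because
  these are the degrees of monomials.\<close>

fun kv :: "nat list \<Rightarrow> 'v \<Rightarrow> 'v" where
  "kv [] v = v"
| "kv (m # ms) v = kv ms (E v - scale (of_nat m) v)"

lemma kv_add: "kv ms (v + w) = kv ms v + kv ms w"
proof (induction ms arbitrary: v w)
  case (Cons m ms)
  have "E (v + w) - scale (of_nat m) (v + w) = (E v - scale (of_nat m) v) + (E w - scale (of_nat m) w)"
    by (simp add: E_add scale_right_distrib)
  then show ?case using Cons by simp
qed simp
lemma additive_kv: "additive (kv ms)" by standard (rule kv_add)
lemma kv_scale: "kv ms (scale c v) = scale c (kv ms v)"
proof (induction ms arbitrary: v)
  case (Cons m ms)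
  have "E (scale c v) - scale (of_nat m) (scale c v) = scale c (E v - scale (of_nat m) v)"
    by (simp add: E_scale scale_right_diff_distrib mult.commute)
  then show ?case using Cons by simp
qed simp
lemma kv_D: "kv ms (D v) = D (kv ms v)"
proof (induction ms arbitrary: v)
  case (Cons m ms)
  have "E (D v) - scale (of_nat m) (D v) = D (E v - scale (of_nat m) v)"
    by (simp add: E_D D_scale additive.diff[OF additive_D])
  then show ?case using Cons by simp
qed simp
lemma kv_append: "kv (ms @ ns) v = kv ns (kv ms v)"
  by (induction ms arbitrary: v) auto
lemma kv_eigen: "E v = scale d v \<Longrightarrow> kv ms v = scale (prod_list (map (\<lambda>m. d - of_nat m) ms)) v"
proof (induction ms)
  case (Cons m ms)
  have "E v - scale (of_nat m) v = scale (d - of_nat m) v"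
    using Cons.prems by (simp add: scale_left_diff_distrib)
  then show ?case using Cons by (simp add: kv_scale)
qed simp

lemma kv_mono:
  assumes "kv [m..<M] v = 0" "m \<le> M" "M \<le> M'" shows "kv [m..<M'] v = 0"
proof -
  have "[m..<M'] = [m..<M] @ [M..<M']" using assms by (metis le_add_diff_inverse upt_add_eq_append)
  then show ?thesis using assms(1) by (simp add: kv_append additive.zero[OF additive_kv])
qed

lemma kv_eigen_zero: "E v = scale (of_nat d) v \<Longrightarrow> m \<le> d \<Longrightarrow> d < M \<Longrightarrow> kv [m..<M] v = 0"
  by (subst kv_eigen) (auto simp: prod_list_zero_iff image_iff intro!: bexI[of _ d])

lemma kv_exists: "\<exists>M. kv [0..<M] v = 0"
proof (induction v rule: hg_induct)
  case zero then show ?case by (simp add: additive.zero[OF additive_kv])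
next
  case (hg p a)
  then obtain d :: nat where "E a = scale (of_nat d) a" using hg_degree by blast
  then have "kv [0..<Suc d] a = 0" by (intro kv_eigen_zero[of _ d]) auto
  then show ?case by blast
next
  case (add x y)
  then obtain M N where "kv [0..<M] x = 0" "kv [0..<N] y = 0" by blast
  then have "kv [0..<max M N] x = 0" "kv [0..<max M N] y = 0"
    using kv_mono[of 0 M x "max M N"] kv_mono[of 0 N y "max M N"] by auto
  then have "kv [0..<max M N] (x + y) = 0" by (simp add: kv_add)
  then show ?case by blast
next
  case (scale c x) then show ?case by (metis kv_scale scale_zero_right)
qed

text \<open>The constant term is split off. The rest has positive degrees only, so it is annihilated
  by a polynomial whose constant term is not 0.\<close>

lemma kv_exists_const: "\<exists>c v' M. v = scale c 1 + v' \<and> M \<ge> 1 \<and> kv [1..<M] v' = 0"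
proof (induction v rule: hg_induct)
  case zero then show ?case by (intro exI[of _ 0] exI[of _ 1]) (auto simp: additive.zero[OF additive_kv])
next
  case (hg p a)
  then obtain d :: nat where d: "E a = scale (of_nat d) a" "d = 0 \<longrightarrow> a = 0 \<or> a = 1" using hg_degree by blast
  show ?case
  proof (cases "d = 0")
    case True
    then have "a = scale 0 1 + 0 \<or> a = scale 1 1 + 0" using d by simp
    then show ?thesis by (metis additive.zero[OF additive_kv] order_refl)
  next
    case False
    then have "kv [1..<Suc d] a = 0" using d(1) by (intro kv_eigen_zero[of _ d]) auto
    then show ?thesis using False by (intro exI[of _ 0] exI[of _ a] exI[of _ "Suc d"]) auto
  qed
next
  case (add x y)
  then obtain c x' M d y' N where a: "x = scale c 1 + x'" "M \<ge> 1" "kv [1..<M] x' = 0"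
    "y = scale d 1 + y'" "N \<ge> 1" "kv [1..<N] y' = 0" by blast
  then have "kv [1..<max M N] x' = 0" "kv [1..<max M N] y' = 0"
    using kv_mono[of 1 M x' "max M N"] kv_mono[of 1 N y' "max M N"] by auto
  then have "kv [1..<max M N] (x' + y') = 0" by (simp add: kv_add)
  moreover have "x + y = scale (c + d) 1 + (x' + y')" using a by (simp add: scale_left_distrib)
  ultimately show ?case using a(2) by (metis max.coboundedI1)
next
  case (scale t x)
  then obtain c x' M where a: "x = scale c 1 + x'" "M \<ge> 1" "kv [1..<M] x' = 0" by blast
  then have "scale t x = scale (t * c) 1 + scale t x'" "kv [1..<M] (scale t x') = 0"
    by (auto simp: scale_right_distrib kv_scale)
  then show ?case using a(2) by blast
qed

text \<open>A polynomial in E with roots 1, ..., M - 1 kills the part of x of positive degree and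
  commutes with D, but acts on 1 by the nonzero product of the numbers -m.\<close>

lemma one_not_total_derivative: "D x \<noteq> 1"
proof
  assume x: "D x = 1"
  obtain c x' M where a: "x = scale c 1 + x'" "M \<ge> 1" "kv [1..<M] x' = 0" using kv_exists_const by blast
  have "D x = D x'" using a(1) by (simp add: D_add D_scale)
  then have "kv [1..<M] 1 = 0" using x a(3) by (metis kv_D D_0)
  moreover have "kv [1..<M] 1 = scale (prod_list (map (\<lambda>m. 0 - of_nat m) [1..<M])) 1"
    by (rule kv_eigen) simp
  moreover have "prod_list (map (\<lambda>m. 0 - of_nat m :: 'f) [1..<M]) \<noteq> 0"
    by (auto simp: prod_list_zero_iff)
  ultimately show False by simp
qed

lemma E_exact:
  assumes "E m = D x" shows "\<exists>c z. m = scale c 1 + D z"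
proof -
  \<comment> \<open>The roots are removed one at a time. If E m - k m and E m are total derivatives,
    so is k m, and k is invertible.\<close>
  have *: "m \<in> range D" if "kv ms m \<in> range D" "E m \<in> range D" "0 \<notin> set ms" for ms m
    using that
  proof (induction ms arbitrary: m)
    case (Cons k ms)
    obtain x where x: "E m = D x" using Cons.prems by auto
    have "E (E m - scale (of_nat k) m) = D (E x - scale (of_nat k) x)"
      using x by (simp add: additive.diff[OF additive_E] E_scale E_D additive.diff[OF additive_D] D_scale)
    then have "E (E m - scale (of_nat k) m) \<in> range D" by blast
    moreover have "kv ms (E m - scale (of_nat k) m) \<in> range D" "0 \<notin> set ms" using Cons.prems by simp_all
    ultimately have "E m - scale (of_nat k) m \<in> range D"
      using Cons.IH[of "E m - scale (of_nat k) m"] by blast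
    then obtain z where z: "E m - scale (of_nat k) m = D z" by auto
    have "scale (of_nat k) m = D (x - z)" using x z by (simp add: additive.diff[OF additive_D] algebra_simps)
    then have "scale (inverse (of_nat k)) (scale (of_nat k) m) = D (scale (inverse (of_nat k)) (x - z))"
      by (simp add: D_scale)
    moreover have "of_nat k \<noteq> (0::'f)" using Cons.prems by auto
    ultimately have "m = D (scale (inverse (of_nat k)) (x - z))" by simp
    then show ?case by blast
  qed simp
  obtain c m' M where a: "m = scale c 1 + m'" "M \<ge> 1" "kv [1..<M] m' = 0" using kv_exists_const by blast
  have "E m' = D x" using assms a(1) by (simp add: E_add E_scale)
  moreover have "kv [1..<M] m' \<in> range D" using a(3) by (metis D_0 rangeI)
  ultimately have "m' \<in> range D" using *[of "[1..<M]" m'] by auto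
  then show ?thesis using a(1) by blast
qed

end

section \<open>Omitted and exchanged slots, and the compatibility of contraction with other
  operations\<close>

lemma sum_skip:
  assumes "i \<le> n" shows "(\<Sum>k<Suc n. f k) = f i + (\<Sum>k<n. f (skip i k) :: 'a::comm_monoid_add)"
proof -
  have "(\<Sum>k<Suc n. f k) = f i + (\<Sum>k\<in>{..<Suc n} - {i}. f k)"
    using assms by (subst sum.remove[of _ i]) auto
  also have "(\<Sum>k\<in>{..<Suc n} - {i}. f k) = (\<Sum>k<n. f (skip i k))"
  proof (rule sum.reindex_bij_witness[of _ "skip i" "\<lambda>k. if k < i then k else k - 1"])
    fix a assume a: "a \<in> {..<Suc n} - {i}"
    show "skip i (if a < i then a else a - 1) = a" using a by (auto simp: skip_def)
    show "(if a < i then a else a - 1) \<in> {..<n}" using a assms by auto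
    then show "f (skip i (if a < i then a else a - 1)) = f a"
      using \<open>skip i (if a < i then a else a - 1) = a\<close> by simp
  qed (auto simp: skip_def)
  finally show ?thesis .
qed

lemma omit_update_skip:
  assumes "i < length xs" "k < length xs - 1"
  shows "omit i (xs[skip i k := x]) = (omit i xs)[k := x]"
  using assms by (intro nth_equalityI) (auto simp: length_omit nth_omit nth_list_update skip_def)

definition adj :: "nat \<Rightarrow> nat \<Rightarrow> nat" where
  "adj i k = (if k = i then Suc i else if k = Suc i then i else k)"

lemma swap_adj_update:
  assumes "Suc i < length xs" "k < length xs"
  shows "(swap_adj i xs)[k := f (swap_adj i xs ! k)] =
    swap_adj i (xs[adj i k := f (xs ! adj i k)])"
  using assms by (intro nth_equalityI) (auto simp: nth_swap_adj nth_list_update adj_def)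

context poisson_vertex_superalgebra begin

lemma sg_plus_1: "sg (k + 1) x = - sg k x" by (simp add: sg_def)

lemma mpolys_sg: "x \<in> mpolys n \<Longrightarrow> sg k x \<in> mpolys n" for x :: "'v mpoly" by (simp add: sg_def)

text \<open>The homotopy takes e to e + 1 as a natural number; this lemma and the next bring 2 back
  to 0.\<close>

lemma rc_parity_cong: "even e = even e' \<Longrightarrow> rc n e y = rc n e' y"
proof -
  assume e: "even e = even e'"
  have "sg (p * (e + s)) x = sg (p * (e' + s)) x" for p s and x :: "'v mpoly"
    using e by (intro sg_cong) simp
  moreover have "sg (q * (p + (e + s))) x = sg (q * (p + (e' + s))) x" for p q s and x :: "'v mpoly"
    using e by (intro sg_cong) simp
  moreover have "(e + s) mod 2 = (e' + s) mod 2" for s using e by (auto simp: mod2_eq_if)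
  ultimately show ?thesis unfolding rc_def by simp
qed

lemma dF_parity_cong: "even e = even e' \<Longrightarrow> dF e y ps as = dF e' y ps as"
proof -
  assume e: "even e = even e'"
  have "sg (s1 e ps i) x = sg (s1 e' ps i) x" for i and x :: "'v mpoly"
    unfolding s1_def using e by (intro sg_cong) simp
  moreover have "sg (s2 e ps i j) x = sg (s2 e' ps i j) x" for i j and x :: "'v mpoly"
    unfolding s2_def using e by (intro sg_cong) simp
  ultimately show ?thesis by (simp add: dF_def)
qed

lemma homp_contr:
  assumes "p \<le> 1" "q \<le> 1" "w \<in> gr q" "homp p x" shows "homp ((q + p) mod 2) (contr w x)"
  unfolding contr_def
proof (rule homp_sum)
  fix m assume "m \<in> ks x"
  have "(D ^^ k) w * lk x m \<in> gr ((q + p) mod 2)" for k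
    using assms D_pow_gr by (intro gr_mult) (auto simp: homp_def)
  then show "homp ((q + p) mod 2) (mconst ((D ^^ lk m 0) w) * sgl (Poly_Mapping.map_key Suc m) (lk x m))"
    by (auto simp: mult_single homp_def lookup_single when_def)
qed simp

lemma hasp_contr: "p \<le> 1 \<Longrightarrow> q \<le> 1 \<Longrightarrow> w \<in> gr q \<Longrightarrow> hasp (Suc n) p x \<Longrightarrow> hasp n ((q + p) mod 2) (contr w x)"
  unfolding hasp_def by (meson eqv_contr homp_contr)

text \<open>Contraction consumes the variable 0 and renumbers the others. It therefore commutes with
  a substitution that fixes this variable, where \<open>Ls\<close> is what remains of
  \<open>Ks\<close> after renumbering, as the last hypothesis says.\<close>

lemma contr_msubst:
  assumes "x \<in> mpolys (Suc n)" "length Ls = n" "length Ks = Suc n" "Ks ! 0 = mvar 0"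
    "\<And>L. L \<in> set Ls \<Longrightarrow> lin m L" "\<And>K. K \<in> set Ks \<Longrightarrow> lin m' K"
    "\<And>k w z. k < n \<Longrightarrow> contr w (Ks ! Suc k * z) = Ls ! k * contr w z"
  shows "contr w (msubst Ks x) = msubst Ls (contr w x)"
  using assms(1)
proof (induction arbitrary: w rule: mpolys_induct)
  case (const v) then show ?case by (simp add: contr_mconst)
next
  case (var i x)
  then have K: "msubst Ks (mvar i * x) = Ks ! i * msubst Ks x"
    using assms(3,6) by (intro msubst_mvar_lin[of _ _ m']) auto
  show ?case
  proof (cases i)
    case 0
    then show ?thesis using K var.IH assms(4) by (simp add: contr_rules)
  next
    case (Suc k)
    then have "k < n" using var(1) by simp
    then have "msubst Ls (mvar k * z) = Ls ! k * msubst Ls z" for z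
      using assms(2,5) by (intro msubst_mvar_lin[of _ _ m]) auto
    then show ?thesis using K Suc var.IH assms(7)[OF \<open>k < n\<close>] by (simp add: contr_rules)
  qed
qed (simp add: msubst_add contr_add)

text \<open>The exponential concerns a variable that contraction only renumbers, so the only effect
  is the exchange of b and w in front of the coefficients.\<close>

lemma contr_exp:
  assumes "p \<le> 1" "q \<le> 1" "w \<in> gr p" "b \<in> gr q"
  shows "contr w (exp_act (Suc k) b x) = sg (p * q) (exp_act k b (contr w x))"
  using assms(3,4)
proof (induction x arbitrary: w b rule: mpoly_induct)
  case (const v)
  have "w * b = sg (p * q) (b * w)" using supercommute[of p q w b] assms const unfolding sg_eq by blast
  then show ?case by (simp add: exp_act_mconst contr_mconst mult.assoc[symmetric] sg_mult_left) (simp add: sg_def single_uminus mult.assoc)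
next
  case (var i x)
  have "D w \<in> gr p" "D b \<in> gr q" using var assms D_even by auto
  then show ?case using var
    by (cases "i = Suc k"; cases i) (auto simp: exp_rules contr_rules sg_add sg_mult_right)
next
  case (add x y) then show ?case by (simp add: exp_act_add contr_add sg_add)
qed

end

context dual_system begin

section \<open>The homotopy operator\<close>

text \<open>The sign is that of \<gamma>_0 for W i in front: for dY, whose parity is e + 1, the two
  cancel, so that the terms in which W i acts add up to E with a plus sign.\<close>

definition hop :: "nat \<Rightarrow> ('v list \<Rightarrow> 'v mpoly) \<Rightarrow> 'v list \<Rightarrow> 'v mpoly" where
  "hop e y bs = (\<Sum>i\<in>I. - sg (e * opp (pr i)) (contr (U i) (y (W i # bs))))"

lemma eqv_hop_sum:
  assumes "\<And>i. i \<in> I \<Longrightarrow> eqv (Suc n) (f i) (g i)"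
  shows "eqv n (\<Sum>i\<in>I. - sg (k i) (contr (U i) (f i))) (\<Sum>i\<in>I. - sg (k i) (contr (U i) (g i)))"
  by (intro eqv_sum eqv_minus eqv_sg eqv_contr assms)

text \<open>Contraction fills the first slot, so the conditions on hY at slot i come from those on Y
  at slot i + 1. The parity changes because W i enters with its opposite parity and U i with its
  parity, and these add up to 1.\<close>

lemma rc_hop:
  assumes y: "rc (Suc n) e y" shows "rc n (e + 1) (hop e y)"
proof (rule rcI)
  fix as :: "'v list" and i :: nat and a b :: 'v and c :: 'f and ps assume l: "length as = n"
  show "hop e y as \<in> mpolys n"
    unfolding hop_def using l by (intro mpolys_sum mpolys_uminus mpolys_sg contr_mpolys rc_mpolys[OF y]) simp
  {
    assume i: "i < n"
    have "eqv n (hop e y (as[i := a + b])) (\<Sum>k\<in>I. - sg (e * opp (pr k)) (contr (U k) (y (W k # as[i := a]) + y (W k # as[i := b]))))"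
      unfolding hop_def using rc_add[OF y, of "W _ # as" "Suc i"] l i by (intro eqv_hop_sum) simp
    then show "eqv n (hop e y (as[i := a + b])) (hop e y (as[i := a]) + hop e y (as[i := b]))"
      by (simp add: hop_def contr_add sg_add sum.distrib[symmetric] add.commute)
    have "eqv n (hop e y (as[i := scale c a])) (\<Sum>k\<in>I. - sg (e * opp (pr k)) (contr (U k) (sc c (y (W k # as[i := a])))))"
      unfolding hop_def using rc_scale[OF y, of "W _ # as" "Suc i"] l i by (intro eqv_hop_sum) simp
    then show "eqv n (hop e y (as[i := scale c a])) (sc c (hop e y (as[i := a])))"
      by (simp add: hop_def contr_sc additive.sum[OF additive_sc] additive.minus[OF additive_sc] sg_additive[OF additive_sc])
    have "eqv n (hop e y (as[i := D (as ! i)])) (\<Sum>k\<in>I. - sg (e * opp (pr k)) (contr (U k) (- (mvar (Suc i) * y (W k # as)))))"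
      unfolding hop_def using rc_sesq[OF y, of "W _ # as" "Suc i"] l i by (intro eqv_hop_sum) simp
    then show "eqv n (hop e y (as[i := D (as ! i)])) (- (mvar i * hop e y as))"
      by (simp add: hop_def contr_rules additive.minus[OF additive_contr] sg_uminus sum_distrib_left sg_mult_right sum_negf)
  }
  assume h: "hom_list ps as"
  have "hasp n (opp ((e + 1 + (\<Sum>i<n. opp (ps ! i))) mod 2)) (hop e y as)"
    unfolding hop_def
  proof (rule hasp_sum)
    fix k assume k: "k \<in> I"
    let ?S = "\<Sum>i<n. opp (ps ! i)"
    have pk: "pr k \<le> 1" "W k \<in> gr (pr k)" "U k \<in> gr (pr k)" using k pr_le W_gr U_gr by auto
    have "(\<Sum>i<Suc n. opp ((pr k # ps) ! i)) = opp (pr k) + ?S"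
      by (subst sum.lessThan_Suc_shift) simp
    then have "hasp (Suc n) (opp ((e + (opp (pr k) + ?S)) mod 2)) (y (W k # as))"
      using rc_hasp[OF y, of "W k # as" "pr k # ps"] l h pk by simp
    from hasp_contr[OF _ pk(1,3) this]
    have "hasp n ((pr k + opp ((e + (opp (pr k) + ?S)) mod 2)) mod 2) (contr (U k) (y (W k # as)))" by simp
    moreover have "(pr k + opp ((e + (opp (pr k) + ?S)) mod 2)) mod 2 = opp ((e + 1 + ?S) mod 2)"
      using pk(1) by (cases "pr k = 0") (auto simp: le_Suc_eq mod2_eq_if)
    ultimately have "hasp n (opp ((e + 1 + ?S) mod 2)) (contr (U k) (y (W k # as)))" by (simp only:)
    then have "hasp n (opp ((e + 1 + ?S) mod 2)) (sg (e * opp (pr k) + 1) (contr (U k) (y (W k # as))))"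
      by (rule hasp_sg[rotated]) simp
    then show "hasp n (opp ((e + 1 + ?S) mod 2)) (- sg (e * opp (pr k)) (contr (U k) (y (W k # as))))"
      by (simp only: sg_plus_1)
  qed simp
  then show "\<exists>x. eqv n x (hop e y as) \<and> homp (opp ((e + 1 + (\<Sum>i<n. opp (ps ! i))) mod 2)) x"
    by (simp add: hasp_def)
  {
    assume i: "Suc i < n"
    have "msubst (swap_adj i (vars n)) (hop e y (swap_adj i as)) =
      (\<Sum>k\<in>I. - sg (e * opp (pr k)) (contr (U k) (msubst (swap_adj (Suc i) (vars (Suc n))) (y (W k # swap_adj i as)))))"
    proof -
      have m: "y (W k # swap_adj i as) \<in> mpolys (Suc n)" for k using l by (intro rc_mpolys[OF y]) simp
      have "contr w (msubst (swap_adj (Suc i) (vars (Suc n))) x) = msubst (swap_adj i (vars n)) (contr w x)"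
        if "x \<in> mpolys (Suc n)" for w x
      proof (rule contr_msubst[OF that])
        show "\<And>L. L \<in> set (swap_adj i (vars n) :: 'v mpoly list) \<Longrightarrow> lin n L" using swap_vars[OF i] by auto
        show "\<And>L. L \<in> set (swap_adj (Suc i) (vars (Suc n)) :: 'v mpoly list) \<Longrightarrow> lin (Suc n) L"
          using swap_vars[of "Suc i" "Suc n"] i by auto
      qed (use i in \<open>auto simp: nth_swap_adj contr_rules simp del: upt_Suc\<close>)
      then show ?thesis
        by (simp add: hop_def additive.sum[OF additive_msubst] additive.minus[OF additive_msubst] sg_additive[OF additive_msubst] m)
    qed
    also have "eqv n \<dots> (\<Sum>k\<in>I. - sg (e * opp (pr k)) (contr (U k) (sg (opp (ps ! i) * opp (ps ! Suc i)) (y (W k # as)))))"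
    proof (rule eqv_hop_sum)
      fix k assume "k \<in> I"
      then show "eqv (Suc n) (msubst (swap_adj (Suc i) (vars (Suc n))) (y (W k # swap_adj i as))) (sg (opp (ps ! i) * opp (ps ! Suc i)) (y (W k # as)))"
        using rc_sym[OF y, of "W k # as" "pr k # ps" "Suc i"] l h i pr_le W_gr by simp
    qed
    also have "\<dots> = sg (opp (ps ! i) * opp (ps ! Suc i)) (hop e y as)"
      by (simp add: hop_def sg_sum sg_uminus sg_additive[OF additive_contr] sg_sg add.commute)
    finally show "eqv n (msubst (swap_adj i (vars n)) (hop e y (swap_adj i as))) (sg (opp (ps ! i) * opp (ps ! Suc i)) (hop e y as))" .
  }
  fix p q :: nat and b c :: 'v
  assume a: "i < n" "p \<le> 1" "q \<le> 1" "b \<in> gr p" "c \<in> gr q"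
  let ?S = "\<Sum>k<i. opp (ps ! k)"
  have "eqv n (hop e y (as[i := b * c])) (\<Sum>k\<in>I. - sg (e * opp (pr k)) (contr (U k)
     (sg (p * (e + (opp (pr k) + ?S))) (exp_act (Suc i) b (y (W k # as[i := c])))
      + sg (q * (p + (e + (opp (pr k) + ?S)))) (exp_act (Suc i) c (y (W k # as[i := b]))))))"
    unfolding hop_def
  proof (rule eqv_hop_sum)
    fix k assume k: "k \<in> I"
    have "(\<Sum>j<Suc i. opp ((pr k # ps) ! j)) = opp (pr k) + ?S"
      by (subst sum.lessThan_Suc_shift) simp
    then show "eqv (Suc n) (y (W k # as[i := b * c])) (sg (p * (e + (opp (pr k) + ?S))) (exp_act (Suc i) b (y (W k # as[i := c])))
      + sg (q * (p + (e + (opp (pr k) + ?S)))) (exp_act (Suc i) c (y (W k # as[i := b]))))"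
      using rc_leibniz[OF y, of "W k # as" "pr k # ps" "Suc i" p q b c] l h a pr_le[OF k] W_gr[OF k] by simp
  qed
  also have "\<dots> = (\<Sum>k\<in>I. sg (p * (e + 1 + ?S)) (exp_act i b (- sg (e * opp (pr k)) (contr (U k) (y (W k # as[i := c])))))
      + sg (q * (p + (e + 1 + ?S))) (exp_act i c (- sg (e * opp (pr k)) (contr (U k) (y (W k # as[i := b]))))))"
  proof (rule sum.cong[OF refl])
    fix k assume k: "k \<in> I"
    have pk: "pr k \<le> 1" "U k \<in> gr (pr k)" using k pr_le U_gr by auto
    \<comment> \<open>The extra slot contributes \<open>opp (pr k)\<close> and passing U k across b
      contributes \<open>pr k\<close>; together they account for the change from e to e + 1.\<close>
    have 1: "even (p * (e + (opp (pr k) + ?S)) + pr k * p) = even (p * (e + 1 + ?S))"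
      and 2: "even (q * (p + (e + (opp (pr k) + ?S))) + pr k * q) = even (q * (p + (e + 1 + ?S)))"
      using opp_mod2[OF pk(1)] by auto
    have "contr (U k) (sg (p * (e + (opp (pr k) + ?S))) (exp_act (Suc i) b (y (W k # as[i := c])))
      + sg (q * (p + (e + (opp (pr k) + ?S)))) (exp_act (Suc i) c (y (W k # as[i := b]))))
     = sg (p * (e + 1 + ?S)) (exp_act i b (contr (U k) (y (W k # as[i := c]))))
      + sg (q * (p + (e + 1 + ?S))) (exp_act i c (contr (U k) (y (W k # as[i := b]))))"
      using contr_exp[OF pk(1) a(2) pk(2) a(4)] contr_exp[OF pk(1) a(3) pk(2) a(5)]
      by (simp add: contr_add sg_additive[OF additive_contr] sg_sg sg_cong[OF 1, simplified] sg_cong[OF 2, simplified])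
    then show "- sg (e * opp (pr k)) (contr (U k) (sg (p * (e + (opp (pr k) + ?S))) (exp_act (Suc i) b (y (W k # as[i := c])))
      + sg (q * (p + (e + (opp (pr k) + ?S)))) (exp_act (Suc i) c (y (W k # as[i := b])))))
      = sg (p * (e + 1 + ?S)) (exp_act i b (- sg (e * opp (pr k)) (contr (U k) (y (W k # as[i := c])))))
      + sg (q * (p + (e + 1 + ?S))) (exp_act i c (- sg (e * opp (pr k)) (contr (U k) (y (W k # as[i := b])))))"
      by (simp only: sg_add additive.minus[OF additive_exp_act] sg_additive[OF additive_exp_act] sg_uminus sg_sg
          add.commute[of "e * opp (pr k)"] minus_add_distrib)
  qed
  also have "\<dots> = sg (p * (e + 1 + ?S)) (exp_act i b (hop e y (as[i := c])))
      + sg (q * (p + (e + 1 + ?S))) (exp_act i c (hop e y (as[i := b])))"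
    unfolding hop_def additive.sum[OF additive_exp_act] sg_sum sum.distrib ..
  finally show "eqv n (hop e y (as[i := b * c])) (sg (p * (e + 1 + ?S)) (exp_act i b (hop e y (as[i := c])))
      + sg (q * (p + (e + 1 + ?S))) (exp_act i c (hop e y (as[i := b]))))" .
qed

section \<open>The degree operator\<close>

definition Lop :: "('v list \<Rightarrow> 'v mpoly) \<Rightarrow> 'v list \<Rightarrow> 'v mpoly" where
  "Lop y as = Em (y as) - (\<Sum>k<length as. y (as[k := E (as ! k)]))"

lemma E_slot:
  "i < length as \<Longrightarrow> k < length as \<Longrightarrow> (as[i := x])[k := E (as[i := x] ! k)] =
    (if k = i then as[i := E x] else (as[k := E (as ! k)])[i := x])"
  by (auto simp: list_update_swap)

lemma Em_add: "Em (x + y) = Em x + Em y" for x y :: "'v mpoly" by (rule pmap_E_add)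
lemma additive_Em: "additive (Em :: 'v mpoly \<Rightarrow> 'v mpoly)" by standard (rule Em_add)
lemma eqv_Em: "eqv n x y \<Longrightarrow> eqv n (Em x) (Em y)"
  by (rule eqv_pmap) (auto simp: additive_E E_D)
lemma Em_mvar: "Em (mvar i * x) = mvar i * Em x" by (rule pmap_mvar[OF additive_E])

lemma Em_sc: "Em (sc c x) = sc c (Em x)" for x :: "'v mpoly"
  by (rule pmap_comm_pmap) (auto simp: E_scale)

lemma Em_exp: "Em (exp_act i b x) = exp_act i (E b) x + exp_act i b (Em x)"
proof (induction x arbitrary: b rule: mpoly_induct)
  case (const v)
  then show ?case by (simp add: exp_act_mconst pmap_mconst E_mult single_add)
next
  case (var k x)
  then show ?case by (cases "k = i") (simp_all add: exp_rules Em_add Em_mvar E_D distrib_left)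
next
  case (add x y) then show ?case by (simp add: exp_act_add Em_add)
qed

lemma hasp_Em:
  assumes "p \<le> 1" "hasp n p x" shows "hasp n p (Em x)"
proof -
  obtain x' where x: "eqv n x' x" "homp p x'" using assms by (auto simp: hasp_def)
  have "homp p (Em x')" using x(2) assms(1) by (auto simp: homp_def lookup_pmap intro: E_gr)
  then show ?thesis using eqv_Em[OF x(1)] by (auto simp: hasp_def)
qed

lemma hom_list_E: "hom_list ps as \<Longrightarrow> k < length as \<Longrightarrow> hom_list ps (as[k := E (as ! k)])"
  using hom_list_nth[of ps as k] by (intro hom_list_update_same) (auto intro: E_gr)

lemma hasp_diff: "p \<le> 1 \<Longrightarrow> hasp n p x \<Longrightarrow> hasp n p y \<Longrightarrow> hasp n p (x - y)"
  using hasp_add[of p n x "- y"] hasp_sg[of p n y 1] by (simp add: sg_def)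

text \<open>E is an even derivation commuting with D, so its action on cochains preserves each
  condition. The slot where the condition is tested is treated apart from the others.\<close>

lemma rc_Lop:
  assumes y: "rc n e y" shows "rc n e (Lop y)"
proof (rule rcI)
  fix as :: "'v list" and i :: nat and a b :: 'v and c :: 'f and ps assume l: "length as = n"
  have lk: "length (as[k := E (as ! k)]) = n" for k using l by simp
  show "Lop y as \<in> mpolys n"
    unfolding Lop_def using l by (intro mpolys_diff mpolys_pmap mpolys_sum rc_mpolys[OF y]) simp_all
  {
    assume i: "i < n"
    have "eqv n (Lop y (as[i := a + b])) ((Em (y (as[i := a])) + Em (y (as[i := b])))
       - (\<Sum>k<n. y ((as[i := a])[k := E (as[i := a] ! k)]) + y ((as[i := b])[k := E (as[i := b] ! k)])))"
      unfolding Lop_def length_list_update l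
    proof (intro eqv_diff eqv_sum)
      show "eqv n (Em (y (as[i := a + b]))) (Em (y (as[i := a])) + Em (y (as[i := b])))"
        unfolding Em_add[symmetric] by (intro eqv_Em rc_add[OF y l i])
      fix k assume "k \<in> {..<n}"
      then have k: "k < n" by simp
      show "eqv n (y ((as[i := a + b])[k := E (as[i := a + b] ! k)]))
         (y ((as[i := a])[k := E (as[i := a] ! k)]) + y ((as[i := b])[k := E (as[i := b] ! k)]))"
        using rc_add[OF y l i] rc_add[OF y lk i] i k l by (simp add: E_slot E_add)
    qed
    then show "eqv n (Lop y (as[i := a + b])) (Lop y (as[i := a]) + Lop y (as[i := b]))"
      by (simp add: Lop_def l sum.distrib algebra_simps)
    have "eqv n (Lop y (as[i := scale c a])) (sc c (Em (y (as[i := a])))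
       - (\<Sum>k<n. sc c (y ((as[i := a])[k := E (as[i := a] ! k)]))))"
      unfolding Lop_def length_list_update l
    proof (intro eqv_diff eqv_sum)
      show "eqv n (Em (y (as[i := scale c a]))) (sc c (Em (y (as[i := a]))))"
        unfolding Em_sc[symmetric] by (intro eqv_Em rc_scale[OF y l i])
      fix k assume "k \<in> {..<n}"
      then have k: "k < n" by simp
      show "eqv n (y ((as[i := scale c a])[k := E (as[i := scale c a] ! k)]))
         (sc c (y ((as[i := a])[k := E (as[i := a] ! k)])))"
        using rc_scale[OF y l i] rc_scale[OF y lk i] i k l by (simp add: E_slot E_scale)
    qed
    then show "eqv n (Lop y (as[i := scale c a])) (sc c (Lop y (as[i := a])))"
      by (simp add: Lop_def l additive.sum[OF additive_sc] additive.diff[OF additive_sc])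
    have "eqv n (Lop y (as[i := D (as ! i)])) (- (mvar i * Em (y as))
       - (\<Sum>k<n. - (mvar i * y (as[k := E (as ! k)]))))"
      unfolding Lop_def length_list_update l
    proof (intro eqv_diff eqv_sum)
      have "Em (- (mvar i * y as)) = - (mvar i * Em (y as))"
        by (simp add: additive.minus[OF additive_Em] Em_mvar)
      then show "eqv n (Em (y (as[i := D (as ! i)]))) (- (mvar i * Em (y as)))"
        using eqv_Em[OF rc_sesq[OF y l i]] by simp
      fix k assume "k \<in> {..<n}"
      then have k: "k < n" by simp
      show "eqv n (y ((as[i := D (as ! i)])[k := E (as[i := D (as ! i)] ! k)])) (- (mvar i * y (as[k := E (as ! k)])))"
        using rc_sesq[OF y lk i, of k] i k l
        by (cases "k = i") (simp_all add: E_slot E_D list_update_swap[of i k])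
    qed
    then show "eqv n (Lop y (as[i := D (as ! i)])) (- (mvar i * Lop y as))"
      by (simp add: Lop_def l sum_negf sum_distrib_left right_diff_distrib)
  }
  assume h: "hom_list ps as"
  have "hasp n (opp ((e + (\<Sum>i<n. opp (ps ! i))) mod 2)) (Lop y as)"
    unfolding Lop_def l
    by (intro hasp_diff hasp_sum hasp_Em rc_hasp[OF y] hom_list_E h) (use l in auto)
  then show "\<exists>x. eqv n x (Lop y as) \<and> homp (opp ((e + (\<Sum>i<n. opp (ps ! i))) mod 2)) x"
    by (simp add: hasp_def)
  {
    assume i: "Suc i < n"
    let ?w = "swap_adj i (vars n) :: 'v mpoly list" let ?s = "opp (ps ! i) * opp (ps ! Suc i)"
    have m: "y (swap_adj i as) \<in> mpolys n" using l by (intro rc_mpolys[OF y]) simp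
    have "(\<Sum>k<n. y ((swap_adj i as)[k := E (swap_adj i as ! k)])) =
        (\<Sum>k<n. y (swap_adj i (as[adj i k := E (as ! adj i k)])))"
      using i l by (intro sum.cong refl) (simp add: swap_adj_update)
    also have "\<dots> = (\<Sum>k<n. y (swap_adj i (as[k := E (as ! k)])))"
      using i by (intro sum.reindex_bij_witness[of _ "adj i" "adj i"]) (auto simp: adj_def)
    finally have "msubst ?w (Lop y (swap_adj i as)) =
       Em (msubst ?w (y (swap_adj i as))) - (\<Sum>k<n. msubst ?w (y (swap_adj i (as[k := E (as ! k)]))))"
      using m pmap_msubst[OF additive_E _ swap_vars(2)[OF i], of "y (swap_adj i as)"]
      by (simp add: Lop_def l additive.diff[OF additive_msubst] additive.sum[OF additive_msubst])
    also have "eqv n \<dots> (Em (sg ?s (y as)) - (\<Sum>k<n. sg ?s (y (as[k := E (as ! k)]))))"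
      using l i h by (intro eqv_diff eqv_sum eqv_Em rc_sym[OF y] hom_list_E) auto
    also have "\<dots> = sg ?s (Lop y as)"
      by (simp add: Lop_def l sg_diff sg_sum sg_additive[OF additive_Em])
    finally show "eqv n (msubst ?w (Lop y (swap_adj i as))) (sg ?s (Lop y as))" .
  }
  fix p q :: nat and b c :: 'v
  assume a: "i < n" "p \<le> 1" "q \<le> 1" "b \<in> gr p" "c \<in> gr q"
  let ?s = "p * (e + (\<Sum>k<i. opp (ps ! k)))" let ?t = "q * (p + (e + (\<Sum>k<i. opp (ps ! k))))"
  have Eb: "E b \<in> gr p" "E c \<in> gr q" using a E_gr by auto
  let ?A = "\<lambda>as b c. sg ?s (exp_act i b (y (as[i := c]))) + sg ?t (exp_act i c (y (as[i := b])))"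
  have L: "eqv n (y (bs[i := b * c])) (?A bs b c)" if "length bs = n" "hom_list ps bs" "b \<in> gr p" "c \<in> gr q" for bs b c
    using that a by (intro rc_leibniz[OF y])
  have rem: "(\<Sum>k<n. f k) = f i + (\<Sum>k\<in>{..<n} - {i}. f k)" for f :: "nat \<Rightarrow> 'v mpoly"
    using a(1) by (subst sum.remove[of _ i]) auto
  have slot: "(\<Sum>k\<in>{..<n} - {i}. y ((as[i := x])[k := E (as[i := x] ! k)])) =
     (\<Sum>k\<in>{..<n} - {i}. y ((as[k := E (as ! k)])[i := x]))" for x
    using a(1) l by (intro sum.cong refl) (simp add: list_update_swap[of i])
  have LL: "Lop y (as[i := x]) = Em (y (as[i := x])) - (y (as[i := E x]) + (\<Sum>k\<in>{..<n} - {i}. y ((as[k := E (as ! k)])[i := x])))" for x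
    unfolding Lop_def length_list_update l rem slot using a(1) l by simp
  have "eqv n (Lop y (as[i := b * c])) (Em (?A as b c) - ((?A as (E b) c + ?A as b (E c)) + (\<Sum>k\<in>{..<n} - {i}. ?A (as[k := E (as ! k)]) b c)))"
    unfolding LL
  proof (intro eqv_diff eqv_add eqv_Em eqv_sum)
    show "eqv n (y (as[i := b * c])) (?A as b c)" by (rule L[OF l h a(4,5)])
    \<comment> \<open>In slot i, E of the product is again a sum of two products, to which the
      Leibniz rule of y applies.\<close>
    have "eqv n (y (as[i := E (b * c)])) (y (as[i := E b * c]) + y (as[i := b * E c]))"
      unfolding E_mult by (rule rc_add[OF y l a(1)])
    also have "eqv n \<dots> (?A as (E b) c + ?A as b (E c))"
      by (intro eqv_add L[OF l h] a Eb)
    finally show "eqv n (y (as[i := E (b * c)])) (?A as (E b) c + ?A as b (E c))" .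
    fix k assume "k \<in> {..<n} - {i}"
    then show "eqv n (y ((as[k := E (as ! k)])[i := b * c])) (?A (as[k := E (as ! k)]) b c)"
      using l by (intro L[OF lk _ a(4,5)] hom_list_E h) auto
  qed
  also have "\<dots> = sg ?s (exp_act i b (Lop y (as[i := c]))) + sg ?t (exp_act i c (Lop y (as[i := b])))"
    unfolding LL
    by (simp add: Em_add sg_additive[OF additive_Em] Em_exp additive.diff[OF additive_exp_act] additive.add[OF additive_exp_act]
        additive.sum[OF additive_exp_act] sg_add sg_diff sg_sum sum.distrib)
  finally show "eqv n (Lop y (as[i := b * c])) (sg ?s (exp_act i b (Lop y (as[i := c]))) + sg ?t (exp_act i c (Lop y (as[i := b]))))" .
qed

lemma t1_E:
  assumes "x \<in> mpolys n" "i < Suc n"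
  shows "Em (t1 (Suc n) i a x) = t1 (Suc n) i (E a) x + t1 (Suc n) i a (Em x) - t1 (Suc n) i a x - t1 (Suc n) i a x"
  unfolding t1_def using assms omit_vars_props[OF assms(2)]
  by (simp add: bp_E[OF lin_var[OF assms(2)]] pmap_msubst[OF additive_E, where n="Suc n"] del: upt_Suc)

lemma eqv_t1_sum: "t1 N i a (sum f A) = (\<Sum>k\<in>A. t1 N i a (f k))"
  by (rule additive.sum[OF additive_t1])

text \<open>The polynomials f, f' and f + f' have different supports. Sums over a common finite set
  can be compared, the additional terms being 0 modulo total derivatives only.\<close>

lemma pl_superset:
  assumes "\<And>c. c = 0 \<Longrightarrow> eqv m (g c) 0" "lin m L" "finite S" "ks f \<subseteq> S"
  shows "eqv m (pl L f g) (\<Sum>k\<in>S. L ^ k * g (lk f k))"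
proof -
  have e: "(\<Sum>k\<in>S. L ^ k * g (lk f k)) = (\<Sum>k\<in>ks f. L ^ k * g (lk f k)) + (\<Sum>k\<in>S - ks f. L ^ k * g (lk f k))"
    using sum.subset_diff[OF assms(4,3)] by (simp add: add.commute)
  have "eqv m (\<Sum>k\<in>S - ks f. L ^ k * g (lk f k)) (\<Sum>k\<in>S - ks f. 0)"
  proof (rule eqv_sum)
    fix k assume "k \<in> S - ks f"
    then have "lk f k = 0" by (simp add: in_keys_iff)
    then have "eqv m (L ^ k * g (lk f k)) (L ^ k * 0)" using assms(1,2) by (intro lin_power)
    then show "eqv m (L ^ k * g (lk f k)) 0" by simp
  qed
  then have "eqv m ((\<Sum>k\<in>ks f. L ^ k * g (lk f k)) + (\<Sum>k\<in>S - ks f. L ^ k * g (lk f k)))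
      ((\<Sum>k\<in>ks f. L ^ k * g (lk f k)) + (\<Sum>k\<in>S - ks f. 0))"
    by (intro eqv_add eqv_refl)
  then show ?thesis unfolding e by (simp add: pl_def eqv_sym)
qed

lemma pl_add_arg:
  assumes g: "\<And>a b. eqv m (g (a + b)) (g a + g b)" and L: "lin m L"
  shows "eqv m (pl L (f + f') g) (pl L f g + pl L f' g)"
proof -
  have "eqv m (g (0 + 0) - g 0) (g 0 + g 0 - g 0)" by (intro eqv_diff g eqv_refl)
  then have z: "eqv m (g c) 0" if "c = 0" for c using that by (simp add: eqv_sym)
  let ?S = "ks f \<union> ks f'"
  have "eqv m (pl L (f + f') g) (\<Sum>k\<in>?S. L ^ k * g (lk (f + f') k))"
    using Poly_Mapping.keys_add[of f f'] by (intro pl_superset z L) auto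
  also have "eqv m \<dots> (\<Sum>k\<in>?S. L ^ k * (g (lk f k) + g (lk f' k)))"
    unfolding lookup_add by (intro eqv_sum lin_power L g)
  also have "\<dots> = (\<Sum>k\<in>?S. L ^ k * g (lk f k)) + (\<Sum>k\<in>?S. L ^ k * g (lk f' k))"
    by (simp add: distrib_left sum.distrib)
  also have "eqv m \<dots> (pl L f g + pl L f' g)"
    by (intro eqv_add eqv_sym[OF pl_superset] z L) auto
  finally show ?thesis .
qed

lemma pl_E:
  assumes g: "\<And>a b. eqv m (g (a + b)) (g a + g b)" and L: "lin m L"
  shows "eqv m (pl L (br a b) (\<lambda>c. g (E c))) (pl L (br (E a) b) g + pl L (br a (E b)) g - pl L (br a b) g - pl L (br a b) g)"
proof -
  have "eqv m (g (0 + 0) - g 0) (g 0 + g 0 - g 0)" by (intro eqv_diff g eqv_refl)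
  then have z: "eqv m (g c) 0" if "c = 0" for c using that by (simp add: eqv_sym)
  let ?P = "\<lambda>f. pl L f g"
  have "ks (pmap E (br a b)) \<subseteq> ks (br a b)" by (auto simp: in_keys_iff lookup_pmap)
  then have "eqv m (?P (pmap E (br a b))) (\<Sum>k\<in>ks (br a b). L ^ k * g (lk (pmap E (br a b)) k))"
    by (intro pl_superset z L) auto
  then have 1: "eqv m (pl L (br a b) (\<lambda>c. g (E c))) (?P (pmap E (br a b)))"
    by (simp add: pl_def lookup_pmap eqv_sym)
  have "br (E a) b + br a (E b) = (pmap E (br a b) + br a b) + br a b" by (simp add: br_E)
  then have "eqv m (?P (br (E a) b) + ?P (br a (E b))) (?P ((pmap E (br a b) + br a b) + br a b))"
    using eqv_sym[OF pl_add_arg[OF g L]] by metis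
  also have "eqv m \<dots> (?P (pmap E (br a b)) + ?P (br a b) + ?P (br a b))"
    using pl_add_arg[OF g L] by (meson eqv_add eqv_refl eqv_trans)
  finally have "eqv m (?P (br (E a) b) + ?P (br a (E b)) - ?P (br a b) - ?P (br a b))
     (?P (pmap E (br a b)) + ?P (br a b) + ?P (br a b) - ?P (br a b) - ?P (br a b))"
    by (intro eqv_diff eqv_refl)
  then have "eqv m (?P (pmap E (br a b))) (?P (br (E a) b) + ?P (br a (E b)) - ?P (br a b) - ?P (br a b))"
    by (simp add: eqv_sym)
  with 1 show ?thesis by (rule eqv_trans)
qed

text \<open>This is d(L Y) = L(dY) + 2 dY. Every term of the differential contains exactly one
  bracket, and each bracket contributes 2 by its Euler degree.\<close>

lemma dF_Lop:
  assumes y: "rc n e y" and l: "length as = Suc n" and h: "hom_list ps as"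
  shows "eqv (Suc n) (dF e (Lop y) ps as)
    (Em (dF e y ps as) - (\<Sum>k<Suc n. dF e y ps (as[k := E (as ! k)])) + dF e y ps as + dF e y ps as)"
proof -
  have A: "t1 (Suc n) i (as ! i) (Lop y (omit i as)) = Em (t1 (Suc n) i (as ! i) (y (omit i as)))
      - (\<Sum>k<Suc n. t1 (Suc n) i (as[k := E (as ! k)] ! i) (y (omit i (as[k := E (as ! k)]))))
      + t1 (Suc n) i (as ! i) (y (omit i as)) + t1 (Suc n) i (as ! i) (y (omit i as))" if i: "i < Suc n" for i
  proof -
    have lo: "length (omit i as) = n" using l i by (simp add: length_omit)
    have m: "y (omit i as) \<in> mpolys n" using lo by (rule rc_mpolys[OF y])
    \<comment> \<open>E on the slot i changes the acting argument; on any other slot it changes an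
      argument of y.\<close>
    have "(\<Sum>k<Suc n. t1 (Suc n) i (as[k := E (as ! k)] ! i) (y (omit i (as[k := E (as ! k)]))))
      = t1 (Suc n) i (E (as ! i)) (y (omit i as))
      + (\<Sum>k<n. t1 (Suc n) i (as ! i) (y ((omit i as)[k := E (omit i as ! k)])))"
    proof (subst sum_skip[of i], goal_cases)
      case 2
      have "skip i k \<noteq> i" for k by (simp add: skip_def)
      then show ?case using i l
        by (simp add: omit_update_same omit_update_skip nth_omit)
    qed (use i in simp)
    then show ?thesis unfolding Lop_def lo additive.diff[OF additive_t1] eqv_t1_sum
      using t1_E[OF m i, of "as ! i"] by (simp add: algebra_simps)
  qed
  have B: "eqv (Suc n) (t2 (Lop y) as i j) (Em (t2 y as i j) - (\<Sum>k<Suc n. t2 y (as[k := E (as ! k)]) i j) + t2 y as i j + t2 y as i j)"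
    if ij: "i < j" "j < Suc n" for i j
  proof -
    obtain n' where n: "n = Suc n'" using ij by (cases n) auto
    let ?R = "omit i (omit j as)" let ?S = "subs2 (Suc n) i j"
    have lj: "length (omit j as) = n" using l ij by (simp add: length_omit)
    have lR: "length ?R = n'" using ij lj n by (simp add: length_omit)
    have aji: "omit j as ! i = as ! i" using ij l by (subst nth_omit) (auto simp: skip_def)
    let ?T = "\<lambda>a b R. pl (mvar i) (br a b) (\<lambda>c. msubst ?S (y (c # R)))"
    have li: "lin (Suc n) (mvar i)" using ij by (intro lin_var) simp
    have g: "eqv (Suc n) (msubst ?S (y ((a + b) # R))) (msubst ?S (y (a # R)) + msubst ?S (y (b # R)))" if "length R = n'" for a b R
    proof -
      have "eqv n (y ((a + b) # R)) (y (a # R) + y (b # R))"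
        using rc_add[OF y, of "0 # R" 0 a b] that n by simp
      from eqv_msubst[OF this subs2_props[OF ij]] show ?thesis by (simp add: msubst_add)
    qed
    have m: "msubst ?S (Em (y (c # ?R))) = Em (msubst ?S (y (c # ?R)))" for c
      using subs2_props[OF ij] lR n rc_mpolys[OF y, of "c # ?R"]
      by (intro pmap_msubst[OF additive_E, symmetric, where n="Suc n"]) auto
    have Epow: "Em (mvar i ^ k * x) = mvar i ^ k * Em x" for k x
      by (induction k) (auto simp: mult.assoc Em_mvar)
    have "t2 (Lop y) as i j = pl (mvar i) (br (as ! i) (as ! j)) (\<lambda>c. Em (msubst ?S (y (c # ?R)))
        - (msubst ?S (y (E c # ?R)) + (\<Sum>k<n'. msubst ?S (y (c # ?R[k := E (?R ! k)])))))"
      unfolding t2_def l Lop_def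
      by (simp add: lR sum.lessThan_Suc_shift additive.diff[OF additive_msubst] additive.sum[OF additive_msubst] msubst_add m del: sum.lessThan_Suc)
    also have "\<dots> = Em (t2 y as i j) - (pl (mvar i) (br (as ! i) (as ! j)) (\<lambda>c. msubst ?S (y (E c # ?R)))
        + (\<Sum>k<n'. ?T (as ! i) (as ! j) (?R[k := E (?R ! k)])))"
      unfolding t2_def l pl_def
      by (simp add: right_diff_distrib distrib_left sum_subtractf sum.distrib additive.sum[OF additive_Em] Epow sum_distrib_left)
        (rule sum.swap)
    also have "eqv (Suc n) \<dots> (Em (t2 y as i j) - ((?T (E (as ! i)) (as ! j) ?R + ?T (as ! i) (E (as ! j)) ?R - t2 y as i j - t2 y as i j)
        + (\<Sum>k<n'. ?T (as ! i) (as ! j) (?R[k := E (?R ! k)]))))"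
      using pl_E[OF g[OF lR] li, of "as ! i" "as ! j"]
      by (intro eqv_diff eqv_add eqv_refl) (simp add: t2_def l)
    finally have 1: "eqv (Suc n) (t2 (Lop y) as i j) (Em (t2 y as i j) - ((?T (E (as ! i)) (as ! j) ?R + ?T (as ! i) (E (as ! j)) ?R - t2 y as i j - t2 y as i j)
        + (\<Sum>k<n'. ?T (as ! i) (as ! j) (?R[k := E (?R ! k)]))))" .
    \<comment> \<open>The slots j and i give E on the entries of the bracket, the others E on the
      remaining arguments; \<open>sum_skip\<close> removes j and then i.\<close>
    have 2: "(\<Sum>k<Suc n. t2 y (as[k := E (as ! k)]) i j) =
        ?T (as ! i) (E (as ! j)) ?R + (?T (E (as ! i)) (as ! j) ?R + (\<Sum>k<n'. ?T (as ! i) (as ! j) (?R[k := E (?R ! k)])))"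
    proof -
      have a: "t2 y (as[j := E (as ! j)]) i j = ?T (as ! i) (E (as ! j)) ?R"
        using ij l by (simp add: t2_def omit_update_same)
      have u: "omit j (as[skip j k := x]) = (omit j as)[k := x]" if "k < n" for k x
        using that ij l by (simp add: omit_update_skip)
      have nk: "as ! skip j k = omit j as ! k" if "k < n" for k using that ij l by (simp add: nth_omit)
      have b: "t2 y (as[skip j i := E (as ! skip j i)]) i j = ?T (E (as ! i)) (as ! j) ?R"
        using ij l u[of i] by (simp add: t2_def omit_update_same) (simp add: skip_def)
      have c: "t2 y (as[skip j (skip i k) := E (as ! skip j (skip i k))]) i j = ?T (as ! i) (as ! j) (?R[k := E (?R ! k)])"
        if k: "k < n'" for k
      proof -
        have k': "skip i k < n" using k n by (simp add: skip_def)
        have ne: "skip j (skip i k) \<noteq> i" "skip j (skip i k) \<noteq> j" using ij by (auto simp: skip_def split: if_splits)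
        have "omit i ((omit j as)[skip i k := x]) = ?R[k := x]" for x
          using k ij lj n by (simp add: omit_update_skip)
        moreover have "omit j as ! skip i k = ?R ! k" using k ij lj n by (simp add: nth_omit)
        ultimately show ?thesis using ne l by (simp add: t2_def u[OF k'] nk[OF k'])
      qed
      have "(\<Sum>k<Suc n. t2 y (as[k := E (as ! k)]) i j) = t2 y (as[j := E (as ! j)]) i j
         + (\<Sum>k<n. t2 y (as[skip j k := E (as ! skip j k)]) i j)"
        using ij by (intro sum_skip) simp
      also have "(\<Sum>k<n. t2 y (as[skip j k := E (as ! skip j k)]) i j) = t2 y (as[skip j i := E (as ! skip j i)]) i j
         + (\<Sum>k<n'. t2 y (as[skip j (skip i k) := E (as ! skip j (skip i k))]) i j)"
        unfolding n using ij n by (intro sum_skip) simp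
      finally show ?thesis using a b c by simp
    qed
    show ?thesis unfolding 2 by (rule eqv_eq_trans[OF 1]) (simp add: algebra_simps)
  qed
  have "eqv (Suc n) (dF e (Lop y) ps as)
    ((\<Sum>i<Suc n. sg (s1 e ps i) (Em (t1 (Suc n) i (as ! i) (y (omit i as)))
      - (\<Sum>k<Suc n. t1 (Suc n) i (as[k := E (as ! k)] ! i) (y (omit i (as[k := E (as ! k)]))))
      + t1 (Suc n) i (as ! i) (y (omit i as)) + t1 (Suc n) i (as ! i) (y (omit i as))))
    + (\<Sum>j<Suc n. \<Sum>i<j. sg (s2 e ps i j) (Em (t2 y as i j) - (\<Sum>k<Suc n. t2 y (as[k := E (as ! k)]) i j) + t2 y as i j + t2 y as i j)))"
    unfolding dF_def l
  proof (intro eqv_add eqv_sum eqv_sg)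
    fix j i assume "j \<in> {..<Suc n}" "i \<in> {..<j}"
    then show "eqv (Suc n) (t2 (Lop y) as i j) (Em (t2 y as i j) - (\<Sum>k<Suc n. t2 y (as[k := E (as ! k)]) i j) + t2 y as i j + t2 y as i j)"
      by (intro B) auto
  qed (use A in \<open>auto intro!: eqv_eq simp del: sum.lessThan_Suc\<close>)
  also have "\<dots> = Em (dF e y ps as) - (\<Sum>k<Suc n. dF e y ps (as[k := E (as ! k)])) + dF e y ps as + dF e y ps as"
  proof -
    have "(\<Sum>i<Suc n. \<Sum>k<Suc n. sg (s1 e ps i) (t1 (Suc n) i (as[k := E (as ! k)] ! i) (y (omit i (as[k := E (as ! k)])))))
       = (\<Sum>k<Suc n. \<Sum>i<Suc n. sg (s1 e ps i) (t1 (Suc n) i (as[k := E (as ! k)] ! i) (y (omit i (as[k := E (as ! k)])))))"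
      by (rule sum.swap)
    moreover have "(\<Sum>j<Suc n. \<Sum>i<j. \<Sum>k<Suc n. sg (s2 e ps i j) (t2 y (as[k := E (as ! k)]) i j))
       = (\<Sum>k<Suc n. \<Sum>j<Suc n. \<Sum>i<j. sg (s2 e ps i j) (t2 y (as[k := E (as ! k)]) i j))"
      by (subst sum.swap, subst (2) sum.swap) (rule refl)
    ultimately show ?thesis
      unfolding dF_def l length_list_update
      by (simp add: Em_add additive.sum[OF additive_Em] sg_additive[OF additive_Em] sg_add sg_diff sg_sum
          sum.distrib sum_subtractf del: sum.lessThan_Suc)
  qed
  finally show ?thesis .
qed

end

section \<open>Contraction of the terms of the differential when an argument is prepended\<close>

lemma vars_Suc: "vars (Suc n) = mvar 0 # map (\<lambda>r. mvar (Suc r)) [0..<n]"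
  by (simp add: upt_conv_Cons map_Suc_upt[symmetric] del: upt_Suc)

lemma omit_vars_Suc: "k < Suc m \<Longrightarrow> omit (Suc k) (vars (Suc (Suc m))) = mvar 0 # map (\<lambda>r. mvar (Suc (skip k r))) [0..<m]"
proof -
  assume k: "k < Suc m"
  have "omit k (map (\<lambda>r. mvar (Suc r)) [0..<Suc m]) = map (\<lambda>r. mvar (Suc (skip k r))) [0..<m]"
    using k by (intro nth_equalityI) (auto simp: length_omit nth_omit skip_def simp del: upt_Suc)
  then show ?thesis unfolding vars_Suc[of "Suc m"] omit_Cons_Suc by simp
qed

lemma map_msubst_vars:
  assumes "\<And>L. L \<in> set Ls \<Longrightarrow> lin n L" "length Ls = m" shows "map (msubst Ls) (vars m) = Ls"
proof (rule nth_equalityI)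
  fix i assume "i < length (map (msubst Ls) (vars m))"
  then have i: "i < length Ls" using assms(2) by simp
  then have "lin n (Ls ! i)" using assms(1) by simp
  then show "map (msubst Ls) (vars m) ! i = Ls ! i" using i assms(2) by (simp add: lin_commute)
qed (use assms in simp)

lemma map_swap_adj: "Suc i < length xs \<Longrightarrow> map f (swap_adj i xs) = swap_adj i (map f xs)"
  by (simp add: swap_adj_def map_update)

context poisson_vertex_superalgebra begin

section \<open>Contraction and the terms of the differential\<close>

lemma contr_mvar_power: "contr w (mvar (Suc k) ^ j * x) = mvar k ^ j * contr w x"
  by (induction j) (auto simp: mult.assoc contr_rules)

lemma contr_mvar_0_power: "contr w (mvar 0 ^ j * x) = contr ((D ^^ j) w) x"
  by (induction j arbitrary: w) (auto simp: mult.assoc contr_rules funpow_swap1)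

lemma contr_lev_Suc: "contr w (lev (mvar (Suc k)) f) = mconst w * lev (mvar k) f"
proof (rule additive_eqI[of "\<lambda>f. contr w (lev (mvar (Suc k)) f)" "\<lambda>f. mconst w * lev (mvar k) f"])
  show "additive (\<lambda>f. contr w (lev (mvar (Suc k)) f))" "additive (\<lambda>f. mconst w * lev (mvar k) f)"
    by (auto intro!: additive.intro simp: lev_add contr_add distrib_left)
  fix j v
  have "mconst w * (mvar k ^ j * x) = mvar k ^ j * (mconst w * x)" for x
    by (induction j) (auto simp: mult.assoc mvar_left_commute)
  then show "contr w (lev (mvar (Suc k)) (sgl j v)) = mconst w * lev (mvar k) (sgl j v)"
    by (simp add: lev_single contr_mvar_power contr_mconst mult_single)
qed

lemma cyc_props:
  assumes "k < Suc m"
  shows "length (mvar k # omit k (vars (Suc m)) :: 'v mpoly list) = Suc m"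
    "\<And>L :: 'v mpoly. L \<in> set (mvar k # omit k (vars (Suc m))) \<Longrightarrow> lin (Suc m) L"
    "sum_list (mvar k # omit k (vars (Suc m)) :: 'v mpoly list) = (\<Sum>i<Suc m. mvar i)"
  using omit_vars_props[OF assms] assms by (auto intro: lin_var simp del: upt_Suc sum.lessThan_Suc)

lemma msubst_cyc:
  assumes "k < Suc m"
  shows "msubst (mvar k # omit k (vars (Suc m))) (mvar 0 * x) = mvar k * msubst (mvar k # omit k (vars (Suc m))) (x :: 'v mpoly)"
    "r < m \<Longrightarrow> msubst (mvar k # omit k (vars (Suc m))) (mvar (Suc r) * x) =
       mvar (skip k r) * msubst (mvar k # omit k (vars (Suc m))) x"
proof -
  let ?M = "mvar k # omit k (vars (Suc m)) :: 'v mpoly list"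
  have "lin (Suc m) (?M ! r)" if "r < Suc m" for r
    using cyc_props[OF assms] that by (metis nth_mem)
  then have *: "msubst ?M (mvar r * x) = ?M ! r * msubst ?M x" if "r < Suc m" for r
    using that cyc_props(1)[OF assms] by (intro msubst_mvar_lin[of _ _ "Suc m"]) auto
  from *[of 0] show "msubst ?M (mvar 0 * x) = mvar k * msubst ?M x" by simp
  assume "r < m"
  with *[of "Suc r"] show "msubst ?M (mvar (Suc r) * x) = mvar (skip k r) * msubst ?M x"
    using assms by (simp add: nth_omit skip_def del: upt_Suc)
qed

text \<open>By the Leibniz rule a acts either on the coefficients of P, after passing u, or on the
  derivatives of u. In the second case [a_\<lambda> D^r u] = (\<lambda> + \<partial>)^r
  [a_\<lambda> u], which is why the contracted variable becomes the operator
  \<open>Phi\<close>.\<close>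

lemma t1_contr:
  assumes "P \<in> mpolys (Suc m)" and k: "k < Suc m" and a: "p \<le> 1" "q \<le> 1" "a \<in> gr p" "u \<in> gr q"
  shows "t1 (Suc m) k a (contr u P) = sg (p * q) (contr u (t1 (Suc (Suc m)) (Suc k) a P))
    + msubst (mvar k # omit k (vars (Suc m))) (subop 0 (Phi 0) (lev (mvar 0) (br a u)) P)"
  using assms(1) a(4) unfolding t1_def
proof (induction arbitrary: u rule: mpolys_induct)
  case (const v)
  let ?M = "mvar k # omit k (vars (Suc m)) :: 'v mpoly list"
  have "msubst ?M (lev (mvar 0) f * mconst v) = lev (mvar k) f * mconst v" for f
  proof -
    have l: "lin (length ?M) (mvar 0)" using cyc_props(1)[OF k] by (simp only:) (rule lin_var, simp)
    have "msubst ?M (mvar 0) = mvar k" using cyc_props(1)[OF k] mvar_commute by (subst msubst_var) auto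
    moreover have "lev (mvar 0) f \<in> mpolys (length ?M)" using l by (rule lev_mpolys)
    moreover have "msubst ?M (lev (mvar 0) f) = lev (msubst ?M (mvar 0)) f"
      using cyc_props(2)[OF k] by (intro msubst_lev[OF l])
    ultimately show ?thesis using cyc_props(2)[OF k]
      by (subst msubst_mult_mconst[where n="Suc m"]) (simp_all only:)
  qed
  then show ?case
    using lev_br_mult[OF a(1-3) const lin_var[OF k]]
    by (simp add: contr_mconst bp_mconst contr_lev_Suc add.commute)
next
  case (var i P)
  let ?M = "mvar k # omit k (vars (Suc m)) :: 'v mpoly list"
  let ?O = "omit (Suc k) (vars (Suc (Suc m))) :: 'v mpoly list"
  have lO: "length ?O = Suc m" using k by (simp add: length_omit)
  then have "?O ! i \<in> set ?O" using var(1) by (intro nth_mem) simp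
  then have O: "msubst ?O (mvar i * P) = ?O ! i * msubst ?O P"
    using var(1) lO by (intro msubst_mvar_lin[of _ _ "Suc (Suc m)"] lin_omit_vars[of _ "Suc k"]) simp_all
  show ?case
  proof (cases i)
    case 0
    have Du: "D u \<in> gr q" using var.prems a(2) D_even by blast
    have "lev (mvar 0) (br a (D u)) = Phi 0 (lev (mvar 0) (br a u))"
      using lev_pmap[OF additive_D lin_var[of 0 1], of "br a u"]
      by (simp add: br_D_right lev_add lev_lam[unfolded One_nat_def] Phi_def)
    moreover have "?O ! 0 = mvar 0" using k by (simp add: omit_vars_Suc del: upt_Suc)
    ultimately show ?thesis using var.IH[OF Du] O 0
      by (simp add: contr_mvar_0 bp_mvar subop_mvar_same)
  next
    case (Suc r)
    then have r: "r < m" using var(1) by simp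
    have "?O ! i = mvar (Suc (skip k r))" using k r Suc by (simp add: omit_vars_Suc del: upt_Suc)
    moreover have "msubst (omit k (vars (Suc m))) (mvar r * z) = mvar (skip k r) * msubst (omit k (vars (Suc m))) z" for z :: "'v mpoly"
    proof -
      have e: "omit k (vars (Suc m)) ! r = (mvar (skip k r) :: 'v mpoly)"
        using k r by (simp add: nth_omit skip_def del: upt_Suc)
      have "lin (Suc m) (mvar (skip k r) :: 'v mpoly)" using r by (intro lin_var) (simp add: skip_def)
      then show ?thesis using msubst_mvar_lin[of r "omit k (vars (Suc m))" "Suc m" z] e k r
        by (simp add: length_omit del: upt_Suc)
    qed
    ultimately show ?thesis using var.IH[OF var.prems] O Suc msubst_cyc(2)[OF k r]
      by (simp add: contr_mvar_Suc bp_mvar subop_mvar_other sg_mult_right distrib_left)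
  qed
next
  case (add x y)
  then show ?case by (simp add: contr_add msubst_add bp_add subop_add sg_add)
qed

text \<open>The bracket of the contracted argument with the k-th one carries the sum of their
  variables. Contraction turns it into \<partial> + \<lambda>_k with \<partial> acting on w, that
  is, into the exponential.\<close>

lemma contr_subs2_0:
  assumes "x \<in> mpolys (Suc m)" and k: "k < Suc m"
  shows "contr w (msubst (subs2 (Suc (Suc m)) 0 (Suc k)) x) = msubst (mvar k # omit k (vars (Suc m))) (exp_act 0 w x)"
  using assms(1)
proof (induction arbitrary: w rule: mpolys_induct)
  case (const v) then show ?case by (simp add: contr_mconst exp_act_mconst)
next
  case (var i x)
  let ?S = "subs2 (Suc (Suc m)) 0 (Suc k)"
  have S: "?S = (mvar 0 + mvar (Suc k)) # map (\<lambda>r. mvar (Suc (skip k r))) [0..<m]"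
    unfolding subs2_def omit_vars_Suc[OF k] by simp
  note sp = subs2_props[of 0 "Suc k" "Suc m"]
  have "lin (Suc (Suc m)) (?S ! i)" using sp(2)[of "?S ! i"] sp(1) k var(1) by (simp del: upt_Suc)
  then have m: "msubst ?S (mvar i * x) = ?S ! i * msubst ?S x"
    using sp(1) k var(1) by (intro msubst_mvar_lin[of _ _ "Suc (Suc m)"]) auto
  show ?case
  proof (cases i)
    case 0
    then show ?thesis using m var.IH msubst_cyc(1)[OF k]
      by (simp add: S distrib_right contr_rules exp_act_mvar_same msubst_add)
  next
    case (Suc r)
    then have r: "r < m" using var(1) by simp
    have "?S ! i = mvar (Suc (skip k r))" using r Suc by (simp add: S)
    then show ?thesis using m var.IH msubst_cyc(2)[OF k r] Suc
      by (simp add: contr_rules exp_act_mvar_other)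
  qed
next
  case (add x y) then show ?case by (simp add: msubst_add contr_add exp_act_add)
qed

text \<open>The bracketed pair precedes the contracted argument in the differential; the exchange
  puts the variable to be contracted first.\<close>

lemma contr_subs2_Suc:
  assumes "P \<in> mpolys (Suc m)" and kl: "k < l" "l < Suc m"
  shows "contr u (msubst (swap_adj 0 (subs2 (Suc (Suc m)) (Suc k) (Suc l))) P) = msubst (subs2 (Suc m) k l) (contr u P)"
proof -
  let ?Z = "omit k (omit l [0..<Suc m])"
  have "omit (Suc k) (omit (Suc l) (vars (Suc (Suc m)))) = (mvar 0 # map (\<lambda>r. mvar (Suc r)) ?Z :: 'v mpoly list)"
    by (simp add: vars_Suc[of "Suc m"] omit_map del: upt_Suc)
  then have S': "swap_adj 0 (subs2 (Suc (Suc m)) (Suc k) (Suc l)) =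
      mvar 0 # (mvar (Suc k) + mvar (Suc l)) # map (\<lambda>r. mvar (Suc r)) ?Z"
    by (simp add: subs2_def del: upt_Suc)
  have S: "subs2 (Suc m) k l = (mvar k + mvar l) # map mvar ?Z"
    by (simp add: subs2_def omit_map del: upt_Suc)
  note sp = subs2_props[OF kl] and sp' = subs2_props[of "Suc k" "Suc l" "Suc m"]
  show ?thesis
  proof (rule contr_msubst[OF assms(1) sp(1)])
    show "length (swap_adj 0 (subs2 (Suc (Suc m)) (Suc k) (Suc l))) = Suc m" using sp'(1) kl by simp
    show "\<And>L. L \<in> set (subs2 (Suc m) k l) \<Longrightarrow> lin (Suc m) L" using sp(2) .
    have "set (swap_adj 0 (subs2 (Suc (Suc m)) (Suc k) (Suc l))) = set (subs2 (Suc (Suc m)) (Suc k) (Suc l))"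
      using sp'(1) kl by (intro set_swap_adj) simp
    then show "\<And>L. L \<in> set (swap_adj 0 (subs2 (Suc (Suc m)) (Suc k) (Suc l))) \<Longrightarrow> lin (Suc (Suc m)) L"
      using sp'(2) kl by auto
    fix r and w z :: "'v" and z' :: "'v mpoly" assume r: "r < m"
    have "length (map mvar ?Z :: 'v mpoly list) = m - 1" using kl by (simp add: length_omit del: upt_Suc)
    then have lz: "length ?Z = m - 1" by simp
    show "contr w (swap_adj 0 (subs2 (Suc (Suc m)) (Suc k) (Suc l)) ! Suc r * z') = subs2 (Suc m) k l ! r * contr w z'"
      unfolding S S' using r lz by (cases r) (auto simp: distrib_right contr_rules simp del: upt_Suc)
  qed (simp add: S' del: upt_Suc)
qed

lemma s1_Cons: "s1 e (p # ps) 0 = opp p * (e + 1) + 1"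
  "s1 e (p # ps) (Suc k) = opp (ps ! k) * (e + (opp p + (\<Sum>i<k. opp (ps ! i))) + 1) + 1"
  by (auto simp: s1_def sum.lessThan_Suc_shift simp del: sum.lessThan_Suc)

lemma s2_Cons:
  "s2 e (p # ps) 0 (Suc k) = e + opp p + opp (ps ! k) * (\<Sum>i<k. opp (ps ! i))"
  "k < l \<Longrightarrow> s2 e (p # ps) (Suc k) (Suc l) = e + opp (ps ! k) * ((opp p + (\<Sum>i<k. opp (ps ! i))) + 1)
     + opp (ps ! l) * (opp p + (\<Sum>i\<in>{..<l} - {k}. opp (ps ! i)))"
proof -
  have a: "{..<Suc k} - {0} = Suc ` {..<k}" for k
    by (auto simp: lessThan_Suc_eq_insert_0)
  have "(\<Sum>i\<in>Suc ` {..<k}. opp ((p # ps) ! i)) = (\<Sum>i<k. opp (ps ! i))"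
    by (subst sum.reindex) auto
  then show "s2 e (p # ps) 0 (Suc k) = e + opp p + opp (ps ! k) * (\<Sum>i<k. opp (ps ! i))"
    by (simp add: s2_def a)
  have b: "{..<Suc l} - {Suc k} = insert 0 (Suc ` ({..<l} - {k}))"
    by (auto simp: lessThan_Suc_eq_insert_0)
  have "(\<Sum>i\<in>{..<Suc l} - {Suc k}. opp ((p # ps) ! i)) = opp p + (\<Sum>i\<in>{..<l} - {k}. opp (ps ! i))"
    unfolding b by (subst sum.insert) (auto simp: sum.reindex)
  moreover have "(\<Sum>i<Suc k. opp ((p # ps) ! i)) = opp p + (\<Sum>i<k. opp (ps ! i))"
    by (subst sum.lessThan_Suc_shift) simp
  ultimately show "s2 e (p # ps) (Suc k) (Suc l) = e + opp (ps ! k) * ((opp p + (\<Sum>i<k. opp (ps ! i))) + 1)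
     + opp (ps ! l) * (opp p + (\<Sum>i\<in>{..<l} - {k}. opp (ps ! i)))"
    unfolding s2_def by simp
qed

text \<open>The four sums are those in which a acts, another argument acts, a is bracketed, and two
  other arguments are bracketed. They correspond to the four parts of the homotopy formula.\<close>

lemma dF_Cons:
  assumes "length as = n"
  shows "dF e y (p # ps) (a # as) =
    sg (s1 e (p # ps) 0) (t1 (Suc n) 0 a (y as))
    + (\<Sum>k<n. sg (s1 e (p # ps) (Suc k)) (t1 (Suc n) (Suc k) (as ! k) (y (a # omit k as))))
    + (\<Sum>l<n. sg (s2 e (p # ps) 0 (Suc l)) (t2 y (a # as) 0 (Suc l))
         + (\<Sum>k<l. sg (s2 e (p # ps) (Suc k) (Suc l)) (t2 y (a # as) (Suc k) (Suc l))))"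
  using assms by (simp add: dF_def sum.lessThan_Suc_shift del: sum.lessThan_Suc)

end

context dual_system begin

section \<open>The homotopy formula\<close>

text \<open>
  In dh + hd the terms of hd in which an argument acts, or in which two arguments are bracketed,
  cancel against dh, up to the action of an argument on the vectors U i, which gives back Y. The
  terms of hd in which W i acts give E (Y a), and the brackets of W i with an argument give the
  rest of L Y.
\<close>

definition con :: "nat \<Rightarrow> 'i \<Rightarrow> 'v mpoly \<Rightarrow> 'v mpoly" where
  "con e i x = - sg ((e + 1) * opp (pr i)) (contr (U i) x)"

lemma con_add: "con e i (x + y) = con e i x + con e i y" by (simp add: con_def contr_add sg_add)
lemma additive_con: "additive (con e i)" by standard (rule con_add)
lemma eqv_con: "eqv (Suc n) x y \<Longrightarrow> eqv n (con e i x) (con e i y)"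
  unfolding con_def by (intro eqv_minus eqv_sg eqv_contr)

lemma homotopy_1:
  assumes "rc n e y" "length as = n"
  shows "(\<Sum>i\<in>I. con e i (sg (s1 e (pr i # ps) 0) (t1 (Suc n) 0 (W i) (y as)))) = Em (y as)"
proof -
  have "con e i (sg (s1 e (pr i # ps) 0) x) = contr (U i) x" for i x
    unfolding con_def s1_Cons sg_additive[OF additive_contr] sg_sg
    by (simp add: sg_def algebra_simps)
  moreover have "omit 0 (vars (Suc n)) = (map (\<lambda>k. mvar (Suc k)) [0..<n] :: 'v mpoly list)"
    unfolding vars_Suc by simp
  ultimately show ?thesis using contr_bp[OF rc_mpolys[OF assms]] by (simp add: t1_def del: upt_Suc)
qed

text \<open>By \<open>t1_contr\<close> the terms in which the argument acts on the value of Y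
  cancel. What remains are its brackets with the U i; after skew-symmetry \<open>J_swap\<close>
  assembles them into Y with this argument in front, and \<open>rc_cycle\<close> puts it back into
  slot k.\<close>

lemma homotopy_2:
  assumes y: "rc (Suc m) e y" and l: "length as = Suc m" and h: "hom_list ps as" and k: "k < Suc m"
  shows "eqv (Suc m) ((\<Sum>i\<in>I. con e i (sg (s1 e (pr i # ps) (Suc k)) (t1 (Suc (Suc m)) (Suc k) (as ! k) (y (W i # omit k as)))))
    + sg (s1 (e + 1) ps k) (t1 (Suc m) k (as ! k) (hop e y (omit k as)))) (y as)"
proof -
  let ?a = "as ! k" let ?p = "ps ! k" let ?B = "omit k as" let ?Q = "\<Sum>i<k. opp (ps ! i)"
  let ?M = "mvar k # omit k (vars (Suc m)) :: 'v mpoly list"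
  have p: "?p \<le> 1" "?a \<in> gr ?p" using hom_list_nth[OF h] k l by auto
  have lB: "length ?B = m" using l k by (simp add: length_omit)
  have P: "y (W i # ?B) \<in> mpolys (Suc m)" for i using lB by (intro rc_mpolys[OF y]) simp
  let ?X = "\<lambda>i. msubst ?M (pe (br (U i) ?a) (y (W i # ?B)))"
  have "(\<Sum>i\<in>I. con e i (sg (s1 e (pr i # ps) (Suc k)) (t1 (Suc (Suc m)) (Suc k) ?a (y (W i # ?B)))))
    + sg (s1 (e + 1) ps k) (t1 (Suc m) k ?a (hop e y ?B))
    = (\<Sum>i\<in>I. con e i (sg (s1 e (pr i # ps) (Suc k)) (t1 (Suc (Suc m)) (Suc k) ?a (y (W i # ?B))))
       + sg (s1 (e + 1) ps k) (- sg (e * opp (pr i)) (t1 (Suc m) k ?a (contr (U i) (y (W i # ?B))))))"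
    by (simp add: hop_def additive.sum[OF additive_t1] additive.minus[OF additive_t1] sg_additive[OF additive_t1] sg_sum sum.distrib)
  also have "\<dots> = (\<Sum>i\<in>I. - sg (opp ?p * ?Q + (pr i + (pr i + ?p) * (pr i + e))) (?X i))"
  proof (rule sum.cong[OF refl])
    fix i assume i: "i \<in> I"
    have pi: "pr i \<le> 1" "U i \<in> gr (pr i)" using i pr_le U_gr by auto
    let ?C = "contr (U i) (t1 (Suc (Suc m)) (Suc k) ?a (y (W i # ?B)))"
    \<comment> \<open>Skew-symmetry exchanges the entries, so the shifted bracket becomes
      \<open>pe\<close> of [U i_\<lambda> a].\<close>
    have "subop 0 (Phi 0) (lev (mvar 0) (br ?a (U i))) (y (W i # ?B)) = - sg (?p * pr i) (pe (br (U i) ?a) (y (W i # ?B)))"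
    proof -
      have ad: "additive (\<lambda>z. subop 0 (Phi 0) z (y (W i # ?B)))"
        by standard (rule subop_add_op[OF additive_Phi])
      show ?thesis unfolding br_skew'[OF p(1) pi(1) p(2) pi(2)]
        by (simp add: additive.minus[OF additive_lev] sg_additive[OF additive_lev] additive.minus[OF ad] sg_additive[OF ad] subop_flip)
    qed
    then have t: "t1 (Suc m) k ?a (contr (U i) (y (W i # ?B))) = sg (?p * pr i) ?C - sg (?p * pr i) (?X i)"
      using t1_contr[OF P[of i] k p(1) pi(1) p(2) pi(2)]
      by (simp add: additive.minus[OF additive_msubst] sg_additive[OF additive_msubst])
    have 1: "con e i (sg (s1 e (pr i # ps) (Suc k)) (t1 (Suc (Suc m)) (Suc k) ?a (y (W i # ?B)))) =
      sg (s1 (e + 1) ps k + (e * opp (pr i) + ?p * pr i)) ?C"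
      unfolding con_def sg_additive[OF additive_contr] sg_sg s1_Cons sg_plus_1[symmetric]
      by (rule sg_cong) (use opp_mod2[OF p(1)] opp_mod2[OF pi(1)] in \<open>auto simp: s1_def\<close>)
    have 2: "sg (s1 (e + 1) ps k + (e * opp (pr i) + ?p * pr i)) (?X i) =
      sg (opp ?p * ?Q + (pr i + (pr i + ?p) * (pr i + e)) + 1) (?X i)"
      by (rule sg_cong) (use opp_mod2[OF p(1)] opp_mod2[OF pi(1)] in \<open>auto simp: s1_def\<close>)
    show "con e i (sg (s1 e (pr i # ps) (Suc k)) (t1 (Suc (Suc m)) (Suc k) ?a (y (W i # ?B))))
       + sg (s1 (e + 1) ps k) (- sg (e * opp (pr i)) (t1 (Suc m) k ?a (contr (U i) (y (W i # ?B)))))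
       = - sg (opp ?p * ?Q + (pr i + (pr i + ?p) * (pr i + e))) (?X i)"
      unfolding 1 t using 2 by (simp only: sg_diff sg_uminus sg_sg sg_plus_1) simp
  qed
  also have "\<dots> = sg (opp ?p * ?Q) (msubst ?M (- (\<Sum>i\<in>I. sg (pr i + (pr i + ?p) * (pr i + e)) (pe (br (U i) ?a) (y (W i # ?B))))))"
    by (simp add: additive.minus[OF additive_msubst] additive.sum[OF additive_msubst] sg_additive[OF additive_msubst]
      sg_uminus sg_sum sg_sg sum_negf del: upt_Suc)
  also have "eqv (Suc m) \<dots> (sg (opp ?p * ?Q) (msubst ?M (y (?a # ?B))))"
    by (intro eqv_sg eqv_msubst[OF _ cyc_props[OF k]] eqv_sym[OF J_swap[OF y lB hom_list_omit[OF h] p]])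
  also have "eqv (Suc m) \<dots> (sg (opp ?p * ?Q) (sg (opp ?p * ?Q) (y as)))"
    by (intro eqv_sg rc_cycle[OF y l h k])
  also have "\<dots> = y as" by (simp add: sg_sg) (simp add: sg_def)
  finally show ?thesis .
qed

text \<open>In hd the bracket stands before W i, in dh after it. One adjacent exchange makes the
  terms agree up to a sign, and the signs turn out to be opposite.\<close>

lemma homotopy_3:
  assumes y: "rc (Suc m) e y" and l: "length as = Suc m" and h: "hom_list ps as" and k: "k < j" "j < Suc m"
  shows "eqv (Suc m) ((\<Sum>i\<in>I. con e i (sg (s2 e (pr i # ps) (Suc k) (Suc j)) (t2 y (W i # as) (Suc k) (Suc j))))
    + sg (s2 (e + 1) ps k j) (t2 (hop e y) as k j)) 0"
proof -
  let ?f = "br (as ! k) (as ! j)" let ?R = "omit k (omit j as)" let ?pc = "(ps ! k + ps ! j) mod 2"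
  let ?S = "subs2 (Suc m) k j" let ?S' = "subs2 (Suc (Suc m)) (Suc k) (Suc j)"
  have p: "ps ! k \<le> 1" "as ! k \<in> gr (ps ! k)" "ps ! j \<le> 1" "as ! j \<in> gr (ps ! j)"
    using hom_list_nth[OF h] k l by auto
  obtain m' where m: "m = Suc m'" using k by (cases m) auto
  have lR: "length ?R = m'" using l k m by (simp add: length_omit)
  have hR: "hom_list (omit k (omit j ps)) ?R" by (intro hom_list_omit h)
  let ?Z = "\<lambda>i r. mvar k ^ r * msubst ?S (contr (U i) (y (W i # lk ?f r # ?R)))"
  have A: "eqv (Suc m) (contr (U i) (t2 y (W i # as) (Suc k) (Suc j))) (\<Sum>r\<in>ks ?f. sg (opp ?pc * opp (pr i)) (?Z i r))" if i: "i \<in> I" for i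
  proof -
    have pi: "pr i \<le> 1" "W i \<in> gr (pr i)" using i pr_le W_gr by auto
    have "contr (U i) (t2 y (W i # as) (Suc k) (Suc j)) =
        (\<Sum>r\<in>ks ?f. mvar k ^ r * contr (U i) (msubst ?S' (y (lk ?f r # W i # ?R))))"
      using l by (simp add: t2_def pl_def additive.sum[OF additive_contr] contr_mvar_power)
    also have "eqv (Suc m) \<dots> (\<Sum>r\<in>ks ?f. sg (opp ?pc * opp (pr i)) (?Z i r))"
    proof (rule eqv_sum)
      fix r
      let ?c = "lk ?f r" let ?P = "y (W i # ?c # ?R)" let ?v = "vars (Suc m) :: 'v mpoly list"
      have Pm: "?P \<in> mpolys (Suc m)" using lR m by (intro rc_mpolys[OF y]) simp
      have "hom_list (?pc # pr i # omit k (omit j ps)) (?c # W i # ?R)"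
        using p pi hR by (auto intro: br_parity)
      from rc_sym[OF y _ this, of 0]
      have "eqv (Suc m) (msubst (swap_adj 0 ?v) ?P) (sg (opp ?pc * opp (pr i)) (y (?c # W i # ?R)))"
        using lR m by (simp del: upt_Suc)
      from eqv_sg[OF this, of "opp ?pc * opp (pr i)"]
      have "eqv (Suc m) (y (?c # W i # ?R)) (sg (opp ?pc * opp (pr i)) (msubst (swap_adj 0 ?v) ?P))"
        unfolding sg_sg by (subst (asm) (2) sg_def) (simp add: eqv_sym del: upt_Suc)
      moreover have sp: "length ?S' = Suc m" "\<And>L. L \<in> set ?S' \<Longrightarrow> lin (Suc (Suc m)) L" "sum_list ?S' = (\<Sum>i<Suc (Suc m). mvar i)"
        using subs2_props[of "Suc k" "Suc j" "Suc m"] k by auto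
      ultimately have "eqv (Suc (Suc m)) (msubst ?S' (y (?c # W i # ?R))) (msubst ?S' (sg (opp ?pc * opp (pr i)) (msubst (swap_adj 0 ?v) ?P)))"
        by (intro eqv_msubst[OF _ sp])
      also have "msubst ?S' (sg (opp ?pc * opp (pr i)) (msubst (swap_adj 0 ?v) ?P)) = sg (opp ?pc * opp (pr i)) (msubst (swap_adj 0 ?S') ?P)"
      proof -
        have v: "swap_adj 0 (map (msubst ?S') ?v) = map (msubst ?S') (swap_adj 0 ?v)"
          using m by (intro map_swap_adj[symmetric]) simp
        have "msubst ?S' (msubst (swap_adj 0 ?v) ?P) = msubst (map (msubst ?S') (swap_adj 0 ?v)) ?P"
        proof (rule msubst_msubst)
          show "?P \<in> mpolys (length (swap_adj 0 ?v))" using Pm by simp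
          show "\<And>K. K \<in> set (swap_adj 0 ?v) \<Longrightarrow> lin (length ?S') K"
            unfolding sp(1) using m by (intro swap_vars(2)[of 0 "Suc m"]) auto
        qed (rule sp(2))
        moreover have "map (msubst ?S') ?v = ?S'" by (rule map_msubst_vars) (use sp(1,2) in auto)
        ultimately show ?thesis unfolding v[symmetric] sg_additive[OF additive_msubst] by (simp only:)
      qed
      finally have "eqv (Suc m) (contr (U i) (msubst ?S' (y (?c # W i # ?R)))) (contr (U i) (sg (opp ?pc * opp (pr i)) (msubst (swap_adj 0 ?S') ?P)))"
        by (rule eqv_contr)
      also have "\<dots> = sg (opp ?pc * opp (pr i)) (msubst ?S (contr (U i) ?P))"
        unfolding sg_additive[OF additive_contr] contr_subs2_Suc[OF Pm k] ..
      finally have "eqv (Suc m) (mvar k ^ r * contr (U i) (msubst ?S' (y (?c # W i # ?R)))) (mvar k ^ r * sg (opp ?pc * opp (pr i)) (msubst ?S (contr (U i) ?P)))"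
        using k by (intro lin_power lin_var) auto
      then show "eqv (Suc m) (mvar k ^ r * contr (U i) (msubst ?S' (y (?c # W i # ?R)))) (sg (opp ?pc * opp (pr i)) (?Z i r))"
        by (simp only: sg_mult_right)
    qed
    finally show ?thesis .
  qed
  have "eqv (Suc m) (\<Sum>i\<in>I. con e i (sg (s2 e (pr i # ps) (Suc k) (Suc j)) (t2 y (W i # as) (Suc k) (Suc j))))
     (\<Sum>i\<in>I. - sg ((e + 1) * opp (pr i)) (sg (s2 e (pr i # ps) (Suc k) (Suc j)) (\<Sum>r\<in>ks ?f. sg (opp ?pc * opp (pr i)) (?Z i r))))"
    unfolding con_def sg_additive[OF additive_contr] by (intro eqv_sum eqv_minus eqv_sg A)
  also have "\<dots> = (\<Sum>i\<in>I. \<Sum>r\<in>ks ?f. - sg ((e + 1) * opp (pr i) + (s2 e (pr i # ps) (Suc k) (Suc j) + opp ?pc * opp (pr i))) (?Z i r))"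
    by (simp add: sg_sum sum_negf sg_sg)
  also have "\<dots> = (\<Sum>i\<in>I. \<Sum>r\<in>ks ?f. sg (s2 (e + 1) ps k j + e * opp (pr i)) (?Z i r))"
  proof (intro sum.cong refl)
    fix i r assume i: "i \<in> I"
    have o: "even (opp ?pc) = odd (ps ! k + ps ! j)" by (subst opp_mod2) auto
    show "- sg ((e + 1) * opp (pr i) + (s2 e (pr i # ps) (Suc k) (Suc j) + opp ?pc * opp (pr i))) (?Z i r) =
      sg (s2 (e + 1) ps k j + e * opp (pr i)) (?Z i r)"
      unfolding sg_plus_1[symmetric] s2_Cons(2)[OF k(1)]
      by (rule sg_cong) (use opp_mod2[OF p(1)] opp_mod2[OF p(3)] opp_mod2[OF pr_le[OF i]] o in \<open>auto simp: s2_def\<close>)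
  qed
  also have "\<dots> = - sg (s2 (e + 1) ps k j) (t2 (hop e y) as k j)"
  proof -
    have "t2 (hop e y) as k j = (\<Sum>r\<in>ks ?f. \<Sum>i\<in>I. - sg (e * opp (pr i)) (?Z i r))"
      unfolding t2_def pl_def hop_def l
      by (simp add: additive.sum[OF additive_msubst] additive.minus[OF additive_msubst] sg_additive[OF additive_msubst]
        sum_distrib_left sg_mult_right)
    also have "\<dots> = (\<Sum>i\<in>I. \<Sum>r\<in>ks ?f. - sg (e * opp (pr i)) (?Z i r))" by (rule sum.swap)
    finally show ?thesis by (simp add: sg_sum sg_uminus sum_negf sg_sg)
  qed
  finally have "eqv (Suc m) ((\<Sum>i\<in>I. con e i (sg (s2 e (pr i # ps) (Suc k) (Suc j)) (t2 y (W i # as) (Suc k) (Suc j))))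
     + sg (s2 (e + 1) ps k j) (t2 (hop e y) as k j))
     (- sg (s2 (e + 1) ps k j) (t2 (hop e y) as k j) + sg (s2 (e + 1) ps k j) (t2 (hop e y) as k j))"
    by (intro eqv_add eqv_refl)
  then show ?thesis by simp
qed

text \<open>The powers of the contracted variable become derivatives of U i and the substitution
  becomes an exponential, so the sum is \<open>Fe\<close> up to sign. The sign is reversed, hence Y
  minus Y at E a.\<close>

lemma homotopy_4:
  assumes y: "rc (Suc m) e y" and l: "length as = Suc m" and h: "hom_list ps as" and k: "k < Suc m"
  shows "eqv (Suc m) (\<Sum>i\<in>I. con e i (sg (s2 e (pr i # ps) 0 (Suc k)) (t2 y (W i # as) 0 (Suc k))))
     (y as - y (as[k := E (as ! k)]))"
proof -
  let ?a = "as ! k" let ?p = "ps ! k" let ?B = "omit k as" let ?Q = "\<Sum>i<k. opp (ps ! i)"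
  let ?M = "mvar k # omit k (vars (Suc m)) :: 'v mpoly list"
  have p: "?p \<le> 1" "?a \<in> gr ?p" using hom_list_nth[OF h] k l by auto
  have lB: "length ?B = m" using l k by (simp add: length_omit)
  have "contr (U i) (t2 y (W i # as) 0 (Suc k)) =
     msubst ?M (\<Sum>r\<in>ks (br (W i) ?a). exp_act 0 ((D ^^ r) (U i)) (y (lk (br (W i) ?a) r # ?B)))" for i
  proof -
    have "y (c # ?B) \<in> mpolys (Suc m)" for c using lB by (intro rc_mpolys[OF y]) simp
    then show ?thesis using l
      by (simp add: t2_def pl_def additive.sum[OF additive_contr] additive.sum[OF additive_msubst] contr_mvar_0_power contr_subs2_0[OF _ k] del: upt_Suc)
  qed
  then have "(\<Sum>i\<in>I. con e i (sg (s2 e (pr i # ps) 0 (Suc k)) (t2 y (W i # as) 0 (Suc k)))) =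
     (\<Sum>i\<in>I. - sg (opp ?p * ?Q) (sg (pr i * e) (msubst ?M (\<Sum>r\<in>ks (br (W i) ?a). exp_act 0 ((D ^^ r) (U i)) (y (lk (br (W i) ?a) r # ?B))))))"
    unfolding con_def sg_additive[OF additive_contr] sg_sg s2_Cons(1)
    by (intro sum.cong refl arg_cong[of _ _ uminus]) (simp only:, rule sg_cong, use opp_mod2[OF pr_le] in auto)
  also have "\<dots> = - sg (opp ?p * ?Q) (msubst ?M (Fe e y ?B ?a))"
    by (simp add: Fe_def sum_negf sg_sum sg_additive[OF additive_msubst] additive.sum[OF additive_msubst] del: upt_Suc)
  also have "eqv (Suc m) \<dots> (- sg (opp ?p * ?Q) (msubst ?M (y (E ?a # ?B) - y (?a # ?B))))"
    by (intro eqv_minus eqv_sg eqv_msubst[OF _ cyc_props[OF k]] Fe_eq[OF y lB hom_list_omit[OF h] p])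
  also have "\<dots> = sg (opp ?p * ?Q) (msubst ?M (y (?a # ?B))) - sg (opp ?p * ?Q) (msubst ?M (y (E ?a # ?B)))"
    by (simp add: additive.diff[OF additive_msubst] sg_diff del: upt_Suc)
  also have "eqv (Suc m) \<dots> (sg (opp ?p * ?Q) (sg (opp ?p * ?Q) (y as)) - sg (opp ?p * ?Q) (sg (opp ?p * ?Q) (y (as[k := E ?a]))))"
  proof (intro eqv_diff eqv_sg)
    show "eqv (Suc m) (msubst ?M (y (?a # ?B))) (sg (opp ?p * ?Q) (y as))" by (rule rc_cycle[OF y l h k])
    show "eqv (Suc m) (msubst ?M (y (E ?a # ?B))) (sg (opp ?p * ?Q) (y (as[k := E ?a])))"
      using rc_cycle[OF y _ hom_list_E[OF h, of k] k] l k by (simp add: omit_update_same del: upt_Suc)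
  qed
  also have "\<dots> = y as - y (as[k := E ?a])" by (simp add: sg_sg) (simp add: sg_def)
  finally show ?thesis .
qed

text \<open>The multiple 2n consists of n copies of y from \<open>homotopy_2\<close> and n from
  \<open>homotopy_4\<close>. In degree 0 there is no slot to contract and only hd is
  present.\<close>

lemma homotopy:
  assumes y: "rc n e y" and l: "length as = n" and h: "hom_list ps as"
  shows "eqv n ((\<Sum>i\<in>I. con e i (dF e y (pr i # ps) (W i # as)))
      + (if n = 0 then 0 else dF (e + 1) (hop e y) ps as))
    (Lop y as + of_nat (2 * n) * y as)"
proof -
  let ?c1 = "\<lambda>k. \<Sum>i\<in>I. con e i (sg (s1 e (pr i # ps) (Suc k)) (t1 (Suc n) (Suc k) (as ! k) (y (W i # omit k as))))"
  let ?c2 = "\<lambda>j. \<Sum>i\<in>I. con e i (sg (s2 e (pr i # ps) 0 (Suc j)) (t2 y (W i # as) 0 (Suc j)))"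
  let ?c3 = "\<lambda>k j. \<Sum>i\<in>I. con e i (sg (s2 e (pr i # ps) (Suc k) (Suc j)) (t2 y (W i # as) (Suc k) (Suc j)))"
  have d: "(\<Sum>i\<in>I. con e i (dF e y (pr i # ps) (W i # as))) = Em (y as) + (\<Sum>k<n. ?c1 k) + (\<Sum>j<n. ?c2 j + (\<Sum>k<j. ?c3 k j))"
  proof -
    have "(\<Sum>i\<in>I. con e i (dF e y (pr i # ps) (W i # as))) =
      (\<Sum>i\<in>I. con e i (sg (s1 e (pr i # ps) 0) (t1 (Suc n) 0 (W i) (y as))))
      + (\<Sum>i\<in>I. \<Sum>k<n. con e i (sg (s1 e (pr i # ps) (Suc k)) (t1 (Suc n) (Suc k) (as ! k) (y (W i # omit k as)))))
      + (\<Sum>i\<in>I. \<Sum>j<n. con e i (sg (s2 e (pr i # ps) 0 (Suc j)) (t2 y (W i # as) 0 (Suc j)))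
          + (\<Sum>k<j. con e i (sg (s2 e (pr i # ps) (Suc k) (Suc j)) (t2 y (W i # as) (Suc k) (Suc j)))))"
      unfolding dF_Cons[OF l] by (simp only: con_add additive.sum[OF additive_con] sum.distrib)
    also have "(\<Sum>i\<in>I. con e i (sg (s1 e (pr i # ps) 0) (t1 (Suc n) 0 (W i) (y as)))) = Em (y as)"
      by (rule homotopy_1[OF y l])
    also have "(\<Sum>i\<in>I. \<Sum>k<n. con e i (sg (s1 e (pr i # ps) (Suc k)) (t1 (Suc n) (Suc k) (as ! k) (y (W i # omit k as))))) = (\<Sum>k<n. ?c1 k)"
      by (rule sum.swap)
    also have "(\<Sum>i\<in>I. \<Sum>j<n. con e i (sg (s2 e (pr i # ps) 0 (Suc j)) (t2 y (W i # as) 0 (Suc j)))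
          + (\<Sum>k<j. con e i (sg (s2 e (pr i # ps) (Suc k) (Suc j)) (t2 y (W i # as) (Suc k) (Suc j)))))
       = (\<Sum>j<n. ?c2 j + (\<Sum>k<j. ?c3 k j))"
      by (subst sum.swap) (simp only: sum.distrib sum.swap[of _ I])
    finally show ?thesis .
  qed
  have Lo: "Lop y as + of_nat (2 * n) * y as = Em (y as) + (\<Sum>k<n. y as) + (\<Sum>k<n. y as - y (as[k := E (as ! k)]))"
    unfolding mult_2 of_nat_add distrib_right by (simp add: Lop_def l sum_subtractf algebra_simps)
  show ?thesis
  proof (cases n)
    case 0 then show ?thesis unfolding d Lo by simp
  next
    case (Suc m)
    note y' = y[unfolded Suc] and l' = l[unfolded Suc]
    have "(\<Sum>i\<in>I. con e i (dF e y (pr i # ps) (W i # as))) + dF (e + 1) (hop e y) ps as =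
       Em (y as) + (\<Sum>k<n. ?c1 k + sg (s1 (e + 1) ps k) (t1 n k (as ! k) (hop e y (omit k as))))
       + (\<Sum>j<n. ?c2 j + (\<Sum>k<j. ?c3 k j + sg (s2 (e + 1) ps k j) (t2 (hop e y) as k j)))"
      unfolding d by (simp add: dF_def l sum.distrib algebra_simps)
    also have "eqv n \<dots> (Em (y as) + (\<Sum>k<n. y as) + (\<Sum>j<n. (y as - y (as[j := E (as ! j)])) + (\<Sum>k<j. 0)))"
      unfolding Suc by (intro eqv_add eqv_sum eqv_refl homotopy_2[OF y' l' h] homotopy_3[OF y' l' h] homotopy_4[OF y' l' h]) auto
    finally show ?thesis unfolding Lo using Suc by simp
  qed
qed

end

context dual_system begin

section \<open>Exactness\<close>

definition is_closed :: "nat \<Rightarrow> nat \<Rightarrow> ('v list \<Rightarrow> 'v mpoly) \<Rightarrow> bool" where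
  "is_closed n e y \<longleftrightarrow> (\<forall>ps as. length as = Suc n \<and> hom_list ps as \<longrightarrow> eqv (Suc n) (dF e y ps as) 0)"

lemma swap_vanish:
  assumes y: "rc n e y" and l: "length as = n" "hom_list ps as" "Suc i < n" and z: "eqv n (y as) 0"
  shows "eqv n (y (swap_adj i as)) 0"
proof -
  let ?s = "opp (swap_adj i ps ! i) * opp (swap_adj i ps ! Suc i)" and ?w = "swap_adj i (vars n) :: 'v mpoly list"
  have "swap_adj i (swap_adj i as) = as"
    using l by (intro nth_equalityI) (auto simp: nth_swap_adj)
  then have "eqv n (msubst ?w (y as)) (sg ?s (y (swap_adj i as)))"
    using rc_sym[OF y _ hom_list_swap[OF l(2), of i], of i] l by simp
  moreover have "eqv n (msubst ?w (y as)) (msubst ?w 0)"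
    using l by (intro eqv_msubst[OF z swap_vars])
  ultimately have "eqv n (sg ?s (y (swap_adj i as))) 0" by (metis eqv_sym eqv_trans msubst_0)
  from eqv_sg[OF this, of ?s] show ?thesis by (simp add: sg_sg) (simp add: sg_def)
qed

lemma front_vanish:
  assumes y: "rc n e y"
  shows "length as = n \<Longrightarrow> hom_list ps as \<Longrightarrow> k < n \<Longrightarrow> eqv n (y as) 0 \<Longrightarrow> eqv n (y (as ! k # omit k as)) 0"
proof (induction k arbitrary: as ps)
  case 0
  then show ?case by (cases as) auto
next
  case (Suc k)
  have "eqv n (y (swap_adj k as ! k # omit k (swap_adj k as))) 0"
    using Suc.prems by (intro Suc.IH[of _ "swap_adj k ps"] hom_list_swap swap_vanish[OF y]) auto
  then show ?case using Suc.prems by (simp add: nth_swap_adj omit_swap_adj)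
qed

text \<open>By \<open>J_eq\<close> the value at any argument in front is a combination of values at
  the U i in front, so the arguments can be freed one after the other.\<close>

lemma vanish_on_generators:
  assumes y: "rc n e y" and z: "\<And>as. length as = n \<Longrightarrow> set as \<subseteq> U ` I \<Longrightarrow> eqv n (y as) 0" and l: "length as = n"
  shows "eqv n (y as) 0"
proof -
  \<comment> \<open>The first k arguments are arbitrary and the others are generators. For the next
    k, slot k is brought to the front, expanded there and brought back.\<close>
  have P: "eqv n (y as) 0" if "k \<le> n" "length as = n" "hom_list ps as" "\<And>i. k \<le> i \<Longrightarrow> i < n \<Longrightarrow> as ! i \<in> U ` I" for k as ps
    using that
  proof (induction k arbitrary: as ps)
    case 0
    then have "set as \<subseteq> U ` I" by (auto simp: set_conv_nth)
    then show ?case using z 0 by blast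
  next
    case (Suc k)
    obtain m where n: "n = Suc m" using Suc.prems by (cases n) auto
    have k: "k < n" using Suc.prems by simp
    let ?B = "omit k as"
    have lB: "length ?B = m" using Suc.prems k n by (simp add: length_omit)
    have p: "ps ! k \<le> 1" "as ! k \<in> gr (ps ! k)" using hom_list_nth[OF Suc.prems(3)] k Suc.prems by auto
    have "eqv n (y (U i # ?B)) 0" if i: "i \<in> I" for i
    proof -
      let ?as = "as[k := U i]" and ?ps = "ps[k := pr i]"
      have h: "hom_list ?ps ?as" using i pr_le U_gr by (intro hom_list_update Suc.prems) auto
      have "eqv n (y ?as) 0"
        using i Suc.prems h by (intro Suc.IH[OF _ _ h]) (auto simp: nth_list_update)
      then have "eqv n (y (?as ! k # omit k ?as)) 0"
        using Suc.prems k h by (intro front_vanish[OF y _ h]) auto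
      then show ?thesis using k Suc.prems by (simp add: omit_update_same)
    qed
    then have "eqv n (J e y ?B (ps ! k) (as ! k)) (\<Sum>i\<in>I. sg ((pr i + ps ! k) * (pr i + e)) (pe (br (W i) (as ! k)) 0))"
      unfolding J_def n by (intro eqv_sum eqv_sg eqv_pe) auto
    moreover have "pe f 0 = 0" for f by (simp add: pe_def)
    ultimately have "eqv n (J e y ?B (ps ! k) (as ! k)) 0" by simp
    with J_eq[OF y[unfolded n] lB hom_list_omit[OF Suc.prems(3)] p]
    have "eqv n (y (as ! k # ?B)) 0" unfolding n by (rule eqv_trans)
    from eqv_msubst[OF this[unfolded n] cyc_props[of k m]]
    have "eqv n (msubst (mvar k # omit k (vars n)) (y (as ! k # ?B))) 0"
      using k n by (simp del: upt_Suc)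
    then have "eqv n (sg (opp (ps ! k) * (\<Sum>i<k. opp (ps ! i))) (y as)) 0"
      using rc_cycle[OF y Suc.prems(2,3) k] by (metis eqv_sym eqv_trans)
    from eqv_sg[OF this, of "opp (ps ! k) * (\<Sum>i<k. opp (ps ! i))"]
    show ?case by (simp add: sg_sg) (simp add: sg_def)
  qed
  show ?thesis
    by (rule rc_eqI[OF y rc_0 l]) (use P[of n] in auto)
qed

lemma dF_0: "dF e (\<lambda>_. 0) ps as = 0"
  using dF_plus[of e "\<lambda>_. 0" "\<lambda>_. 0" ps as] by simp

lemma dF_uminus_smult:
  assumes "rc n e' y" "rc n e' z" "length as = Suc n"
  shows "dF e (\<lambda>as. sc t (y as - z as)) ps as = sc t (dF e y ps as - dF e z ps as)"
proof -
  have 1: "dF e (\<lambda>as. sc t (y as - z as)) ps as = sc t (dF e (\<lambda>as. y as - z as) ps as)"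
    using assms by (intro dF_smult[of n]) (auto intro: rc_mpolys)
  have "dF e (\<lambda>as. (y as - z as) + z as) ps as = dF e (\<lambda>as. y as - z as) ps as + dF e z ps as"
    by (rule dF_plus)
  then have "dF e (\<lambda>as. y as - z as) ps as = dF e y ps as - dF e z ps as" by simp
  with 1 show ?thesis by simp
qed

lemma Lop_generators:
  assumes "length as = n" "set as \<subseteq> U ` I" shows "Lop y as = Em (y as) - of_nat n * y as"
proof -
  have "as[k := E (as ! k)] = as" if "k < n" for k
  proof -
    have "as ! k \<in> U ` I" using assms that nth_mem by blast
    then have "E (as ! k) = as ! k" by (auto simp: E_U)
    then show ?thesis by simp
  qed
  then show ?thesis using assms(1) by (simp add: Lop_def)
qed

text \<open>Induction on the roots of a polynomial in E that kills the values on generators. Without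
  roots y is 0 and so is its primitive; otherwise one root is moved from y to the cocycle z below,
  which has a primitive x by induction.\<close>

lemma exact_step:
  assumes "rc n e y" "is_closed n e y" "n = Suc m"
    "\<And>as. length as = n \<Longrightarrow> set as \<subseteq> U ` I \<Longrightarrow> eqv n (pmap (kv ms) (y as)) 0"
  shows "\<exists>x. rc m (e + 1) x \<and> (\<forall>ps as. length as = n \<and> hom_list ps as \<longrightarrow> eqv n (dF (e + 1) x ps as) (y as))"
  using assms
proof (induction ms arbitrary: y)
  case Nil
  have pid: "pmap (kv []) x = x" for x :: "'v mpoly" by (rule poly_mapping_eqI) (simp add: lookup_pmap)
  have "eqv n (y as) 0" if "length as = n" "set as \<subseteq> U ` I" for as
    using Nil(4)[OF that] unfolding pid .
  then have "eqv n (y as) 0" if "length as = n" for as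
    by (intro vanish_on_generators[OF Nil(1) _ that])
  then show ?case by (intro exI[of _ "\<lambda>_. 0"]) (auto simp: rc_0 dF_0 eqv_sym)
next
  case (Cons k ms)
  note y = Cons.prems(1) and n = Cons.prems(3)
  \<comment> \<open>On generators L is E - n, so L y + (n - k) y is (E - k) y there. Subtracting it
    from L y + 2n y leaves (n + k) y.\<close>
  let ?t = "of_nat n - of_nat k :: 'f" and ?d = "of_nat (n + k) :: 'f"
  define z where "z as = Lop y as + sc ?t (y as)" for as
  have z: "rc n e z" unfolding z_def by (intro rc_plus rc_Lop rc_smult y)
  have "is_closed n e z"
    unfolding is_closed_def
  proof (intro allI impI, elim conjE)
    fix ps as assume a: "length as = Suc n" "hom_list ps as"
    have c: "eqv (Suc n) (dF e y ps bs) 0" if "length bs = Suc n" "hom_list ps bs" for bs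
      using Cons.prems(2) that by (auto simp: is_closed_def)
    have "eqv (Suc n) (dF e (Lop y) ps as) (Em 0 - (\<Sum>k<Suc n. 0) + 0 + 0)"
      by (rule eqv_trans[OF dF_Lop[OF y a]])
        (intro eqv_add eqv_diff eqv_sum eqv_Em c a hom_list_E, use a in \<open>auto intro!: hom_list_E\<close>)
    moreover have "eqv (Suc n) (sc ?t (dF e y ps as)) (sc ?t 0)" by (intro eqv_sc c a)
    ultimately have "eqv (Suc n) (dF e (Lop y) ps as + sc ?t (dF e y ps as)) ((Em 0 - (\<Sum>k<Suc n. 0) + 0 + 0) + sc ?t 0)"
      by (rule eqv_add)
    moreover have "dF e z ps as = dF e (Lop y) ps as + sc ?t (dF e y ps as)"
      unfolding z_def dF_plus using dF_smult[of n y as e ?t ps] a rc_mpolys[OF y] by simp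
    ultimately show "eqv (Suc n) (dF e z ps as) 0" by (simp add: additive.zero[OF additive_Em])
  qed
  moreover have "eqv n (pmap (kv ms) (z as)) 0" if a: "length as = n" "set as \<subseteq> U ` I" for as
  proof -
    have "z as = Em (y as) - sc (of_nat k) (y as)"
      unfolding z_def Lop_generators[OF a] sc_of_nat[symmetric]
      by (rule poly_mapping_eqI) (simp add: lookup_add lookup_minus lookup_pmap scale_left_diff_distrib)
    then have "pmap (kv ms) (z as) = pmap (kv (k # ms)) (y as)"
      using additive.zero[OF additive_kv] by (intro poly_mapping_eqI) (simp add: lookup_pmap lookup_minus)
    then show ?thesis using Cons.prems(4)[OF a] by (simp only:)
  qed
  ultimately obtain x where x: "rc m (e + 1) x"
    "\<And>ps as. length as = n \<Longrightarrow> hom_list ps as \<Longrightarrow> eqv n (dF (e + 1) x ps as) (z as)"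
    using Cons.IH[OF z _ n] by blast
  have hy: "rc m (e + 1) (hop e y)" using y n rc_hop by blast
  define w where "w as = sc (inverse ?d) (hop e y as - x as)" for as
  \<comment> \<open>In degree 0 this would fail for the root k = 0; the class of 1 survives for this
    reason.\<close>
  have d0: "?d \<noteq> 0" unfolding of_nat_eq_0_iff using n by simp
  have "eqv n (dF (e + 1) w ps as) (y as)" if a: "length as = n" "hom_list ps as" for ps as
  proof -
    have "eqv n (\<Sum>i\<in>I. con e i (dF e y (pr i # ps) (W i # as))) (\<Sum>i\<in>I. con e i 0)"
    proof (intro eqv_sum eqv_con)
      fix i assume "i \<in> I"
      then show "eqv (Suc n) (dF e y (pr i # ps) (W i # as)) 0"
        using Cons.prems(2) a pr_le W_gr by (simp add: is_closed_def)
    qed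
    then have "eqv n (\<Sum>i\<in>I. con e i (dF e y (pr i # ps) (W i # as))) 0"
      by (simp add: additive.zero[OF additive_con])
    from eqv_diff[OF homotopy[OF y a] this]
    have "eqv n (dF (e + 1) (hop e y) ps as) (Lop y as + of_nat (2 * n) * y as)"
      using n by simp
    then have "eqv n (dF (e + 1) (hop e y) ps as - dF (e + 1) x ps as) ((Lop y as + of_nat (2 * n) * y as) - z as)"
      using x(2)[OF a] by (rule eqv_diff)
    moreover have "(Lop y as + of_nat (2 * n) * y as) - z as = sc ?d (y as)"
      unfolding z_def sc_of_nat[symmetric]
      by (rule poly_mapping_eqI) (simp add: lookup_add lookup_minus lookup_pmap algebra_simps flip: scale_left_distrib)
    ultimately have "eqv n (sc (inverse ?d) (dF (e + 1) (hop e y) ps as - dF (e + 1) x ps as)) (sc (inverse ?d) (sc ?d (y as)))"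
      by (metis eqv_sc)
    then show ?thesis unfolding w_def sc_sc
      using dF_uminus_smult[OF hy x(1)] a n d0 by (simp del: of_nat_add)
  qed
  moreover have "rc m (e + 1) w" unfolding w_def by (intro rc_smult rc_diff hy x(1))
  ultimately show ?case by blast
qed

lemma kv_poly_exists: "\<exists>M. pmap (kv [0..<M]) x = 0" for x :: "'v mpoly"
proof (induction x rule: mpoly_induct)
  case (const v)
  then show ?case using kv_exists[of v] by (metis additive.zero additive_kv pmap_mconst single_zero)
next
  case (var i x) then show ?case by (metis mult_zero_right pmap_mvar[OF additive_kv])
next
  case (add x y)
  have mono: "pmap (kv [0..<N]) x = 0" if "pmap (kv [0..<M]) x = 0" "M \<le> N" for M N and x :: "'v mpoly"
  proof (rule poly_mapping_eqI)
    fix m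
    have "kv [0..<M] (lk x m) = 0"
      using that(1) lookup_pmap[of "kv [0..<M]" x m, OF additive.zero[OF additive_kv]] by simp
    then show "lk (pmap (kv [0..<N]) x) m = lk 0 m"
      using kv_mono[of 0 M "lk x m" N] that(2) by (simp add: lookup_pmap additive.zero[OF additive_kv])
  qed
  from add obtain M N where "pmap (kv [0..<M]) x = 0" "pmap (kv [0..<N]) y = 0" by blast
  then have "pmap (kv [0..<max M N]) (x + y) = 0"
    using mono[of M x "max M N"] mono[of N y "max M N"] by (simp add: additive.add[OF additive_pmap[OF additive_kv]])
  then show ?case by blast
qed

text \<open>Roots for the next element are chosen to kill what the earlier ones leave of it; earlier
  elements stay annihilated.\<close>

lemma kv_poly_exists_finite: "finite A \<Longrightarrow> \<exists>ms. \<forall>x\<in>A. pmap (kv ms) x = (0 :: 'v mpoly)"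
proof (induction A rule: finite_induct)
  case (insert a A)
  then obtain ms where ms: "\<forall>x\<in>A. pmap (kv ms) x = 0" by blast
  obtain M where M: "pmap (kv [0..<M]) (pmap (kv ms) a) = 0" using kv_poly_exists by blast
  have "pmap (kv (ms @ [0..<M])) x = pmap (kv [0..<M]) (pmap (kv ms) x)" for x :: "'v mpoly"
    by (rule poly_mapping_eqI) (simp add: lookup_pmap additive.zero[OF additive_kv] kv_append)
  then have "\<forall>x\<in>insert a A. pmap (kv (ms @ [0..<M])) x = 0"
    using ms M by (simp add: additive.zero[OF additive_pmap[OF additive_kv], of "[0..<M]"])
  then show ?case by blast
qed simp

lemma exact:
  assumes "rc (Suc m) e y" "is_closed (Suc m) e y"
  shows "\<exists>x. rc m (e + 1) x \<and> (\<forall>ps as. length as = Suc m \<and> hom_list ps as \<longrightarrow> eqv (Suc m) (dF (e + 1) x ps as) (y as))"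
proof -
  have "finite {as. set as \<subseteq> U ` I \<and> length as = Suc m}"
    using finite_I by (intro finite_lists_length_eq) simp
  then have "finite (y ` {as. set as \<subseteq> U ` I \<and> length as = Suc m})" by simp
  from kv_poly_exists_finite[OF this] obtain ms where
    ms: "\<forall>x\<in>y ` {as. set as \<subseteq> U ` I \<and> length as = Suc m}. pmap (kv ms) x = 0" by blast
  show ?thesis using ms by (intro exact_step[OF assms refl, of ms]) auto
qed

section \<open>The cohomology\<close>

lemma cocycles_obtain:
  assumes "Y \<in> cocycles n"
  obtains y0 y1 where "Y = toY n (\<lambda>as. y0 as + y1 as)" "rc n 0 y0" "rc n 1 y1" "is_closed n 0 y0" "is_closed n 1 y1"
proof -
  have "Y \<in> cochains n" using assms by (simp add: cocycles_def)
  then obtain y0 y1 where y: "Y = toY n (\<lambda>as. y0 as + y1 as)" "rc n 0 y0" "rc n 1 y1"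
    unfolding cochains_eq by blast
  then have "is_closed n 0 y0" "is_closed n 1 y1"
    using toY_cocycle[of n y0 y1] assms unfolding is_closed_def by blast+
  with y that show thesis by blast
qed

lemma cocycle_coboundary:
  assumes "Y \<in> cocycles (Suc m)" shows "Y \<in> coboundaries (Suc m)"
proof -
  obtain y0 y1 where y: "Y = toY (Suc m) (\<lambda>as. y0 as + y1 as)" "rc (Suc m) 0 y0" "rc (Suc m) 1 y1"
    "is_closed (Suc m) 0 y0" "is_closed (Suc m) 1 y1" using cocycles_obtain[OF assms] by blast
  obtain x0 where x0: "rc m 1 x0" "\<And>ps as. length as = Suc m \<Longrightarrow> hom_list ps as \<Longrightarrow> eqv (Suc m) (dF 1 x0 ps as) (y0 as)"
    using exact[OF y(2,4)] by auto
  obtain x1 where x1: "rc m 2 x1" "\<And>ps as. length as = Suc m \<Longrightarrow> hom_list ps as \<Longrightarrow> eqv (Suc m) (dF 2 x1 ps as) (y1 as)"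
    using exact[OF y(3,5)] by (auto simp: numeral_2_eq_2)
  \<comment> \<open>The primitive of the odd part is even, with its parity counted as 2.\<close>
  have x1': "rc m 0 x1" using x1(1) rc_parity_cong[of 2 0] by simp
  have "dF 2 x1 ps as = dF 0 x1 ps as" for ps as by (rule dF_parity_cong) simp
  then have d1: "toY (Suc m) (dd m 0 x1) = toY (Suc m) y1"
    using d_hom_eqI[OF x1' y(3), of 0] x1(2) by (simp add: d_hom_toY)
  have d0: "toY (Suc m) (dd m 1 x0) = toY (Suc m) y0"
    using d_hom_eqI[OF x0(1) y(2), of 1] x0(2) by (simp add: d_hom_toY)
  have "Y = toY (Suc m) (\<lambda>as. dd m 0 x1 as + dd m 1 x0 as)"
    unfolding y(1) using toY_add[of "Suc m" y0 y1] toY_add[of "Suc m" "dd m 1 x0" "dd m 0 x1"] d0 d1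
    by (simp add: add.commute)
  then show ?thesis unfolding coboundaries_Suc using x1' x0(1) by blast
qed

text \<open>The coboundaries form a group, so all of them have the same class.\<close>

lemma coboundaries_translate:
  assumes "Y \<in> coboundaries (Suc m)" shows "cochain_add Y ` coboundaries (Suc m) = coboundaries (Suc m)"
proof -
  obtain y0 y1 where y: "Y = toY (Suc m) (\<lambda>as. dd m 0 y0 as + dd m 1 y1 as)" "rc m 0 y0" "rc m 1 y1"
    using assms unfolding coboundaries_Suc by blast
  have add: "cochain_add Y (toY (Suc m) (\<lambda>as. dd m 0 z0 as + dd m 1 z1 as)) =
     toY (Suc m) (\<lambda>as. dd m 0 (\<lambda>as. y0 as + z0 as) as + dd m 1 (\<lambda>as. y1 as + z1 as) as)" for z0 z1
    unfolding y(1) toY_add dd_plus by (rule arg_cong[of _ _ "toY (Suc m)"]) (auto simp: algebra_simps)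
  show ?thesis
  proof
    show "cochain_add Y ` coboundaries (Suc m) \<subseteq> coboundaries (Suc m)"
    proof
      fix X assume "X \<in> cochain_add Y ` coboundaries (Suc m)"
      then obtain z0 z1 where "rc m 0 z0" "rc m 1 z1" "X = cochain_add Y (toY (Suc m) (\<lambda>as. dd m 0 z0 as + dd m 1 z1 as))"
        unfolding coboundaries_Suc by blast
      then show "X \<in> coboundaries (Suc m)" unfolding coboundaries_Suc add using y(2,3) rc_plus by blast
    qed
    show "coboundaries (Suc m) \<subseteq> cochain_add Y ` coboundaries (Suc m)"
    proof
      fix X assume "X \<in> coboundaries (Suc m)"
      then obtain x0 x1 where x: "rc m 0 x0" "rc m 1 x1" "X = toY (Suc m) (\<lambda>as. dd m 0 x0 as + dd m 1 x1 as)"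
        unfolding coboundaries_Suc by blast
      let ?z0 = "\<lambda>as. x0 as - y0 as" and ?z1 = "\<lambda>as. x1 as - y1 as"
      have "X = cochain_add Y (toY (Suc m) (\<lambda>as. dd m 0 ?z0 as + dd m 1 ?z1 as))"
        unfolding add x(3) by simp
      moreover have "toY (Suc m) (\<lambda>as. dd m 0 ?z0 as + dd m 1 ?z1 as) \<in> coboundaries (Suc m)"
        unfolding coboundaries_Suc using x y rc_diff by blast
      ultimately show "X \<in> cochain_add Y ` coboundaries (Suc m)" by blast
    qed
  qed
qed

lemma H_PV_Suc: "H_PV (Suc m) = {cohom_class (Suc m) (cochain_zero (Suc m))}"
proof -
  have "cohom_class (Suc m) Y = coboundaries (Suc m)" if "Y \<in> cocycles (Suc m)" for Y
    using coboundaries_translate[OF cocycle_coboundary[OF that]] by (simp add: cohom_class_def)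
  then show ?thesis unfolding H_PV_def using zero_cocycle[of "Suc m"] by blast
qed

lemma int_cochain_toY: "int_cochain m = toY 0 (\<lambda>_. mconst m)"
  by (auto simp: int_cochain_def toY_def)

lemma mpolys_0_iff: "x \<in> mpolys 0 \<longleftrightarrow> x = mconst (lk x 0)"
proof
  assume "x \<in> mpolys 0"
  then have k: "ks x \<subseteq> {0}" by (auto simp: mpolys_def)
  show "x = mconst (lk x 0)"
  proof (rule poly_mapping_eqI)
    fix m show "lk x m = lk (mconst (lk x 0)) m"
      using k by (cases "m = 0") (auto simp: lookup_single in_keys_iff)
  qed
next
  assume "x = mconst (lk x 0)" then show "x \<in> mpolys 0" by (metis mpolys_mconst)
qed

lemma eqv_0_mconst: "eqv 0 (mconst a) (mconst b) \<longleftrightarrow> a - b \<in> range D"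
proof
  assume "eqv 0 (mconst a) (mconst b)"
  then obtain z where z: "z \<in> mpolys 0" "mconst a = mconst b + del 0 z" by (auto simp: eqv_alt)
  have "lk (mconst a) 0 = lk (mconst b + del 0 z) 0" by (simp only: z(2))
  then show "a - b \<in> range D" by (simp add: del_def lookup_add lookup_pmap)
next
  assume "a - b \<in> range D"
  then obtain x where "a = b + D x" by (metis add_diff_cancel_left' add_diff_eq diff_add_cancel imageE)
  then show "eqv 0 (mconst a) (mconst b)"
    unfolding eqv_alt by (intro bexI[of _ "mconst x"]) (auto simp: del_def Dm_mconst single_add)
qed

lemma closed_0:
  assumes y: "rc 0 e y" and c: "is_closed 0 e y" shows "\<exists>c. eqv 0 (y []) (mconst (scale c 1))"
proof -
  have "eqv 0 (\<Sum>i\<in>I. con e i (dF e y (pr i # []) (W i # []))) (\<Sum>i\<in>I. con e i 0)"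
    using c pr_le W_gr by (intro eqv_sum eqv_con) (auto simp: is_closed_def hom_list_def[of "[]" "[]"])
  then have 0: "eqv 0 (\<Sum>i\<in>I. con e i (dF e y (pr i # []) (W i # []))) 0"
    by (simp add: additive.zero[OF additive_con])
  have "hom_list [] []" by (simp add: hom_list_def)
  from homotopy[OF y _ this] have "eqv 0 (\<Sum>i\<in>I. con e i (dF e y (pr i # []) (W i # []))) (Em (y []))"
    by (simp add: Lop_def)
  from eqv_trans[OF eqv_sym[OF this] 0] have z: "eqv 0 (Em (y [])) (mconst 0)" by simp
  have m: "y [] = mconst (lk (y []) 0)" by (rule iffD1[OF mpolys_0_iff rc_mpolys[OF y]]) simp
  have "Em (y []) = mconst (E (lk (y []) 0))"
    using arg_cong[OF m, of Em] by (simp only: pmap_mconst[of E, OF E_0])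
  with z have "eqv 0 (mconst (E (lk (y []) 0))) (mconst 0)" by (simp only:)
  then obtain x where "E (lk (y []) 0) = D x" unfolding eqv_0_mconst by auto
  then obtain c z where "lk (y []) 0 = scale c 1 + D z" using E_exact by blast
  then have "eqv 0 (mconst (lk (y []) 0)) (mconst (scale c 1))" by (simp add: eqv_0_mconst)
  then show ?thesis using m by auto
qed

lemma cocycles_0: "cocycles 0 = {int_cochain (scale c 1) | c. True}"
proof
  show "cocycles 0 \<subseteq> {int_cochain (scale c 1) | c. True}"
  proof
    fix Y assume "Y \<in> cocycles 0"
    then obtain y0 y1 where y: "Y = toY 0 (\<lambda>as. y0 as + y1 as)" "rc 0 0 y0" "rc 0 1 y1" "is_closed 0 0 y0" "is_closed 0 1 y1"
      using cocycles_obtain by blast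
    obtain c d where cd: "eqv 0 (y0 []) (mconst (scale c 1))" "eqv 0 (y1 []) (mconst (scale d 1))"
      using closed_0 y by meson
    have "eqv 0 (y0 [] + y1 []) (mconst (scale (c + d) 1))"
      using eqv_add[OF cd] by (simp add: scale_left_distrib single_add)
    then have "Y = int_cochain (scale (c + d) 1)" unfolding y(1) int_cochain_toY toY_eq by simp
    then show "Y \<in> {int_cochain (scale c 1) | c. True}" by blast
  qed
  show "{int_cochain (scale c 1) | c. True} \<subseteq> cocycles 0"
  proof clarify
    fix c
    let ?y = "\<lambda>_. mconst (scale c 1) :: 'v mpoly"
    \<comment> \<open>The element 1 is even, so its class is odd for the opposite parity and belongs
      to the component e = 1.\<close>
    have y: "rc 0 1 ?y"
    proof (rule rcI)
      fix as :: "'v list" and ps :: "nat list"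
      have "homp 0 (mconst (scale c 1) :: 'v mpoly)"
        using one_even by (auto simp: homp_def lookup_single when_def gr_scale)
      then show "\<exists>x. eqv 0 x (mconst (scale c 1)) \<and> homp (opp ((1 + (\<Sum>i<0. opp (ps ! i))) mod 2)) x"
        by auto
    qed auto
    have "int_cochain (scale c 1) = toY 0 (\<lambda>as. 0 + ?y as)" by (simp add: int_cochain_toY)
    moreover have "d_PV 0 (toY 0 (\<lambda>as. 0 + ?y as)) = toY 1 (\<lambda>as. dd 0 0 (\<lambda>_. 0) as + dd 0 1 ?y as)"
      using d_PV_toY[OF rc_0 y] by simp
    moreover have "toY 1 (\<lambda>as. dd 0 0 (\<lambda>_. 0) as + dd 0 1 ?y as) = toY 1 (\<lambda>_. 0)"
      unfolding toY_eq
    proof (intro allI impI)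
      fix as :: "'v list" assume l: "length as = 1"
      have "dF 1 ?y ps bs = 0" if "length bs = 1" for ps and bs :: "'v list"
        using that by (simp add: dF_def t1_def bp_mconst br_scale_right additive.zero[OF additive_lev])
      then have "dd 0 1 ?y as = 0" unfolding dd_def using l by (intro sum.neutral) auto
      then show "eqv 1 (dd 0 0 (\<lambda>_. 0) as + dd 0 1 ?y as) 0" by (simp add: dd_def dF_0)
    qed
    moreover have "toY 0 (\<lambda>as. 0 + ?y as) \<in> cochains 0"
      unfolding cochains_eq using rc_0 y by (intro CollectI exI[of _ "\<lambda>_. 0"] exI[of _ ?y]) auto
    ultimately show "int_cochain (scale c 1) \<in> cocycles 0" by (simp add: cocycles_def toY_zero)
  qed
qed

lemma cohom_class_0: "cohom_class 0 (toY 0 y) = {toY 0 y}"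
  by (simp add: cohom_class_def coboundaries_def toY_zero toY_add)

lemma H_PV_0: "H_PV 0 = {cohom_class 0 (int_cochain (scale c 1)) | c. True}"
  unfolding H_PV_def cocycles_0 by blast

lemma int_one_nonzero: "cohom_class 0 (int_cochain 1) \<noteq> cohom_class 0 (cochain_zero 0)"
proof
  assume "cohom_class 0 (int_cochain 1) = cohom_class 0 (cochain_zero 0)"
  then have "eqv 0 (mconst 1) (mconst 0 :: 'v mpoly)"
    unfolding int_cochain_toY toY_zero cohom_class_0 by (auto simp: toY_eq)
  then have "1 \<in> range D" unfolding eqv_0_mconst by simp
  then show False using one_not_total_derivative by auto
qed

end

section \<open>Dual bases of the free superfermion algebra\<close>

context fermion_space begin

lemma form_sum_left: "form (\<Sum>x\<in>A. f x) b = (\<Sum>x\<in>A. form (f x) b)"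
  using additive.sum[of "\<lambda>a. form a b" f A] form_add_left by (auto simp: additive_def)

lemma form_sum_right: "form a (\<Sum>x\<in>A. f x) = (\<Sum>x\<in>A. form a (f x))"
  using additive.sum[of "\<lambda>b. form a b" f A] form_add_right by (auto simp: additive_def)

text \<open>For a homogeneous basis, a is sent to the combination of the basis with coefficients
  (a|b). Nondegeneracy makes this injective, hence surjective in finite dimension, and preimages of
  basis vectors are dual vectors.\<close>

lemma dual_bases:
  obtains B dl par where "finite B" "span B = UNIV" "span (dl ` B) = UNIV"
    "\<And>b. b \<in> B \<Longrightarrow> par b \<le> 1 \<and> b \<in> gr (par b) \<and> dl b \<in> gr (par b)"
    "\<And>b b'. b \<in> B \<Longrightarrow> b' \<in> B \<Longrightarrow> form (dl b) b' = (if b = b' then 1 else 0)"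
proof -
  \<comment> \<open>Maximality among homogeneous vectors makes all basis vectors
    homogeneous.\<close>
  obtain B where B: "B \<subseteq> gr 0 \<union> gr 1" "independent B" "gr 0 \<union> gr 1 \<subseteq> span B"
    using maximal_independent_subset[of "gr 0 \<union> gr 1"] by blast
  have sB: "span B = UNIV"
  proof -
    have "v \<in> span B" for v
    proof -
      obtain x y where "x \<in> gr 0" "y \<in> gr 1" "v = x + y" using gr_sum by blast
      then show ?thesis using B(3) by (auto intro: span_add)
    qed
    then show ?thesis by blast
  qed
  obtain T where T: "finite T" "span T = UNIV" using finite_dim by blast
  have fB: "finite B" using independent_span_bound[OF T(1) B(2)] T(2) by simp
  interpret fd: finite_dimensional_vector_space scale B
    by unfold_locales (use fB B(2) sB in auto)
  define par where "par b = (if b \<in> gr 0 then 0 else 1 :: nat)" for b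
  have par: "par b \<le> 1" "b \<in> gr (par b)" if "b \<in> B" for b using that B(1) by (auto simp: par_def)
  have form_B: "a = 0" if "\<And>b. b \<in> B \<Longrightarrow> form a b = 0" for a
  proof (rule form_nondegenerate)
    fix x
    have "x \<in> span B" using sB by simp
    then show "form a x = 0"
      by (induction rule: span_induct_alt) (use that form_add_right form_scale_right form_sum_right[of a "\<lambda>_. 0" "{}"] in auto)
  qed
  define F where "F a = (\<Sum>b\<in>B. scale (form a b) b)" for a
  have lin: "Vector_Spaces.linear scale scale F"
    by unfold_locales (auto simp: F_def form_add_left form_scale_left scale_left_distrib sum.distrib scale_sum_right)
  interpret F: Vector_Spaces.linear scale scale F by (rule lin)
  have coeffs: "\<forall>b\<in>B. c b = 0" if "(\<Sum>b\<in>B. scale (c b) b) = 0" for c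
    using B(2) fB that by (auto simp: independent_explicit_finite_subsets)
  have "inj F"
    unfolding F.inj_iff_eq_0
  proof (intro allI impI)
    fix a assume "F a = 0"
    then have "\<forall>b\<in>B. form a b = 0" unfolding F_def by (rule coeffs)
    then show "a = 0" by (intro form_B) simp
  qed
  then have "surj F" by (rule fd.linear_inj_imp_surj[OF lin])
  then obtain G where G: "\<And>b. F (G b) = b" by (metis surjD)
  have GB: "form (G b) b' = (if b = b' then 1 else 0)" if b: "b \<in> B" "b' \<in> B" for b b'
  proof -
    have "(\<Sum>x\<in>B. scale (form (G b) x - (if b = x then 1 else 0)) x) = F (G b) - (\<Sum>x\<in>B. if b = x then x else 0)"
      unfolding F_def sum_subtractf[symmetric] by (intro sum.cong refl) (auto simp: scale_left_diff_distrib)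
    also have "\<dots> = 0" using b fB by (simp add: G)
    finally show ?thesis using coeffs b(2) by fastforce
  qed
  \<comment> \<open>A preimage need not be homogeneous. The form vanishes between different
    parities, so the part of the right parity still has the dual pairings.\<close>
  define dl where "dl b = hpart (par b) (G b)" for b
  have dlB: "form (dl b) b' = (if b = b' then 1 else 0)" if b: "b \<in> B" "b' \<in> B" for b b'
  proof (cases "par b = par b'")
    case True
    have "1 - par b \<noteq> par b'" using par(1)[OF b(1)] True by (cases "par b = 0") auto
    then have "form (G b - dl b) b' = 0"
      using par[OF b(2)] par[OF b(1)] hpart_rest[of "par b" "G b"] True
      unfolding dl_def by (intro form_even[of "1 - par b" "par b'"]) auto
    moreover have "form (G b) b' = form (G b - dl b) b' + form (dl b) b'"
      by (simp flip: form_add_left)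
    ultimately show ?thesis using GB[OF b] by simp
  next
    case False
    then have "form (dl b) b' = 0"
      using par[OF b(2)] par[OF b(1)] hpart_in[of "par b" "G b"]
      unfolding dl_def by (intro form_even[of "par b" "par b'"]) auto
    then show ?thesis using False by auto
  qed
  have "a \<in> span (dl ` B)" for a
  proof -
    \<comment> \<open>The difference of a and its expansion in the dual vectors pairs to 0 with the
      basis, so it is 0.\<close>
    have "form (a - (\<Sum>b\<in>B. scale (form a b) (dl b))) b' = 0" if b': "b' \<in> B" for b'
    proof -
      have "form (\<Sum>b\<in>B. scale (form a b) (dl b)) b' = (\<Sum>b\<in>B. if b = b' then form a b else 0)"
        unfolding form_sum_left by (intro sum.cong refl) (auto simp: form_scale_left dlB b')
      also have "\<dots> = form a b'" using b' fB by simp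
      finally show ?thesis
        using form_add_left[of "a - (\<Sum>b\<in>B. scale (form a b) (dl b))" "\<Sum>b\<in>B. scale (form a b) (dl b)" b'] by simp
    qed
    then have "a - (\<Sum>b\<in>B. scale (form a b) (dl b)) = 0" by (rule form_B)
    then have "a = (\<Sum>b\<in>B. scale (form a b) (dl b))" by simp
    also have "\<dots> \<in> span (dl ` B)" by (intro span_sum span_scale span_base) auto
    finally show ?thesis .
  qed
  then have "span (dl ` B) = UNIV" by blast
  then show thesis
    using that[of B dl par] fB sB par dlB hpart_in unfolding dl_def by auto
qed

end

section \<open>Generators of the free superfermion algebra\<close>

context free_superfermion begin

lemma j_0: "j 0 = 0"
  using j_add[of 0 0] by simp

text \<open>The span of the monomials is closed under D and products. It contains j of constant
  polynomials, and by splitting off constant terms j of all; the words in these exhaust the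
  algebra.\<close>

lemma generated:
  assumes T: "h.span T = UNIV" "\<And>t. t \<in> T \<Longrightarrow> \<exists>p. j [:t:] \<in> G p"
  shows "v \<in> span {a. \<exists>p. hgen G p a}"
proof -
  let ?S = "span {a. \<exists>p. hgen G p a}"
  have D: "D x \<in> ?S" if "x \<in> ?S" for x
    using that
  proof (induction rule: span_induct_alt)
    case base show ?case by (simp add: span_zero)
  next
    case (step c x y)
    then have "D x \<in> ?S" by (auto intro!: span_base hgen_D)
    then show ?case using step by (simp add: D_add D_scale span_add span_scale)
  qed
  have m: "x * y \<in> ?S" if "x \<in> ?S" "y \<in> ?S" for x y
    using that(1)
  proof (induction rule: span_induct_alt)
    case base show ?case by (simp add: span_zero)
  next
    case (step c x x')
    then obtain p where x: "hgen G p x" by blast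
    have "x * y \<in> ?S" using that(2)
    proof (induction rule: span_induct_alt)
      case base show ?case by (simp add: span_zero)
    next
      case (step d y y')
      then obtain q where "hgen G q y" by blast
      then have "x * y \<in> ?S" using x by (auto intro!: span_base hgen_mult)
      then show ?case using step by (simp add: distrib_left scale_mult_right[symmetric] span_add span_scale)
    qed
    then show ?case using step by (simp add: distrib_right scale_mult_left[symmetric] span_add span_scale)
  qed
  have one: "1 \<in> ?S" by (auto intro!: span_base hgen_one)
  have js: "j [:a:] \<in> ?S" for a
  proof -
    have "a \<in> h.span T" using T(1) by simp
    then show ?thesis
    proof (induction rule: h.span_induct_alt)
      case base show ?case by (simp add: j_0 span_zero)
    next
      case (step c x y)
      have "[:scaleh c x + y:] = map_poly (scaleh c) [:x:] + [:y:]" by (simp add: map_poly_pCons)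
      then have "j [:scaleh c x + y:] = scale c (j [:x:]) + j [:y:]" by (simp only: j_add j_scale)
      moreover have "j [:x:] \<in> ?S" using T(2)[OF step(1)] by (auto intro!: span_base hgen_gen)
      ultimately show ?case using step by (simp add: span_add span_scale)
    qed
  qed
  have jS: "j x \<in> ?S" for x
  proof (induction x)
    case 0 show ?case by (simp add: j_0 span_zero)
  next
    case (pCons a p)
    have "pCons a p = [:a:] + pCons 0 p" by simp
    then have "j (pCons a p) = j [:a:] + D (j p)" by (simp only: j_add D_gen)
    then show ?case using js D[OF pCons(2)] by (simp add: span_add)
  qed
  have "prod_list (map j w) \<in> ?S" for w
    by (induction w) (auto simp: one intro: m jS)
  then have "word_eval scale j t \<in> ?S" for t
    unfolding word_eval_def by (intro span_sum span_scale)
  then show ?thesis using word_eval_surj by (metis surjD)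
qed

lemma dual_system_exists: "\<exists>(B :: 'h set) U W pr. dual_system scale gr D br B U W pr"
proof -
  obtain B dl par where B: "finite B" "h.span B = UNIV" "h.span (dl ` B) = UNIV"
    "\<And>b. b \<in> B \<Longrightarrow> par b \<le> 1 \<and> b \<in> grh (par b) \<and> dl b \<in> grh (par b)"
    "\<And>b b'. b \<in> B \<Longrightarrow> b' \<in> B \<Longrightarrow> form (dl b) b' = (if b = b' then 1 else 0)"
    using h.dual_bases by metis
  have jg: "j [:a:] \<in> gr p" if "p \<le> 1" "a \<in> grh p" for a p
    using that by (intro j_even) (auto simp: coeff_pCons split: nat.splits)
  \<comment> \<open>The bracket of generators is the form, so a basis and its left dual become the U
    i and W i.\<close>
  have "dual_system scale gr D br B (\<lambda>b. j [:b:]) (\<lambda>b. j [:dl b:]) par"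
  proof unfold_locales
    show "v \<in> span {a. \<exists>p. hgen (\<lambda>p. {j [:i:] |i. i \<in> B \<and> par i = p}) p a}" for v
      by (rule generated[OF B(2)]) blast
    show "v \<in> span {a. \<exists>p. hgen (\<lambda>p. {j [:dl i:] |i. i \<in> B \<and> par i = p}) p a}" for v
      by (rule generated[OF B(3)]) blast
  qed (use B jg in \<open>auto simp: br_gen\<close>)
  then show ?thesis by blast
qed

end

theorem theorem4p7:
  fixes scaleh :: "'f::field_char_0 \<Rightarrow> 'h::ab_group_add \<Rightarrow> 'h" and grh :: "nat \<Rightarrow> 'h set"
    and form :: "'h \<Rightarrow> 'h \<Rightarrow> 'f"
    and scale :: "'f \<Rightarrow> 'v::ring_1 \<Rightarrow> 'v" and gr :: "nat \<Rightarrow> 'v set"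
    and D :: "'v \<Rightarrow> 'v" and br :: "'v \<Rightarrow> 'v \<Rightarrow> 'v lpoly"
    and j :: "'h poly \<Rightarrow> 'v"
  assumes "free_superfermion scaleh grh form scale gr D br j"
  shows "poisson_vertex_superalgebra.H_PV scale gr D br 0 =
      {poisson_vertex_superalgebra.cohom_class scale gr D br 0
         (poisson_vertex_superalgebra.int_cochain D (scale c 1)) | c. True}
    \<and> poisson_vertex_superalgebra.cohom_class scale gr D br 0
           (poisson_vertex_superalgebra.int_cochain D 1) \<noteq>
         poisson_vertex_superalgebra.cohom_class scale gr D br 0
           (poisson_vertex_superalgebra.cochain_zero D 0)
    \<and> (\<forall>n\<ge>1. poisson_vertex_superalgebra.H_PV scale gr D br n =
      {poisson_vertex_superalgebra.cohom_class scale gr D br n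
         (poisson_vertex_superalgebra.cochain_zero D n)})"
proof -
  obtain B :: "'h set" and U W pr where "dual_system scale gr D br B U W pr"
    using free_superfermion.dual_system_exists[OF assms] by blast
  then interpret dual_system scale gr D br B U W pr .
  show ?thesis using H_PV_0 int_one_nonzero H_PV_Suc by (auto simp: Suc_le_eq gr0_conv_Suc)
qed

end
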